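(* Let $\mathfrak K\subset\mathbb R^d$ and let $0<\eta\le k<\gamma$, where $k$ is an integer. There exists a unique linear map $$\mathcal I: C_{2,k}^{\eta,\gamma}(\mathfrak K)\to \Omega^k(\mathfrak K)$$ satisfying $$|\mathcal I\Xi(\sigma)-\Xi(\sigma)|\lesssim \llbracket\delta\Xi\rrbracket_{\gamma,\mathfrak K}\,\mathrm{diam}(\sigma)^\gamma,\qquad |\mathcal I\Xi(\sigma)|\lesssim \llbracket\Xi\rrbracket_{(\eta,\gamma);\mathfrak K}\,\mathrm{diam}(\sigma)^\eta,$$ uniformly in $\sigma\in\mathfrak X^k_{\le1}(\mathfrak K)$. Furthermore, for any regular sequence of subdivisions $(\mathcal K_n)_{n\in\mathbb N}$ of $\sigma\in\mathfrak X^k(\mathfrak K)$, $$\mathcal I\Xi(\sigma)=\lim_{n\to\infty}\sum_{\sigma'\in\mathcal K_n}\Xi(\sigma').$$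
   Context: $\mathbb R^d$ carries a fixed norm, used for distances and diameters; $\mathrm{Vol}^k$ is $k$-dimensional Hausdorff measure. A $k$-simplex is the convex hull of affinely independent $v_0,\dots,v_k\in\mathbb R^d$ (its vertices). An oriented $k$-simplex $[v_0,\dots,v_k]$ is a $k$-simplex together with an ordering of its vertices modulo even permutations; $-\sigma$ is $\sigma$ with the opposite orientation. An orientation is identified with an orientation of the $k$-plane containing the simplex, so orientations of simplices in the same $k$-plane can be compared. $\mathfrak X^k(\mathfrak K)$ is the set of oriented $k$-simplices contained in $\mathfrak K$, and $\mathfrak X^k_{\le 1}(\mathfrak K)$ the subset of those of diameter at most $1$. A subdivision $\mathcal K$ of $\sigma$ (written $\mathcal K|\sigma$) is a finite set of oriented $k$-simplices, all with the same orientation as $\sigma$, with pairwise intersections of zero $\mathrm{Vol}^k$-measure, whose union is $\sigma$; $|\mathcal K|$ is its cardinality. A sequence $(\mathcal K_n)$ of subdivisions of $\sigma$ is regular if $\lim_{n}\sum_{w\in\mathcal K_n}\mathrm{diam}(w)^\beta=0$ for every $\beta>k$. $\Omega^k(\mathfrak K)$ is the space of maps $A:\mathfrak X^k(\mathfrak K)\to\mathbb R$ with $A(-\sigma)=-A(\sigma)$, with $A(\sigma)=\sum_{\tau\in\mathcal K}A(\tau)$ for every $\mathcal K|\sigma$, and such that $(v_0,\dots,v_k)\mapsto A([v_0,\dots,v_k])$ is Borel measurable. $C^{\eta,\gamma}_{2,k}(\mathfrak K)$ is the space of all functions $\Xi:\mathfrak X^k(\mathfrak K)\to\mathbb R$ with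 $\Xi(\sigma)=-\Xi(-\sigma)$ and $\llbracket\Xi\rrbracket_{(\eta,\gamma);\mathfrak K}:=\llbracket\Xi\rrbracket_{\eta,\mathfrak K}+\llbracket\delta\Xi\rrbracket_{\gamma,\mathfrak K}<\infty$, where $$\llbracket\Xi\rrbracket_{\eta,\mathfrak K}:=\sup_{\sigma\in\mathfrak X^k(\mathfrak K)}\frac{|\Xi(\sigma)|}{\mathrm{diam}(\sigma)^\eta},\qquad \llbracket\delta\Xi\rrbracket_{\gamma,\mathfrak K}:=\sup_{\sigma\in\mathfrak X^k(\mathfrak K)}\sup_{\mathcal K|\sigma}\frac{\big|\Xi(\sigma)-\sum_{\sigma'\in\mathcal K}\Xi(\sigma')\big|}{|\mathcal K|\,\mathrm{diam}(\sigma)^\gamma},$$ the supremum over $\mathcal K|\sigma$ running over all subdivisions of $\sigma$. The symbol $\lesssim$ means inequality up to a multiplicative constant that is uniform over the stated quantities.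
   Formalization: For non-Borel Ξ the map IΞ can fail to be Borel measurable, so the claim with target Ω^k is stated for Ξ that are Borel measurable in the vertices; for all Ξ in C_{2,k}^{η,γ} the same claim is stated with measurability dropped from the target. *)

theory Defs
  imports "Jordan_Normal_Form.Determinant" "HOL-Analysis.Analysis"
begin

(* An arbitrary norm N on the space; it need not be the Euclidean norm of the type class.
   Since all norms are equivalent, the topology and the Borel sets are those of the type. *)
definition is_norm :: "('a::euclidean_space \<Rightarrow> real) \<Rightarrow> bool" where
  "is_norm N \<longleftrightarrow>
     (\<forall>x. 0 \<le> N x) \<and> (\<forall>x. N x = 0 \<longleftrightarrow> x = 0) \<and>
     (\<forall>c x. N (c *\<^sub>R x) = \<bar>c\<bar> * N x) \<and> (\<forall>x y. N (x + y) \<le> N x + N y)"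

definition ediam :: "('a::euclidean_space \<Rightarrow> real) \<Rightarrow> 'a set \<Rightarrow> ennreal" where
  "ediam N S = (SUP x\<in>S. SUP y\<in>S. ennreal (N (x - y)))"

(* k-dimensional Hausdorff (outer) measure for the metric of N, without a normalising constant.
   The empty set contributes 0 to a cover also when k = 0. *)
definition hausdorff_pre ::
    "('a::euclidean_space \<Rightarrow> real) \<Rightarrow> nat \<Rightarrow> real \<Rightarrow> 'a set \<Rightarrow> ennreal" where
  "hausdorff_pre N k \<delta> A =
     (INF C\<in>{C :: nat \<Rightarrow> 'a set. A \<subseteq> (\<Union>i. C i) \<and> (\<forall>i. ediam N (C i) \<le> ennreal \<delta>)}.
        \<Sum>i. (if C i = {} then 0 else ediam N (C i) ^ k))"

definition Vol :: "('a::euclidean_space \<Rightarrow> real) \<Rightarrow> nat \<Rightarrow> 'a set \<Rightarrow> ennreal" where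
  "Vol N k A = (SUP \<delta>\<in>{0<..}. hausdorff_pre N k \<delta> A)"

definition simplex_vertices :: "nat \<Rightarrow> 'a::euclidean_space list \<Rightarrow> bool" where
  "simplex_vertices k vs \<longleftrightarrow>
     length vs = Suc k \<and> distinct vs \<and> \<not> affine_dependent (set vs)"

(* An oriented simplex is an ordering of its vertices modulo even permutations, i.e. the
   equivalence class consisting of all even rearrangements of a vertex list. *)
type_synonym 'a osimplex = "'a list set"

definition osimplex :: "'a list \<Rightarrow> 'a osimplex" where
  "osimplex vs = {permute_list p vs | p. p permutes {..<length vs} \<and> evenperm p}"

definition opposite :: "'a osimplex \<Rightarrow> 'a osimplex" where
  "opposite \<sigma> =
     {permute_list p vs | p vs. vs \<in> \<sigma> \<and> p permutes {..<length vs} \<and> \<not> evenperm p}"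

definition carrier_of :: "'a::euclidean_space osimplex \<Rightarrow> 'a set" where
  "carrier_of \<sigma> = convex hull (\<Union>vs\<in>\<sigma>. set vs)"

definition diam :: "('a::euclidean_space \<Rightarrow> real) \<Rightarrow> 'a osimplex \<Rightarrow> real" where
  "diam N \<sigma> = enn2real (ediam N (carrier_of \<sigma>))"

definition simplices :: "nat \<Rightarrow> 'a::euclidean_space set \<Rightarrow> 'a osimplex set" where
  "simplices k K =
     {osimplex vs | vs. simplex_vertices k vs \<and> convex hull (set vs) \<subseteq> K}"

definition simplices_le1 ::
    "('a::euclidean_space \<Rightarrow> real) \<Rightarrow> nat \<Rightarrow> 'a set \<Rightarrow> 'a osimplex set" where
  "simplices_le1 N k K = {\<sigma> \<in> simplices k K. diam N \<sigma> \<le> 1}"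

(* Both simplices span the same k-plane, and the matrix expressing the edge basis
   w_1 - w_0, ..., w_k - w_0 in terms of v_1 - v_0, ..., v_k - v_0 has positive determinant.
   This does not depend on the representatives vs and ws. *)
definition same_orientation ::
    "nat \<Rightarrow> 'a::euclidean_space osimplex \<Rightarrow> 'a osimplex \<Rightarrow> bool" where
  "same_orientation k \<sigma> \<tau> \<longleftrightarrow>
     (\<exists>vs\<in>\<sigma>. \<exists>ws\<in>\<tau>. affine hull (set vs) = affine hull (set ws) \<and>
        (\<exists>M \<in> carrier_mat k k.
           (\<forall>i<k. ws ! Suc i - ws ! 0 = (\<Sum>j<k. (M $$ (i, j)) *\<^sub>R (vs ! Suc j - vs ! 0))) \<and>
           Determinant.det M > (0::real)))"

definition subdivision ::
    "('a::euclidean_space \<Rightarrow> real) \<Rightarrow> nat \<Rightarrow> 'a osimplex \<Rightarrow> 'a osimplex set \<Rightarrow> bool" where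
  "subdivision N k \<sigma> P \<longleftrightarrow>
     finite P \<and> P \<subseteq> simplices k UNIV \<and>
     (\<forall>\<tau>\<in>P. same_orientation k \<sigma> \<tau>) \<and>
     (\<forall>\<tau>\<in>P. \<forall>\<tau>'\<in>P. \<tau> \<noteq> \<tau>' \<longrightarrow> Vol N k (carrier_of \<tau> \<inter> carrier_of \<tau>') = 0) \<and>
     (\<Union>\<tau>\<in>P. carrier_of \<tau>) = carrier_of \<sigma>"

definition regular_subdivisions ::
    "('a::euclidean_space \<Rightarrow> real) \<Rightarrow> nat \<Rightarrow> 'a osimplex \<Rightarrow> (nat \<Rightarrow> 'a osimplex set) \<Rightarrow> bool" where
  "regular_subdivisions N k \<sigma> P \<longleftrightarrow>
     (\<forall>n. subdivision N k \<sigma> (P n)) \<and>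
     (\<forall>\<beta>::real. \<beta> > real k \<longrightarrow> (\<lambda>n. \<Sum>w\<in>P n. diam N w powr \<beta>) \<longlonglongrightarrow> 0)"

(* A real function on the k-simplices of K is represented by its extension by 0 to the whole
   type, so that equality and the vector space operations are the pointwise ones. *)
definition alternating :: "nat \<Rightarrow> 'a::euclidean_space set \<Rightarrow> ('a osimplex \<Rightarrow> real) \<Rightarrow> bool" where
  "alternating k K A \<longleftrightarrow>
     (\<forall>\<sigma>. \<sigma> \<notin> simplices k K \<longrightarrow> A \<sigma> = 0) \<and>
     (\<forall>\<sigma>\<in>simplices k K. A (opposite \<sigma>) = - A \<sigma>)"

(* Vertex tuples are functions in the extensional product over the indices {..k}; the product
   sigma-algebra is the Borel sigma-algebra, and it is traced on the set of tuples that
   actually span a k-simplex contained in K. *)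
definition measurable_cochain ::
    "nat \<Rightarrow> 'a::euclidean_space set \<Rightarrow> ('a osimplex \<Rightarrow> real) \<Rightarrow> bool" where
  "measurable_cochain k K A \<longleftrightarrow>
     (\<lambda>v. A (osimplex (map v [0..<Suc k]))) \<in> borel_measurable
       (restrict_space (Pi\<^sub>M {..k} (\<lambda>_. borel))
          {v. simplex_vertices k (map v [0..<Suc k]) \<and> convex hull (v ` {..k}) \<subseteq> K})"

definition additive_cochains ::
    "('a::euclidean_space \<Rightarrow> real) \<Rightarrow> nat \<Rightarrow> 'a set \<Rightarrow> ('a osimplex \<Rightarrow> real) set" where
  "additive_cochains N k K =
     {A. alternating k K A \<and>
         (\<forall>\<sigma>\<in>simplices k K. \<forall>P. subdivision N k \<sigma> P \<longrightarrow> A \<sigma> = (\<Sum>\<tau>\<in>P. A \<tau>))}"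

definition Omega ::
    "('a::euclidean_space \<Rightarrow> real) \<Rightarrow> nat \<Rightarrow> 'a set \<Rightarrow> ('a osimplex \<Rightarrow> real) set" where
  "Omega N k K = {A \<in> additive_cochains N k K. measurable_cochain k K A}"

(* The seminorms are ennreal-valued: suprema may be infinite, and are 0 if there is no
   k-simplex in K. *)
definition seminorm_eta ::
    "('a::euclidean_space \<Rightarrow> real) \<Rightarrow> nat \<Rightarrow> 'a set \<Rightarrow> real \<Rightarrow> ('a osimplex \<Rightarrow> real) \<Rightarrow> ennreal" where
  "seminorm_eta N k K \<eta> \<Xi> = (SUP \<sigma>\<in>simplices k K. ennreal (\<bar>\<Xi> \<sigma>\<bar> / diam N \<sigma> powr \<eta>))"

definition seminorm_delta ::
    "('a::euclidean_space \<Rightarrow> real) \<Rightarrow> nat \<Rightarrow> 'a set \<Rightarrow> real \<Rightarrow> ('a osimplex \<Rightarrow> real) \<Rightarrow> ennreal" where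
  "seminorm_delta N k K \<gamma> \<Xi> =
     (SUP \<sigma>\<in>simplices k K. SUP P\<in>{P. subdivision N k \<sigma> P}.
        ennreal (\<bar>\<Xi> \<sigma> - (\<Sum>\<sigma>'\<in>P. \<Xi> \<sigma>')\<bar> / (real (card P) * diam N \<sigma> powr \<gamma>)))"

definition seminorm_eta_gamma ::
    "('a::euclidean_space \<Rightarrow> real) \<Rightarrow> nat \<Rightarrow> 'a set \<Rightarrow> real \<Rightarrow> real \<Rightarrow> ('a osimplex \<Rightarrow> real) \<Rightarrow> ennreal"
  where
  "seminorm_eta_gamma N k K \<eta> \<gamma> \<Xi> = seminorm_eta N k K \<eta> \<Xi> + seminorm_delta N k K \<gamma> \<Xi>"

definition C2 ::
    "('a::euclidean_space \<Rightarrow> real) \<Rightarrow> nat \<Rightarrow> 'a set \<Rightarrow> real \<Rightarrow> real \<Rightarrow> ('a osimplex \<Rightarrow> real) set" where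
  "C2 N k K \<eta> \<gamma> = {\<Xi>. alternating k K \<Xi> \<and> seminorm_eta_gamma N k K \<eta> \<gamma> \<Xi> < \<infinity>}"

(* Omega requires Borel measurability, which additive limits of arbitrary germs need not have:
   for k = 1 in the plane and a set E of reals, let \<Xi> [x, y] be the horizontal component of
   y - x if x and y lie on a common horizontal line of height in E, and 0 otherwise. It is
   additive and has finite seminorms for \<eta> = 1, but is not measurable unless E is Borel. Hence
   maps into Omega are considered on the measurable germs. *)
definition C2_measurable ::
    "('a::euclidean_space \<Rightarrow> real) \<Rightarrow> nat \<Rightarrow> 'a set \<Rightarrow> real \<Rightarrow> real \<Rightarrow> ('a osimplex \<Rightarrow> real) set" where
  "C2_measurable N k K \<eta> \<gamma> = {\<Xi> \<in> C2 N k K \<eta> \<gamma>. measurable_cochain k K \<Xi>}"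

definition linear_between ::
    "('b \<Rightarrow> real) set \<Rightarrow> ('b \<Rightarrow> real) set \<Rightarrow> (('b \<Rightarrow> real) \<Rightarrow> ('b \<Rightarrow> real)) \<Rightarrow> bool" where
  "linear_between V W I \<longleftrightarrow>
     I \<in> V \<rightarrow>\<^sub>E W \<and>
     (\<forall>f\<in>V. \<forall>g\<in>V. I (\<lambda>x. f x + g x) = (\<lambda>x. I f x + I g x)) \<and>
     (\<forall>c. \<forall>f\<in>V. I (\<lambda>x. c * f x) = (\<lambda>x. c * I f x))"

(* The implicit constants are uniform in both the germ and the simplex. *)
definition sewing_bounds ::
    "('a::euclidean_space \<Rightarrow> real) \<Rightarrow> nat \<Rightarrow> 'a set \<Rightarrow> real \<Rightarrow> real \<Rightarrow> ('a osimplex \<Rightarrow> real) set \<Rightarrow>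
     (('a osimplex \<Rightarrow> real) \<Rightarrow> ('a osimplex \<Rightarrow> real)) \<Rightarrow> bool" where
  "sewing_bounds N k K \<eta> \<gamma> V I \<longleftrightarrow>
     (\<exists>c::real. \<forall>\<Xi>\<in>V. \<forall>\<sigma>\<in>simplices_le1 N k K.
        \<bar>I \<Xi> \<sigma> - \<Xi> \<sigma>\<bar> \<le> c * enn2real (seminorm_delta N k K \<gamma> \<Xi>) * diam N \<sigma> powr \<gamma>) \<and>
     (\<exists>c::real. \<forall>\<Xi>\<in>V. \<forall>\<sigma>\<in>simplices_le1 N k K.
        \<bar>I \<Xi> \<sigma>\<bar> \<le> c * enn2real (seminorm_eta_gamma N k K \<eta> \<gamma> \<Xi>) * diam N \<sigma> powr \<eta>)"

end

theory Submission
  imports Defs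
begin

text \<open>Cutting an edge \<open>v\<^sub>i v\<^sub>j\<close> of a simplex at an inner point yields two simplices, obtained by
  replacing \<open>v\<^sub>i\<close> or \<open>v\<^sub>j\<close> by that point. Bisection with Maubach's choice of edges produces, after
  \<open>k n\<close> generations, \<open>2\<^bsup>k n\<^esup>\<close> cells of diameter at most \<open>k 2\<^bsup>-n\<^esup> diam \<sigma>\<close> with vertices in a
  lattice of scale \<open>2\<^bsup>-n\<^esup>\<close>. Since \<open>\<gamma> > k\<close>, the sums of \<open>\<Xi>\<close> over these cells converge geometrically,
  which gives the value of the sewing map and the bound on \<open>\<bar>\<I>\<Xi>(\<sigma>) - \<Xi>(\<sigma>)\<bar>\<close>.

  For additivity over a subdivision \<open>P\<close> of \<open>\<sigma>\<close>, compare the cells of \<open>\<sigma>\<close> with the cells of all members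
  of \<open>P\<close> through their common refinement. By the lattice structure each cell meets boundedly many
  cells of the other kind, and the intersection of two cells is cut into boundedly many simplices
  by repeatedly cutting edges at the zeros of barycentric coordinates. So the refinement has \<open>O(2\<^bsup>k n\<^esup>)\<close>
  pieces and the two sums differ by \<open>O(2\<^bsup>(k - \<gamma>) n\<^esup>)\<close>.

  Any additive map which is \<open>\<gamma>\<close>-close to \<open>\<Xi>\<close> on small simplices is the limit of the sums of \<open>\<Xi>\<close> along
  every regular sequence of subdivisions. This gives uniqueness and the compatibility with opposite
  orientations.\<close>

section \<open>Cutting simplices along edges\<close>

text \<open>Since \<open>seminorm_delta\<close> divides by the number of pieces, errors are paid per
  piece: the cell count times diam^\<gamma> has to tend to zero for every \<gamma> > k. Barycentric
  subdivision does not guarantee this: for k >= 2 it has (k+1)! cells against a diameter factor of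
  only k/(k+1). Bisection has 2^k cells against 1/2 per generation, up to the fixed constant k.

  Members of an arbitrary subdivision need not meet face to face, so cells w and w' may intersect in
  a lower-dimensional set. Pieces of w not inside w' are discarded; they meet w' only on finitely
  many hyperplanes, so the pieces kept cover a dense part, and closedness does the rest.

  Hausdorff measure enters twice. Hulls of k points are null, which turns cut simplices into
  subdivisions. Simplices of dimension k are not null, so different positions in a list of pieces
  give different oriented simplices, and lists can be counted and summed as sets.

  All constructions act on vertex lists, so the limit could a priori depend on the chosen order of
  the vertices. That it does not is a consequence of additivity, not an input to it.\<close>

lemma convex_hull_list:
  fixes vs :: "'a::real_vector list"
  shows "convex hull (set vs) =
    {\<Sum>i<length vs. c i *\<^sub>R vs ! i | c.
      (\<forall>i<length vs. 0 \<le> c i) \<and> (\<Sum>i<length vs. c i) = (1::real)}"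
    (is "_ = ?R")
proof
  have "convex ?R"
  proof (rule convexI)
    fix x y u v assume "x \<in> ?R" "y \<in> ?R" and uv: "0 \<le> u" "0 \<le> v" "u + v = (1::real)"
    then obtain c d where c: "\<forall>i<length vs. 0 \<le> c i" "(\<Sum>i<length vs. c i) = (1::real)"
      "x = (\<Sum>i<length vs. c i *\<^sub>R vs ! i)"
      and d: "\<forall>i<length vs. 0 \<le> d i" "(\<Sum>i<length vs. d i) = (1::real)"
      "y = (\<Sum>i<length vs. d i *\<^sub>R vs ! i)" by blast
    have "u *\<^sub>R x + v *\<^sub>R y = (\<Sum>i<length vs. (u * c i + v * d i) *\<^sub>R vs ! i)"
      by (simp add: c d scaleR_sum_right sum.distrib scaleR_add_left)
    moreover have "\<forall>i<length vs. 0 \<le> u * c i + v * d i"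
      using c d uv by simp
    moreover have "(\<Sum>i<length vs. u * c i + v * d i) = 1"
      using c d uv by (simp add: sum.distrib flip: sum_distrib_left)
    ultimately show "u *\<^sub>R x + v *\<^sub>R y \<in> ?R"
      unfolding mem_Collect_eq by (intro exI[of _ "\<lambda>i. u * c i + v * d i"]) simp
  qed
  moreover have "set vs \<subseteq> ?R"
  proof
    fix x assume "x \<in> set vs"
    then obtain m where m: "m < length vs" "x = vs ! m" by (auto simp: in_set_conv_nth)
    define c where "c = (\<lambda>i. if i = m then 1 else 0 :: real)"
    have "(\<Sum>i<length vs. c i *\<^sub>R vs ! i) = (\<Sum>i<length vs. if m = i then vs ! i else 0)"
      by (rule sum.cong) (auto simp: c_def)
    then have "x = (\<Sum>i<length vs. c i *\<^sub>R vs ! i)"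
      using m by simp
    moreover have "(\<Sum>i<length vs. c i) = 1" "\<forall>i<length vs. 0 \<le> c i"
      using m by (auto simp: c_def)
    ultimately show "x \<in> ?R" by blast
  qed
  ultimately show "convex hull (set vs) \<subseteq> ?R"
    by (intro hull_minimal)
  show "?R \<subseteq> convex hull (set vs)"
  proof
    fix x assume "x \<in> ?R"
    then obtain c where c: "\<forall>i<length vs. 0 \<le> c i" "(\<Sum>i<length vs. c i) = (1::real)"
      and x: "x = (\<Sum>i<length vs. c i *\<^sub>R vs ! i)" by blast
    show "x \<in> convex hull (set vs)"
      unfolding x by (rule convex_sum) (use c in \<open>simp_all add: hull_inc\<close>)
  qed
qed

lemma sum_split_two:
  fixes f :: "nat \<Rightarrow> 'b::comm_monoid_add"
  assumes "i < n" "j < n" "i \<noteq> j"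
  shows "sum f {..<n} = f i + f j + sum f ({..<n} - {i, j})"
proof -
  have "{..<n} = insert i (insert j ({..<n} - {i, j}))" using assms by auto
  then have "sum f {..<n} = sum f (insert i (insert j ({..<n} - {i, j})))" by simp
  then show ?thesis using assms by (simp add: add.assoc)
qed

text \<open>Substituting \<open>vs ! i\<close> by its expression through \<open>z\<close> and
  \<open>vs ! j\<close> turns the coefficients \<open>c\<close> into \<open>d\<close>. Only the
  coefficient at \<open>j\<close> could become negative, and \<open>le\<close> says exactly that it
  does not.\<close>

lemma half_cut_mem:
  fixes vs :: "'a::real_vector list"
  assumes ij: "i < length vs" "j < length vs" "i \<noteq> j" and t: "0 < t" "t < 1"
    and z: "z = (1 - t) *\<^sub>R vs ! i + t *\<^sub>R vs ! j"
    and c: "\<forall>i<length vs. 0 \<le> c i" "(\<Sum>i<length vs. c i) = (1::real)"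
    and le: "t * c i \<le> (1 - t) * c j"
  shows "(\<Sum>i<length vs. c i *\<^sub>R vs ! i) \<in> convex hull (set (vs[i := z]))"
proof -
  define d where "d = c(i := c i / (1 - t), j := c j - t * c i / (1 - t))"
  let ?ws = "vs[i := z]"
  have "d i + d j = c i / (1 - t) * (1 - t) + c j"
    using ij by (simp add: d_def algebra_simps diff_divide_distrib)
  then have "d i + d j = c i + c j" using t by simp
  moreover have "(\<Sum>m\<in>{..<length vs} - {i, j}. d m) = (\<Sum>m\<in>{..<length vs} - {i, j}. c m)"
    by (rule sum.cong) (auto simp: d_def)
  ultimately have "(\<Sum>m<length vs. d m) = 1"
    using c(2) unfolding sum_split_two[OF ij] by simp
  moreover have "\<forall>m<length vs. 0 \<le> d m"
    using c(1) ij t le by (auto simp: d_def field_simps)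
  moreover have "(\<Sum>i<length vs. c i *\<^sub>R vs ! i) = (\<Sum>m<length vs. d m *\<^sub>R ?ws ! m)"
  proof -
    have "d i *\<^sub>R ?ws ! i + d j *\<^sub>R ?ws ! j = c i *\<^sub>R vs ! i + c j *\<^sub>R vs ! j"
    proof -
      define q where "q = c i / (1 - t)"
      have q: "q * (1 - t) = c i" "t * c i / (1 - t) = q * t" using t by (simp_all add: q_def)
      have "d i *\<^sub>R ?ws ! i + d j *\<^sub>R ?ws ! j
          = q *\<^sub>R ((1 - t) *\<^sub>R vs ! i + t *\<^sub>R vs ! j) + (c j - q * t) *\<^sub>R vs ! j"
        using ij by (simp add: d_def z q(2) flip: q_def)
      also have "\<dots> = (q * (1 - t)) *\<^sub>R vs ! i + c j *\<^sub>R vs ! j"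
        by (simp add: algebra_simps)
      finally show ?thesis unfolding q(1) .
    qed
    moreover have "(\<Sum>m\<in>{..<length vs} - {i, j}. d m *\<^sub>R ?ws ! m)
        = (\<Sum>m\<in>{..<length vs} - {i, j}. c m *\<^sub>R vs ! m)"
      by (rule sum.cong) (auto simp: d_def)
    ultimately show ?thesis
      unfolding sum_split_two[OF ij] by simp
  qed
  ultimately show ?thesis
    unfolding convex_hull_list by (auto intro!: exI[of _ d])
qed

text \<open>The sign of \<open>t * c i - (1 - t) * c j\<close> decides into which half a point
  falls. The second half is the first one with \<open>i\<close>, \<open>j\<close> and
  \<open>t\<close>, \<open>1 - t\<close> exchanged.\<close>

lemma convex_hull_edge_cut:
  fixes vs :: "'a::real_vector list"
  assumes ij: "i < length vs" "j < length vs" "i \<noteq> j" and t: "0 < t" "t < 1"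
    and z: "z = (1 - t) *\<^sub>R vs ! i + t *\<^sub>R vs ! j"
  shows "convex hull (set vs) = convex hull (set (vs[i := z])) \<union> convex hull (set (vs[j := z]))"
proof (intro equalityI subsetI)
  fix x assume "x \<in> convex hull (set vs)"
  then obtain c where c: "\<forall>i<length vs. 0 \<le> c i" "(\<Sum>i<length vs. c i) = (1::real)"
    and x: "x = (\<Sum>i<length vs. c i *\<^sub>R vs ! i)" unfolding convex_hull_list by auto
  show "x \<in> convex hull (set (vs[i := z])) \<union> convex hull (set (vs[j := z]))"
  proof (cases "t * c i \<le> (1 - t) * c j")
    case True
    show ?thesis using half_cut_mem[OF ij t z c True] x by simp
  next
    case False
    then show ?thesis
      using half_cut_mem[OF ij(2,1) ij(3)[symmetric], of "1 - t" z c] t c z x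
      by (simp add: add.commute)
  qed
next
  fix x assume x: "x \<in> convex hull (set (vs[i := z])) \<union> convex hull (set (vs[j := z]))"
  have zin: "z \<in> convex hull (set vs)"
    unfolding z using ij t by (intro convexD[OF convex_convex_hull]) (auto intro!: hull_inc)
  have "set (vs[m := z]) \<subseteq> convex hull (set vs)" for m
    using set_update_subset_insert[of vs m z] zin hull_subset[of "set vs" convex] by blast
  then have "convex hull (set (vs[m := z])) \<subseteq> convex hull (set vs)" for m
    by (rule hull_minimal) (rule convex_convex_hull)
  then show "x \<in> convex hull (set vs)" using x by blast
qed

text \<open>A binary tree of edge cuts of which only the leaves are kept. The cut point takes over
  the position of the vertex it replaces, so orientations remain comparable, and in a list equal
  leaves would still count separately. Taking \<open>t\<close> strictly between 0 and 1 keeps both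
  halves nondegenerate.\<close>

inductive dissect :: "'a::real_vector list \<Rightarrow> 'a list list \<Rightarrow> bool" where
  trivial: "dissect vs [vs]"
| cut: "\<lbrakk>i < length vs; j < length vs; i \<noteq> j; 0 < t; t < 1;
    z = (1 - t) *\<^sub>R vs ! i + t *\<^sub>R vs ! j;
    dissect (vs[i := z]) L; dissect (vs[j := z]) M\<rbrakk> \<Longrightarrow> dissect vs (L @ M)"

lemma dissect_length: "dissect vs L \<Longrightarrow> ws \<in> set L \<Longrightarrow> length ws = length vs"
  by (induction rule: dissect.induct) auto

lemma dissect_hull: "dissect vs L \<Longrightarrow> convex hull (set vs) = (\<Union>ws\<in>set L. convex hull (set ws))"
proof (induction rule: dissect.induct)
  case (cut i vs j t z L M)
  show ?case using convex_hull_edge_cut[OF cut(1-6)] cut.IH by auto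
qed simp

lemma dissect_subset: "dissect vs L \<Longrightarrow> ws \<in> set L \<Longrightarrow> set ws \<subseteq> convex hull (set vs)"
  using dissect_hull hull_subset[of "set ws" convex] by blast

lemma dissect_concat:
  "dissect vs L \<Longrightarrow> (\<And>ws. ws \<in> set L \<Longrightarrow> dissect ws (f ws)) \<Longrightarrow> dissect vs (concat (map f L))"
  by (induction rule: dissect.induct) (auto intro: dissect.cut)

text \<open>As \<open>t \<noteq> 1\<close>, the replaced vertex \<open>vs ! i\<close> is an affine
  combination of \<open>z\<close> and \<open>vs ! j\<close>.\<close>

lemma affine_hull_edge_cut:
  fixes vs :: "'a::real_vector list"
  assumes ij: "i < length vs" "j < length vs" "i \<noteq> j" and t: "t \<noteq> 1"
    and z: "z = (1 - t) *\<^sub>R vs ! i + t *\<^sub>R vs ! j"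
  shows "affine hull (set (vs[i := z])) = affine hull (set vs)"
proof
  have z1: "z \<in> affine hull (set vs)"
    unfolding z using ij by (intro mem_affine affine_affine_hull) (auto intro!: hull_inc)
  then have "set (vs[i := z]) \<subseteq> affine hull (set vs)"
    using set_update_subset_insert[of vs i z] hull_subset[of "set vs" affine] by blast
  then show "affine hull (set (vs[i := z])) \<subseteq> affine hull (set vs)"
    by (rule hull_minimal) (rule affine_affine_hull)
  have inz: "z \<in> affine hull (set (vs[i := z]))"
    using ij by (intro hull_inc set_update_memI)
  have inm: "vs ! m \<in> affine hull (set (vs[i := z]))" if "m < length vs" "m \<noteq> i" for m
  proof (intro hull_inc)
    have "vs[i := z] ! m \<in> set (vs[i := z])" using that by (intro nth_mem) simp
    then show "vs ! m \<in> set (vs[i := z])" using that by simp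
  qed
  have "vs ! i = (1 / (1 - t)) *\<^sub>R z + (- t / (1 - t)) *\<^sub>R vs ! j"
    using t by (simp add: z scaleR_add_right)
  moreover have "(1 / (1 - t)) *\<^sub>R z + (- t / (1 - t)) *\<^sub>R vs ! j \<in> affine hull (set (vs[i := z]))"
    using t ij by (intro mem_affine affine_affine_hull inz inm) (auto simp: field_simps)
  ultimately have "vs ! i \<in> affine hull (set (vs[i := z]))" by simp
  then have "set vs \<subseteq> affine hull (set (vs[i := z]))"
    using inm by (metis in_set_conv_nth subsetI)
  then show "affine hull (set vs) \<subseteq> affine hull (set (vs[i := z]))"
    by (rule hull_minimal) (rule affine_affine_hull)
qed

lemma dissect_affine_hull:
  "dissect vs L \<Longrightarrow> ws \<in> set L \<Longrightarrow> affine hull (set ws) = affine hull (set vs)"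
proof (induction rule: dissect.induct)
  case (cut i vs j t z L M)
  have "affine hull (set (vs[i := z])) = affine hull (set vs)"
    using cut by (intro affine_hull_edge_cut[where t=t]) auto
  moreover have "affine hull (set (vs[j := z])) = affine hull (set vs)"
    using cut by (intro affine_hull_edge_cut[where t="1 - t" and j=i]) auto
  ultimately show ?case using cut by auto
qed simp

text \<open>With k + 1 entries, dimension k leaves no room for repetition or dependence. In this
  form nondegeneracy depends on the length and the affine hull only, and cuts preserve both.\<close>

lemma simplex_vertices_iff_aff_dim:
  "simplex_vertices k vs \<longleftrightarrow> length vs = Suc k \<and> aff_dim (set vs) = int k"
proof
  assume "simplex_vertices k vs"
  then show "length vs = Suc k \<and> aff_dim (set vs) = int k"
    unfolding simplex_vertices_def by (auto simp: affine_independent_iff_card distinct_card)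
next
  assume a: "length vs = Suc k \<and> aff_dim (set vs) = int k"
  have "aff_dim (set vs) \<le> int (card (set vs)) - 1"
    by (intro aff_dim_le_card) simp
  with a have "card (set vs) \<ge> Suc k" by linarith
  with a card_length[of vs] have c: "card (set vs) = Suc k" by simp
  with a have "distinct vs" by (simp add: card_distinct)
  moreover have "\<not> affine_dependent (set vs)"
    using a c by (simp add: affine_independent_iff_card)
  ultimately show "simplex_vertices k vs" using a by (simp add: simplex_vertices_def)
qed

lemma dissect_simplex_vertices:
  assumes "dissect vs L" "ws \<in> set L" "simplex_vertices k vs"
  shows "simplex_vertices k ws"
  using assms dissect_length[OF assms(1,2)] dissect_affine_hull[OF assms(1,2)]
  unfolding simplex_vertices_iff_aff_dim by (metis aff_dim_affine_hull)

section \<open>Affine functionals and cuts along hyperplanes\<close>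

lemma inner_affine_sum:
  assumes "(\<Sum>i\<in>I. u i) = (1::real)"
  shows "inner a (\<Sum>i\<in>I. u i *\<^sub>R x i) + b = (\<Sum>i\<in>I. u i * (inner a (x i) + b))"
proof -
  have "(\<Sum>i\<in>I. u i * b) = b" using assms by (simp flip: sum_distrib_right)
  then show ?thesis by (simp add: inner_sum_right distrib_left sum.distrib)
qed

text \<open>The barycentric coordinate of \<open>p\<close>, extended from the affine hull to the
  whole space so that its zero set is a hyperplane. The differences to another vertex
  \<open>q\<close> are independent, so a linear functional may be prescribed on them; the adjoint
  represents it by a vector.\<close>

lemma barycentric_functional:
  fixes S :: "'a::euclidean_space set"
  assumes "\<not> affine_dependent S" "p \<in> S"
  shows "\<exists>a b. inner a p + b = 1 \<and> (\<forall>q\<in>S - {p}. inner a q + b = 0)"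
proof (cases "S - {p} = {}")
  case True
  have "inner (0::'a) p + 1 = 1" by simp
  then show ?thesis using True by blast
next
  case False
  then obtain q where q: "q \<in> S" "q \<noteq> p" by blast
  have "S = insert q (S - {q})" using q by blast
  with assms(1) have ind: "independent ((\<lambda>x. x - q) ` (S - {q}))"
    using affine_dependent_iff_dependent[of q "S - {q}"] by auto
  obtain f where f: "linear f"
    "\<And>x. x \<in> (\<lambda>x. x - q) ` (S - {q}) \<Longrightarrow> f x = (if x = p - q then 1 else 0::real)"
    using linear_independent_extend[OF ind, of "\<lambda>x. if x = p - q then 1 else 0::real"] by blast
  define a where "a = adjoint f 1"
  have a: "inner a x = f x" for x
    using adjoint_works[OF f(1), of x 1] by (simp add: a_def inner_commute)
  have "inner a p + (- inner a q) = 1"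
    using f(2)[of "p - q"] q assms(2) by (simp add: a linear_diff[OF f(1)])
  moreover have "inner a r + (- inner a q) = 0" if "r \<in> S - {p}" for r
  proof (cases "r = q")
    case False
    then show ?thesis
      using f(2)[of "r - q"] that by (simp add: a linear_diff[OF f(1)])
  qed simp
  ultimately show ?thesis by blast
qed

text \<open>The nonnegative terms \<open>u p * (inner a p + b)\<close> sum to zero, so each vanishes
  and no weight sits off the hyperplane.\<close>

lemma mem_convex_hull_zero_set:
  assumes "finite A" "\<And>p. p \<in> A \<Longrightarrow> 0 \<le> inner a p + b" "x \<in> convex hull A" "inner a x + b = 0"
  shows "x \<in> convex hull {p \<in> A. inner a p + b = 0}"
proof -
  obtain u where u: "\<forall>p\<in>A. 0 \<le> u p" "sum u A = 1" "(\<Sum>p\<in>A. u p *\<^sub>R p) = x"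
    using assms(3) by (auto simp: convex_hull_finite[OF assms(1)])
  have "(\<Sum>p\<in>A. u p * (inner a p + b)) = 0"
    using inner_affine_sum[OF u(2), of a "\<lambda>p. p" b] u(3) assms(4) by simp
  then have z: "\<forall>p\<in>A. u p * (inner a p + b) = 0"
    using assms u by (subst (asm) sum_nonneg_eq_0_iff) auto
  define B where "B = {p \<in> A. inner a p + b = 0}"
  have u0: "u p = 0" if "p \<in> A - B" for p using z that by (auto simp: B_def)
  have "sum u B = 1"
    using u(2) sum.mono_neutral_right[of A B u] assms(1) u0 by (auto simp: B_def)
  moreover have "(\<Sum>p\<in>B. u p *\<^sub>R p) = x"
    using u(3) sum.mono_neutral_right[of A B "\<lambda>p. u p *\<^sub>R p"] assms(1) u0 by (auto simp: B_def)
  ultimately show ?thesis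
    using u(1) assms(1) unfolding B_def[symmetric]
    by (subst convex_hull_finite) (auto simp: B_def intro!: exI[of _ u])
qed

lemma inner_ge_on_hull:
  assumes "\<And>p. p \<in> A \<Longrightarrow> 0 \<le> inner a p + b" "x \<in> convex hull A"
  shows "0 \<le> inner a x + b"
proof -
  have "A \<subseteq> {x. inner a x \<ge> - b}" using assms(1) by fastforce
  then have "convex hull A \<subseteq> {x. inner a x \<ge> - b}"
    by (rule hull_minimal) (rule convex_halfspace_ge)
  then show ?thesis using assms(2) by auto
qed

lemma inner_le_on_hull:
  assumes "\<And>p. p \<in> A \<Longrightarrow> inner a p + b \<le> 0" "x \<in> convex hull A"
  shows "inner a x + b \<le> 0"
  using inner_ge_on_hull[of A "- a" "- b" x] assms by fastforce

text \<open>With barycentric coordinates \<lambda>, the hyperplane (1 - t) \<lambda>_j = t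
  \<lambda>_i contains \<open>z\<close> and all vertices other than \<open>vs ! i\<close> and
  \<open>vs ! j\<close>, and separates the two halves. They therefore meet inside the face
  \<open>fs\<close> of the first half that omits position \<open>j\<close>, the only vertex of that
  half off the hyperplane. Having \<open>k\<close> points, this face will be a null set.\<close>

lemma edge_cut_inter:
  fixes vs :: "'a::euclidean_space list"
  assumes "simplex_vertices k vs"
    and ij: "i < length vs" "j < length vs" "i \<noteq> j" and t: "0 < t" "t < 1"
    and z: "z = (1 - t) *\<^sub>R vs ! i + t *\<^sub>R vs ! j"
  obtains fs where "length fs = k"
    "convex hull (set (vs[i := z])) \<inter> convex hull (set (vs[j := z])) \<subseteq> convex hull (set fs)"
proof -
  have len: "length vs = Suc k" and di: "distinct vs" and ind: "\<not> affine_dependent (set vs)"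
    using assms(1) by (auto simp: simplex_vertices_def)
  obtain a b where ab: "inner a (vs ! i) + b = 1" "\<forall>q\<in>set vs - {vs ! i}. inner a q + b = 0"
    using barycentric_functional[OF ind, of "vs ! i"] ij by auto
  obtain a' b' where ab': "inner a' (vs ! j) + b' = 1" "\<forall>q\<in>set vs - {vs ! j}. inner a' q + b' = 0"
    using barycentric_functional[OF ind, of "vs ! j"] ij by auto
  define c where "c = (1 - t) *\<^sub>R a' - t *\<^sub>R a"
  define d where "d = (1 - t) * b' - t * b"
  have cd: "inner c x + d = (1 - t) * (inner a' x + b') - t * (inner a x + b)" for x
    by (simp add: c_def d_def inner_diff_left algebra_simps)
  have A: "inner a (vs ! m) + b = (if m = i then 1 else 0)" if "m < length vs" for m
    using that ab ij di by (auto simp: nth_eq_iff_index_eq)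
  have A': "inner a' (vs ! m) + b' = (if m = j then 1 else 0)" if "m < length vs" for m
    using that ab' ij di by (auto simp: nth_eq_iff_index_eq)
  have g: "inner c (vs ! m) + d = (if m = j then 1 - t else if m = i then - t else 0)"
    if "m < length vs" for m
    unfolding cd using A[OF that] A'[OF that] ij by auto
  have gz: "inner c z + d = 0"
  proof -
    have "inner c z + d = (1 - t) * (inner c (vs ! i) + d) + t * (inner c (vs ! j) + d)"
      by (simp add: z inner_add_right algebra_simps)
    also have "\<dots> = 0" using g ij by simp
    finally show ?thesis .
  qed
  define ws where "ws = vs[i := z]"
  define fs where "fs = take j ws @ drop (Suc j) ws"
  have lw: "length ws = Suc k" by (simp add: ws_def len)
  have gw: "inner c (ws ! m) + d = (if m = j then 1 - t else 0)" if "m < length vs" for m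
    using that g[OF that] ij gz by (auto simp: ws_def nth_list_update)
  have gw': "inner c (vs[j := z] ! m) + d = (if m = i then - t else 0)" if "m < length vs" for m
    using that g[OF that] ij gz by (auto simp: nth_list_update)
  have ge: "0 \<le> inner c p + d" if "p \<in> set ws" for p
    using that gw t by (auto simp: in_set_conv_nth lw len split: if_splits)
  have le: "inner c p + d \<le> 0" if "p \<in> set (vs[j := z])" for p
    using that gw' t by (auto simp: in_set_conv_nth lw len split: if_splits)
  show thesis
  proof
    show "length fs = k" using ij by (simp add: fs_def lw len)
    show "convex hull (set (vs[i := z])) \<inter> convex hull (set (vs[j := z])) \<subseteq> convex hull (set fs)"
    proof
      fix x assume x: "x \<in> convex hull (set (vs[i := z])) \<inter> convex hull (set (vs[j := z]))"
      have "inner c x + d = 0"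
        using inner_ge_on_hull[of "set ws" c d x] inner_le_on_hull[of "set (vs[j := z])" c d x]
          ge le x by (auto simp: ws_def intro!: antisym)
      then have "x \<in> convex hull {p \<in> set ws. inner c p + d = 0}"
        using ge x by (intro mem_convex_hull_zero_set) (auto simp: ws_def)
      moreover have "{p \<in> set ws. inner c p + d = 0} \<subseteq> set fs"
      proof
        fix p assume p: "p \<in> {p \<in> set ws. inner c p + d = 0}"
        then obtain m where m: "m < length ws" "p = ws ! m" by (auto simp: in_set_conv_nth)
        with p gw[of m] t have "m \<noteq> j" by (auto simp: lw len)
        have "ws = take j ws @ ws ! j # drop (Suc j) ws"
          using ij by (simp add: id_take_nth_drop lw len)
        show "p \<in> set fs"
        proof (cases "m < j")
          case True
          then have "p = take j ws ! m" "m < length (take j ws)" using m by auto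
          then show ?thesis by (metis UnI1 fs_def nth_mem set_append)
        next
          case False
          with \<open>m \<noteq> j\<close> have "Suc j \<le> m" by simp
          then have "p = drop (Suc j) ws ! (m - Suc j)" "m - Suc j < length (drop (Suc j) ws)"
            using m by auto
          then show ?thesis by (metis UnI2 fs_def nth_mem set_append)
        qed
      qed
      ultimately show "x \<in> convex hull (set fs)"
        using hull_mono by blast
    qed
  qed
qed

text \<open>An edge with ends strictly on opposite sides is cut at the zero \<open>z\<close> of the
  functional. Each half exchanges a vertex off the hyperplane for one on it, so the number of
  vertices off the hyperplane bounds the depth of the tree of cuts.\<close>

lemma dissect_by_functional:
  fixes vs :: "'a::euclidean_space list"
  shows "\<exists>L. dissect vs L \<and> length L \<le> 2 ^ card {m. m < length vs \<and> inner a (vs ! m) + b \<noteq> 0} \<and>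
    (\<forall>ws\<in>set L. (\<forall>p\<in>set ws. 0 \<le> inner a p + b) \<or> (\<forall>p\<in>set ws. inner a p + b \<le> 0))"
proof (induction "card {m. m < length vs \<and> inner a (vs ! m) + b \<noteq> 0}" arbitrary: vs
    rule: less_induct)
  case less
  let ?g = "\<lambda>x. inner a x + b"
  let ?Z = "\<lambda>vs. {m. m < length vs \<and> ?g (vs ! m) \<noteq> 0}"
  show ?case
  proof (cases "(\<forall>p\<in>set vs. 0 \<le> ?g p) \<or> (\<forall>p\<in>set vs. ?g p \<le> 0)")
    case True
    then show ?thesis
      by (intro exI[of _ "[vs]"]) (simp add: dissect.trivial)
  next
    case False
    then obtain i j where ij: "i < length vs" "j < length vs" "?g (vs ! i) < 0" "0 < ?g (vs ! j)"
      by (metis in_set_conv_nth not_le)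
    define u v where "u = ?g (vs ! i)" and "v = ?g (vs ! j)"
    have uv: "u < 0" "0 < v" using ij by (simp_all add: u_def v_def)
    define t where "t = - u / (v - u)"
    define z where "z = (1 - t) *\<^sub>R vs ! i + t *\<^sub>R vs ! j"
    have t: "0 < t" "t < 1" unfolding t_def using uv by (simp_all add: less_divide_eq divide_less_0_iff)
    have "?g z = (1 - t) * u + t * v"
      unfolding z_def u_def v_def inner_add_right inner_scaleR_right by (simp add: algebra_simps)
    also have "\<dots> = u + t * (v - u)" by (simp add: algebra_simps)
    also have "\<dots> = 0" unfolding t_def using uv by simp
    finally have gz: "?g z = 0" .
    have c: "card (?Z (vs[m := z])) < card (?Z vs)" if "m = i \<or> m = j" for m
    proof -
      have "m \<in> ?Z vs" "m \<notin> ?Z (vs[m := z])" using that ij gz by auto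
      moreover have "?Z (vs[m := z]) \<subseteq> ?Z vs"
      proof
        fix x assume "x \<in> ?Z (vs[m := z])"
        then have x: "x < length vs" "?g (vs[m := z] ! x) \<noteq> 0" by simp_all
        have "x \<noteq> m"
        proof
          assume "x = m"
          with x(1) have "vs[m := z] ! x = z" by simp
          with x(2) gz show False by simp
        qed
        with x show "x \<in> ?Z vs" by simp
      qed
      ultimately have "?Z (vs[m := z]) \<subset> ?Z vs" by blast
      then show ?thesis by (intro psubset_card_mono) simp_all
    qed
    have ci: "card (?Z (vs[i := z])) < card (?Z vs)" and cj: "card (?Z (vs[j := z])) < card (?Z vs)"
      using c by simp_all
    obtain L where L: "dissect (vs[i := z]) L" "length L \<le> 2 ^ card (?Z (vs[i := z]))"
      "\<forall>ws\<in>set L. (\<forall>p\<in>set ws. 0 \<le> ?g p) \<or> (\<forall>p\<in>set ws. ?g p \<le> 0)"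
      using less[OF ci] by blast
    obtain M where M: "dissect (vs[j := z]) M" "length M \<le> 2 ^ card (?Z (vs[j := z]))"
      "\<forall>ws\<in>set M. (\<forall>p\<in>set ws. 0 \<le> ?g p) \<or> (\<forall>p\<in>set ws. ?g p \<le> 0)"
      using less[OF cj] by blast
    have "dissect vs (L @ M)"
      using ij t by (intro dissect.cut[OF _ _ _ t z_def L(1) M(1)]) auto
    moreover have "length (L @ M) \<le> 2 ^ card (?Z vs)"
    proof -
      obtain q where q: "card (?Z vs) = Suc q" using ci by (cases "card (?Z vs)") auto
      have "length L \<le> 2 ^ q" "length M \<le> 2 ^ q"
        using ci cj unfolding q less_Suc_eq_le
        by (auto intro: order_trans[OF L(2)] order_trans[OF M(2)] power_increasing)
      then show ?thesis by (simp add: q)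
    qed
    moreover have "\<forall>ws\<in>set (L @ M). (\<forall>p\<in>set ws. 0 \<le> ?g p) \<or> (\<forall>p\<in>set ws. ?g p \<le> 0)"
      using L(3) M(3) unfolding set_append by blast
    ultimately show ?thesis by blast
  qed
qed

text \<open>Pieces lie in the hull of what they were cut from, so later cuts do not spoil signs
  fixed earlier. Each functional multiplies the number of pieces by at most
  \<open>2 ^ length vs\<close>, because cuts do not change the number of vertices.\<close>

lemma dissect_by_functionals:
  fixes vs :: "'a::euclidean_space list"
  shows "\<exists>L. dissect vs L \<and> length L \<le> 2 ^ (length vs * length gs) \<and>
    (\<forall>ws\<in>set L. \<forall>(a, b)\<in>set gs.
      (\<forall>p\<in>set ws. 0 \<le> inner a p + b) \<or> (\<forall>p\<in>set ws. inner a p + b \<le> 0))"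
proof (induction gs)
  case Nil
  then show ?case by (intro exI[of _ "[vs]"]) (auto intro: dissect.trivial)
next
  case (Cons g gs)
  obtain a b where g: "g = (a, b)" by (cases g)
  obtain L where L: "dissect vs L" "length L \<le> 2 ^ (length vs * length gs)"
    "\<forall>ws\<in>set L. \<forall>(a, b)\<in>set gs.
      (\<forall>p\<in>set ws. 0 \<le> inner a p + b) \<or> (\<forall>p\<in>set ws. inner a p + b \<le> 0)"
    using Cons by blast
  have "\<exists>M. dissect ws M \<and> length M \<le> 2 ^ length ws \<and>
     (\<forall>us\<in>set M. (\<forall>p\<in>set us. 0 \<le> inner a p + b) \<or> (\<forall>p\<in>set us. inner a p + b \<le> 0))" for ws
  proof -
    have "card {m. m < length ws \<and> inner a (ws ! m) + b \<noteq> 0} \<le> card {..<length ws}"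
      by (intro card_mono) auto
    then have "2 ^ card {m. m < length ws \<and> inner a (ws ! m) + b \<noteq> 0} \<le> (2::nat) ^ length ws"
      by (intro power_increasing) auto
    then show ?thesis using dissect_by_functional[of ws a b] order_trans by blast
  qed
  then obtain f where f: "\<And>ws. dissect ws (f ws)" "\<And>ws. length (f ws) \<le> 2 ^ length ws"
    "\<And>ws us. us \<in> set (f ws) \<Longrightarrow>
      (\<forall>p\<in>set us. 0 \<le> inner a p + b) \<or> (\<forall>p\<in>set us. inner a p + b \<le> 0)"
    by metis
  have "length (concat (map f L)) \<le> length L * 2 ^ length vs"
  proof -
    have "length (concat (map f L)) = (\<Sum>ws\<leftarrow>L. length (f ws))" by (simp add: length_concat comp_def)
    also have "\<dots> \<le> (\<Sum>ws\<leftarrow>L. 2 ^ length vs)"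
      using f(2) dissect_length[OF L(1)] by (intro sum_list_mono) metis
    finally show ?thesis by (simp add: sum_list_triv)
  qed
  also have "\<dots> \<le> 2 ^ (length vs * length (g # gs))"
    using mult_right_mono[OF L(2), of "2 ^ length vs"] by (simp add: power_add mult.commute)
  finally have len: "length (concat (map f L)) \<le> 2 ^ (length vs * length (g # gs))" .
  have "(\<forall>p\<in>set us. 0 \<le> inner c p + d) \<or> (\<forall>p\<in>set us. inner c p + d \<le> 0)"
    if "ws \<in> set L" "us \<in> set (f ws)" "(c, d) \<in> set gs" for ws us c d
  proof -
    have sub: "set us \<subseteq> convex hull (set ws)" by (rule dissect_subset[OF f(1) that(2)])
    have "(\<forall>p\<in>set ws. 0 \<le> inner c p + d) \<or> (\<forall>p\<in>set ws. inner c p + d \<le> 0)"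
      using bspec[OF bspec[OF L(3) that(1)] that(3)] by simp
    then show ?thesis
      using sub inner_ge_on_hull[of "set ws" c d] inner_le_on_hull[of "set ws" c d] by (meson subsetD)
  qed
  then show ?case
    using dissect_concat[OF L(1) f(1)] len f(3) unfolding g
    by (intro exI[of _ "concat (map f L)"]) (simp, blast)
qed

section \<open>Orientation\<close>

text \<open>The determinant from \<open>same_orientation\<close> with its value exposed, so that
  signs can be multiplied. It is a relation because a matrix exists only if the edges of
  \<open>ws\<close> lie in the span of those of \<open>vs\<close>.\<close>

definition frame_det :: "nat \<Rightarrow> 'a::real_vector list \<Rightarrow> 'a list \<Rightarrow> real \<Rightarrow> bool" where
  "frame_det k vs ws x \<longleftrightarrow> (\<exists>M \<in> carrier_mat k k.
     (\<forall>i<k. ws ! Suc i - ws ! 0 = (\<Sum>j<k. (M $$ (i, j)) *\<^sub>R (vs ! Suc j - vs ! 0))) \<and>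
     Determinant.det M = x)"

lemma frame_detI:
  assumes "M \<in> carrier_mat k k"
    "\<And>i. i < k \<Longrightarrow> ws ! Suc i - ws ! 0 = (\<Sum>j<k. (M $$ (i, j)) *\<^sub>R (vs ! Suc j - vs ! 0))"
    "Determinant.det M = x"
  shows "frame_det k vs ws x"
  using assms unfolding frame_det_def by blast

lemma frame_det_refl: "frame_det k vs vs 1"
proof (rule frame_detI[of "1\<^sub>m k"])
  fix i assume i: "i < k"
  have "(\<Sum>j<k. (1\<^sub>m k $$ (i, j)) *\<^sub>R (vs ! Suc j - vs ! 0))
      = (\<Sum>j<k. if i = j then vs ! Suc j - vs ! 0 else 0)"
    using i by (intro sum.cong) auto
  then show "vs ! Suc i - vs ! 0 = (\<Sum>j<k. (1\<^sub>m k $$ (i, j)) *\<^sub>R (vs ! Suc j - vs ! 0))"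
    using i by simp
qed auto

lemma frame_det_mat_mult:
  fixes e :: "nat \<Rightarrow> 'a::real_vector"
  assumes "A \<in> carrier_mat k k" "B \<in> carrier_mat k k" "i < k"
  shows "(\<Sum>j<k. (A $$ (i, j)) *\<^sub>R (\<Sum>l<k. (B $$ (j, l)) *\<^sub>R e l)) =
    (\<Sum>l<k. ((A * B) $$ (i, l)) *\<^sub>R e l)"
proof -
  have AB: "(A * B) $$ (i, l) = (\<Sum>j<k. A $$ (i, j) * B $$ (j, l))" if "l < k" for l
    using assms that by (simp add: scalar_prod_def lessThan_atLeast0)
  have "(\<Sum>j<k. (A $$ (i, j)) *\<^sub>R (\<Sum>l<k. (B $$ (j, l)) *\<^sub>R e l))
      = (\<Sum>l<k. \<Sum>j<k. (A $$ (i, j) * B $$ (j, l)) *\<^sub>R e l)"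
    by (simp add: scaleR_sum_right) (rule sum.swap)
  also have "\<dots> = (\<Sum>l<k. ((A * B) $$ (i, l)) *\<^sub>R e l)"
    by (intro sum.cong refl) (simp add: AB scaleR_sum_left)
  finally show ?thesis .
qed

lemma frame_det_trans:
  assumes "frame_det k us vs x" "frame_det k vs ws y"
  shows "frame_det k us ws (x * y)"
proof -
  obtain M where M: "M \<in> carrier_mat k k" "Determinant.det M = x"
    "\<And>i. i < k \<Longrightarrow> vs ! Suc i - vs ! 0 = (\<Sum>j<k. (M $$ (i, j)) *\<^sub>R (us ! Suc j - us ! 0))"
    using assms(1) unfolding frame_det_def by blast
  obtain B where B: "B \<in> carrier_mat k k" "Determinant.det B = y"
    "\<And>i. i < k \<Longrightarrow> ws ! Suc i - ws ! 0 = (\<Sum>j<k. (B $$ (i, j)) *\<^sub>R (vs ! Suc j - vs ! 0))"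
    using assms(2) unfolding frame_det_def by blast
  show ?thesis
  proof (rule frame_detI[of "B * M"])
    fix i assume i: "i < k"
    show "ws ! Suc i - ws ! 0 = (\<Sum>j<k. ((B * M) $$ (i, j)) *\<^sub>R (us ! Suc j - us ! 0))"
      unfolding frame_det_mat_mult[OF B(1) M(1) i, symmetric] B(3)[OF i]
      by (intro sum.cong refl) (simp add: M(3))
  qed (use M B in \<open>auto simp: det_mult[OF B(1) M(1)]\<close>)
qed

lemma frame_det_sym:
  assumes "frame_det k vs ws x" "x \<noteq> 0"
  shows "frame_det k ws vs (1 / x)"
proof -
  obtain M where M: "M \<in> carrier_mat k k" "Determinant.det M = x"
    "\<And>i. i < k \<Longrightarrow> ws ! Suc i - ws ! 0 = (\<Sum>j<k. (M $$ (i, j)) *\<^sub>R (vs ! Suc j - vs ! 0))"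
    using assms(1) unfolding frame_det_def by blast
  \<comment> \<open>The inverse of \<open>M\<close> by the adjugate, available since its determinant
    \<open>x\<close> is nonzero.\<close>
  define B where "B = (1 / x) \<cdot>\<^sub>m adj_mat M"
  have B: "B \<in> carrier_mat k k" using adj_mat(1)[OF M(1)] by (simp add: B_def)
  have "B * M = (1 / x) \<cdot>\<^sub>m (adj_mat M * M)"
    unfolding B_def by (rule mult_smult_assoc_mat[OF adj_mat(1)[OF M(1)] M(1)])
  also have "\<dots> = 1\<^sub>m k"
    using assms(2) unfolding adj_mat(3)[OF M(1)] M(2) by (intro eq_matI) auto
  finally have BM: "B * M = 1\<^sub>m k" .
  have "Determinant.det B * x = 1"
    using det_mult[OF B M(1)] unfolding BM M(2) by simp
  then have d: "Determinant.det B = 1 / x" using assms(2) by (simp add: field_simps)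
  show ?thesis
  proof (rule frame_detI[OF B _ d])
    fix i assume i: "i < k"
    have "(\<Sum>j<k. (B $$ (i, j)) *\<^sub>R (ws ! Suc j - ws ! 0))
      = (\<Sum>j<k. (B $$ (i, j)) *\<^sub>R (\<Sum>l<k. (M $$ (j, l)) *\<^sub>R (vs ! Suc l - vs ! 0)))"
      by (intro sum.cong refl) (simp add: M(3))
    also have "\<dots> = (\<Sum>l<k. (1\<^sub>m k $$ (i, l)) *\<^sub>R (vs ! Suc l - vs ! 0))"
      unfolding frame_det_mat_mult[OF B M(1) i] BM ..
    also have "\<dots> = (\<Sum>l<k. if i = l then vs ! Suc l - vs ! 0 else 0)"
      using i by (intro sum.cong) auto
    also have "\<dots> = vs ! Suc i - vs ! 0" using i by simp
    finally show "vs ! Suc i - vs ! 0 = (\<Sum>j<k. (B $$ (i, j)) *\<^sub>R (ws ! Suc j - ws ! 0))" ..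
  qed
qed

text \<open>Laplace expansion along the line that is zero off the diagonal: one term survives, and
  its minor is an identity matrix. The two alternatives in \<open>Z\<close> serve the two cases of
  \<open>frame_det_shear\<close>.\<close>

lemma det_unit_except_row_or_column:
  fixes M :: "real mat"
  assumes M: "M \<in> carrier_mat k k" and r: "r < k"
    and I: "\<And>i j. \<lbrakk>i < k; j < k; i \<noteq> r; j \<noteq> r\<rbrakk> \<Longrightarrow> M $$ (i, j) = (if i = j then 1 else 0)"
    and Z: "(\<forall>i<k. i \<noteq> r \<longrightarrow> M $$ (i, r) = 0) \<or> (\<forall>j<k. j \<noteq> r \<longrightarrow> M $$ (r, j) = 0)"
  shows "Determinant.det M = M $$ (r, r)"
proof -
  have "mat_delete M r r = 1\<^sub>m (k - 1)"
    using M r by (intro eq_matI) (auto simp: mat_delete_def I)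
  then have c: "cofactor M r r = 1" by (simp add: cofactor_def)
  from Z show ?thesis
  proof
    assume z: "\<forall>i<k. i \<noteq> r \<longrightarrow> M $$ (i, r) = 0"
    have "Determinant.det M = (\<Sum>i<k. M $$ (i, r) * cofactor M i r)"
      by (rule laplace_expansion_column[OF M r])
    also have "\<dots> = (\<Sum>i<k. if r = i then M $$ (r, r) else 0)"
      using z c by (intro sum.cong) auto
    finally show ?thesis using r by simp
  next
    assume z: "\<forall>j<k. j \<noteq> r \<longrightarrow> M $$ (r, j) = 0"
    have "Determinant.det M = (\<Sum>j<k. M $$ (r, j) * cofactor M r j)"
      by (rule laplace_expansion_row[OF M r])
    also have "\<dots> = (\<Sum>i<k. if r = i then M $$ (r, r) else 0)"
      using z c by (intro sum.cong) auto
    finally show ?thesis using r by simp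
  qed
qed

lemma frame_det_shear:
  fixes vs :: "'a::real_vector list"
  assumes len: "length vs = Suc k" and ij: "i \<le> k" "j \<le> k" "i \<noteq> j"
  shows "frame_det k vs (vs[i := (1 - t) *\<^sub>R vs ! i + t *\<^sub>R vs ! j]) (1 - t)"
proof (cases i)
  case 0
  then obtain r where r: "j = Suc r" "r < k" using ij by (cases j) auto
  \<comment> \<open>Vertex 0 is the base point of all edges, so moving it subtracts
    \<open>t *\<^sub>R (vs ! j - vs ! 0)\<close> from every edge: the identity is altered in column
    \<open>r\<close> only.\<close>
  define M where "M = Matrix.mat k k (\<lambda>(a, b). (if a = b then 1 else 0) - (if b = r then t else 0))"
  have M: "M \<in> carrier_mat k k" by (simp add: M_def)
  show ?thesis
  proof (rule frame_detI[OF M])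
    have "Determinant.det M = M $$ (r, r)"
      using r by (intro det_unit_except_row_or_column[OF M]) (auto simp: M_def)
    then show "Determinant.det M = 1 - t" using r by (simp add: M_def)
    fix a assume a: "a < k"
    have "(\<Sum>b<k. M $$ (a, b) *\<^sub>R (vs ! Suc b - vs ! 0))
      = (\<Sum>b<k. (if a = b then vs ! Suc b - vs ! 0 else 0)
          - (if r = b then t *\<^sub>R (vs ! Suc b - vs ! 0) else 0))"
      using a by (intro sum.cong) (auto simp: M_def scaleR_diff_left)
    also have "\<dots> = vs ! Suc a - vs ! 0 - t *\<^sub>R (vs ! j - vs ! 0)"
      using a r by (simp add: sum_subtractf)
    finally show "vs[i := (1 - t) *\<^sub>R vs ! i + t *\<^sub>R vs ! j] ! Suc a
        - vs[i := (1 - t) *\<^sub>R vs ! i + t *\<^sub>R vs ! j] ! 0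
      = (\<Sum>b<k. M $$ (a, b) *\<^sub>R (vs ! Suc b - vs ! 0))"
      using a len 0 by (simp add: algebra_simps)
  qed
next
  case (Suc r)
  with ij have r: "r < k" by simp
  \<comment> \<open>Only the edge ending at the moved vertex changes: the identity is altered in row
    \<open>r\<close> only.\<close>
  define M where "M = Matrix.mat k k (\<lambda>(a, b). (if a = b then (if a = r then 1 - t else 1) else 0)
     + (if a = r \<and> Suc b = j then t else 0))"
  have M: "M \<in> carrier_mat k k" by (simp add: M_def)
  show ?thesis
  proof (rule frame_detI[OF M])
    have "Determinant.det M = M $$ (r, r)"
      using r ij Suc by (intro det_unit_except_row_or_column[OF M]) (auto simp: M_def)
    then show "Determinant.det M = 1 - t" using r Suc ij by (simp add: M_def)
    fix a assume a: "a < k"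
    \<comment> \<open>For \<open>j = 0\<close> the edge from vertex 0 to \<open>vs ! j\<close> is
      zero; the index \<open>j - 1\<close> then truncates to 0, and its coefficient is set to
      0.\<close>
    have "(\<Sum>b<k. M $$ (a, b) *\<^sub>R (vs ! Suc b - vs ! 0))
      = (\<Sum>b<k. (if a = b then (if a = r then 1 - t else 1) *\<^sub>R (vs ! Suc b - vs ! 0) else 0)
          + (if j - 1 = b then (if a = r \<and> j \<noteq> 0 then t else 0) *\<^sub>R (vs ! Suc b - vs ! 0) else 0))"
      using a by (intro sum.cong) (auto simp: M_def scaleR_add_left)
    also have "\<dots> = (if a = r then 1 - t else 1) *\<^sub>R (vs ! Suc a - vs ! 0)
        + (if a = r \<and> j \<noteq> 0 then t else 0) *\<^sub>R (vs ! Suc (j - 1) - vs ! 0)"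
      using a ij by (auto simp: sum.distrib)
    also have "\<dots> = vs[i := (1 - t) *\<^sub>R vs ! i + t *\<^sub>R vs ! j] ! Suc a
        - vs[i := (1 - t) *\<^sub>R vs ! i + t *\<^sub>R vs ! j] ! 0"
      using a len Suc by (cases "a = r"; cases "j = 0") (simp_all add: algebra_simps)
    finally show "vs[i := (1 - t) *\<^sub>R vs ! i + t *\<^sub>R vs ! j] ! Suc a
        - vs[i := (1 - t) *\<^sub>R vs ! i + t *\<^sub>R vs ! j] ! 0
      = (\<Sum>b<k. M $$ (a, b) *\<^sub>R (vs ! Suc b - vs ! 0))" by (rule sym)
  qed
qed

section \<open>Permutations of the vertices\<close>

lemma permute_list_transpose:
  assumes "a < length vs" "b < length vs"
  shows "permute_list (Transposition.transpose a b) vs = vs[a := vs ! b, b := vs ! a]"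
  by (rule nth_equalityI)
    (use assms in \<open>auto simp: permute_list_def nth_list_update transpose_apply_other
      Transposition.transpose_def\<close>)

text \<open>A transposition of two vertices is a product of three shears along their edge.\<close>

lemma frame_det_transpose:
  fixes vs :: "'a::real_vector list"
  assumes len: "length vs = Suc k" and ij: "i \<le> k" "j \<le> k" "i \<noteq> j"
  shows "frame_det k vs (permute_list (Transposition.transpose i j) vs) (- 1)"
proof -
  define a where "a = vs ! i"
  define b where "b = vs ! j"
  \<comment> \<open>The reflection of \<open>a\<close> in \<open>b\<close>. Along the line through
    them the pair (a, b) becomes (c, b), then (c, a), then (b, a); the shear factors are -1, 2 and
    1/2.\<close>
  define c where "c = 2 *\<^sub>R b - a"
  have 1: "frame_det k vs (vs[i := c]) (- 1)"
    using frame_det_shear[OF len ij, of 2] by (simp add: c_def a_def b_def algebra_simps)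
  have 2: "frame_det k (vs[i := c]) (vs[i := c, j := a]) 2"
    using frame_det_shear[of "vs[i := c]" k j i "-1"] len ij
    by (simp add: c_def a_def b_def algebra_simps)
  have "(1/2) *\<^sub>R c + (1/2) *\<^sub>R a = b" by (simp add: c_def scaleR_diff_right)
  then have 3: "frame_det k (vs[i := c, j := a]) (vs[i := c, j := a, i := b]) (1/2)"
    using frame_det_shear[of "vs[i := c, j := a]" k i j "1/2"] len ij by simp
  have "vs[i := c, j := a, i := b] = vs[i := b, j := a]"
    using ij by (metis list_update_overwrite list_update_swap)
  also have "\<dots> = permute_list (Transposition.transpose i j) vs"
    using permute_list_transpose[of i vs j] ij len by (simp add: a_def b_def)
  finally show ?thesis
    using frame_det_trans[OF frame_det_trans[OF 1 2] 3] by simp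
qed

text \<open>Induction over transpositions composed on the right: \<open>permute_list\<close> applies
  the right factor last, to the list already permuted by \<open>p\<close>, so each one contributes a
  further factor -1.\<close>

lemma frame_det_permute:
  fixes vs :: "'a::real_vector list"
  assumes p: "p permutes {..k}" and len: "length vs = Suc k"
  shows "frame_det k vs (permute_list p vs) (of_int (sign p))"
  using finite_atMost p
proof (induction rule: permutes_rev_induct)
  case id
  then show ?case by (simp add: frame_det_refl)
next
  case (swap a b p)
  have "permutation p" using swap by (intro permutes_imp_permutation[OF finite_atMost])
  then have sgn: "sign (p \<circ> Transposition.transpose a b) = - sign p"
    using swap by (simp add: sign_compose permutation_swap_id sign_swap_id)
  have "Transposition.transpose a b permutes {..<length vs}"
    using swap len by (intro permutes_swap_id) auto
  then have pl: "permute_list (p \<circ> Transposition.transpose a b) vs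
      = permute_list (Transposition.transpose a b) (permute_list p vs)"
    by (rule permute_list_compose)
  show ?case
    unfolding sgn pl
    using frame_det_trans[OF swap.IH frame_det_transpose[of "permute_list p vs" k a b]] swap len by simp
qed

text \<open>A cut is a shear with factor \<open>1 - t\<close> or \<open>t\<close>, and both are
  positive.\<close>

lemma dissect_frame_det:
  "dissect vs L \<Longrightarrow> ws \<in> set L \<Longrightarrow> length vs = Suc k \<Longrightarrow> \<exists>x>0. frame_det k vs ws x"
proof (induction rule: dissect.induct)
  case (trivial vs)
  then show ?case using frame_det_refl[of k vs] by (auto intro!: exI[of _ 1])
next
  case (cut i vs j t z L M)
  show ?case
  proof (cases "ws \<in> set L")
    case True
    then obtain x where "0 < x" "frame_det k (vs[i := z]) ws x" using cut by auto
    moreover have "frame_det k vs (vs[i := z]) (1 - t)"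
      using frame_det_shear[of vs k i j t] cut by simp
    ultimately show ?thesis
      using frame_det_trans[of k vs "vs[i := z]" "1 - t" ws x] cut.hyps by (intro exI[of _ "(1 - t) * x"]) auto
  next
    case False
    then obtain x where "0 < x" "frame_det k (vs[j := z]) ws x" using cut by auto
    moreover have "frame_det k vs (vs[j := z]) t"
      using frame_det_shear[of vs k j i "1 - t"] cut by (simp add: add.commute)
    ultimately show ?thesis
      using frame_det_trans[of k vs "vs[j := z]" t ws x] cut.hyps by (intro exI[of _ "t * x"]) auto
  qed
qed

section \<open>Oriented simplices as classes of vertex lists\<close>

lemma mem_osimplex_self: "vs \<in> osimplex vs"
  unfolding osimplex_def by (auto intro!: exI[of _ id] permutes_id)

text \<open>Composition with \<open>p\<close> maps the even permutations onto the parity class of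
  \<open>p\<close>; a given \<open>r\<close> in that class is reached from the inverse of
  \<open>p\<close> followed by \<open>r\<close> in \<open>permute_list\<close>, which is
  even.\<close>

lemma osimplex_permute:
  assumes p: "p permutes {..<length vs}"
  shows "osimplex (permute_list p vs) =
    {permute_list r vs | r. r permutes {..<length vs} \<and> evenperm r = evenperm p}"
    (is "_ = ?R")
proof (intro equalityI subsetI)
  have pp: "permutation p" using permutes_imp_permutation[OF finite_lessThan p] .
  fix ws
  show "ws \<in> ?R" if ws: "ws \<in> osimplex (permute_list p vs)"
  proof -
    obtain q where q: "q permutes {..<length vs}" "evenperm q" "ws = permute_list q (permute_list p vs)"
      using ws unfolding osimplex_def by auto
    have "permutation q" using permutes_imp_permutation[OF finite_lessThan q(1)] .
    then have "ws = permute_list (p \<circ> q) vs" "p \<circ> q permutes {..<length vs}"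
      "evenperm (p \<circ> q) = evenperm p"
      using q p pp by (auto simp: permute_list_compose permutes_compose evenperm_comp)
    then show ?thesis by blast
  qed
  show "ws \<in> osimplex (permute_list p vs)" if ws: "ws \<in> ?R"
  proof -
    obtain r where r: "r permutes {..<length vs}" "evenperm r = evenperm p" "ws = permute_list r vs"
      using ws by blast
    have pr: "permutation r" using permutes_imp_permutation[OF finite_lessThan r(1)] .
    define q where "q = inv_into UNIV p \<circ> r"
    have q: "q permutes {..<length vs}"
      unfolding q_def using p r by (intro permutes_compose permutes_inv)
    have "p \<circ> q = r" unfolding q_def using p by (simp add: o_assoc permutes_inv_o)
    then have "ws = permute_list q (permute_list p vs)"
      using r q permute_list_compose[of q vs p] by simp
    moreover have "evenperm q"
      unfolding q_def using pp pr r by (simp add: evenperm_comp permutation_inverse evenperm_inv)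
    ultimately show ?thesis using q unfolding osimplex_def by auto
  qed
qed

lemma osimplex_cong: "ws \<in> osimplex vs \<Longrightarrow> osimplex ws = osimplex vs"
  unfolding osimplex_def[of vs] by (auto simp: osimplex_permute)

lemma mem_osimplexE:
  assumes "ws \<in> osimplex vs"
  obtains p where "p permutes {..<length vs}" "evenperm p" "ws = permute_list p vs"
  using assms unfolding osimplex_def by blast

lemma set_mem_osimplex: "ws \<in> osimplex vs \<Longrightarrow> set ws = set vs"
  by (auto elim!: mem_osimplexE)

lemma length_mem_osimplex: "ws \<in> osimplex vs \<Longrightarrow> length ws = length vs"
  by (auto elim!: mem_osimplexE)

lemma simplex_vertices_mem_osimplex:
  "ws \<in> osimplex vs \<Longrightarrow> simplex_vertices k ws \<longleftrightarrow> simplex_vertices k vs"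
  using set_mem_osimplex[of ws vs] length_mem_osimplex[of ws vs]
  unfolding simplex_vertices_iff_aff_dim by simp

lemma carrier_of_osimplex [simp]: "carrier_of (osimplex vs) = convex hull (set vs)"
proof -
  have "(\<Union>ws\<in>osimplex vs. set ws) = set vs"
    using mem_osimplex_self[of vs] set_mem_osimplex by blast
  then show ?thesis by (simp add: carrier_of_def)
qed

lemma opposite_osimplex:
  assumes p: "p permutes {..<length vs}" "\<not> evenperm p"
  shows "opposite (osimplex vs) = osimplex (permute_list p vs)"
proof -
  have "opposite (osimplex vs) = {permute_list r vs | r. r permutes {..<length vs} \<and> \<not> evenperm r}"
    (is "_ = ?R")
  proof (intro equalityI subsetI)
    fix ws assume "ws \<in> opposite (osimplex vs)"
    then obtain r us where r: "us \<in> osimplex vs" "r permutes {..<length us}" "\<not> evenperm r"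
      "ws = permute_list r us" unfolding opposite_def by blast
    from r(1) obtain q where q: "q permutes {..<length vs}" "evenperm q" "us = permute_list q vs"
      by (rule mem_osimplexE)
    have "permutation q" "permutation r"
      using permutes_imp_permutation[OF finite_lessThan q(1)]
        permutes_imp_permutation[OF finite_lessThan r(2)] .
    then have "ws = permute_list (q \<circ> r) vs" "q \<circ> r permutes {..<length vs}" "\<not> evenperm (q \<circ> r)"
      using q r by (auto simp: permute_list_compose permutes_compose evenperm_comp)
    then show "ws \<in> ?R" by blast
  next
    fix ws assume "ws \<in> ?R"
    then show "ws \<in> opposite (osimplex vs)"
      using mem_osimplex_self[of vs] unfolding opposite_def by blast
  qed
  then show ?thesis using osimplex_permute[OF p(1)] p(2) by simp
qed

lemma opposite_osimplex_swap:
  assumes "2 \<le> length vs"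
  shows "opposite (osimplex vs) = osimplex (permute_list (Transposition.transpose 0 1) vs)"
  using assms by (intro opposite_osimplex permutes_swap_id) (auto simp: evenperm_swap)

text \<open>Even reorderings have frame determinant 1, so the sign is the same for all
  representatives and may be tested on the lists at hand.\<close>

lemma same_orientation_iff:
  fixes vs ws :: "'a::euclidean_space list"
  assumes "length vs = Suc k" "length ws = Suc k"
  shows "same_orientation k (osimplex vs) (osimplex ws) \<longleftrightarrow>
    affine hull (set vs) = affine hull (set ws) \<and> (\<exists>x>0. frame_det k vs ws x)"
proof
  assume "same_orientation k (osimplex vs) (osimplex ws)"
  then obtain vs' ws' x where *: "vs' \<in> osimplex vs" "ws' \<in> osimplex ws"
    "affine hull (set vs') = affine hull (set ws')" "0 < x" "frame_det k vs' ws' x"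
    unfolding same_orientation_def frame_det_def by blast
  have even: "frame_det k us us' 1" if us: "us' \<in> osimplex us" "length us = Suc k"
    for us us' :: "'a list"
  proof -
    obtain p where p: "p permutes {..<length us}" "evenperm p" "us' = permute_list p us"
      using us(1) by (rule mem_osimplexE)
    then have "p permutes {..k}" using us(2) by (simp add: lessThan_Suc_atMost)
    from frame_det_permute[OF this us(2)] show ?thesis using p by (simp add: sign_def)
  qed
  have "frame_det k ws' ws 1"
    using frame_det_sym[OF even[OF *(2) assms(2)]] by simp
  from frame_det_trans[OF frame_det_trans[OF even[OF *(1) assms(1)] *(5)] this]
  have "frame_det k vs ws x" by simp
  moreover have "affine hull (set vs) = affine hull (set ws)"
    using *(3) unfolding set_mem_osimplex[OF *(1)] set_mem_osimplex[OF *(2)] .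
  ultimately show "affine hull (set vs) = affine hull (set ws) \<and> (\<exists>x>0. frame_det k vs ws x)"
    using *(4) by blast
next
  assume "affine hull (set vs) = affine hull (set ws) \<and> (\<exists>x>0. frame_det k vs ws x)"
  then show "same_orientation k (osimplex vs) (osimplex ws)"
    unfolding same_orientation_def frame_det_def using mem_osimplex_self by blast
qed

lemma simplicesE:
  assumes "\<sigma> \<in> simplices k K"
  obtains vs where "\<sigma> = osimplex vs" "simplex_vertices k vs" "length vs = Suc k"
    "convex hull (set vs) \<subseteq> K"
  using assms unfolding simplices_def simplex_vertices_def by blast

lemma same_orientation_trans:
  fixes \<sigma> \<tau> \<rho> :: "'a::euclidean_space osimplex"
  assumes "\<sigma> \<in> simplices k UNIV" "\<tau> \<in> simplices k UNIV" "\<rho> \<in> simplices k UNIV"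
    and "same_orientation k \<sigma> \<tau>" "same_orientation k \<tau> \<rho>"
  shows "same_orientation k \<sigma> \<rho>"
proof -
  obtain us vs ws where *: "\<sigma> = osimplex us" "\<tau> = osimplex vs" "\<rho> = osimplex ws"
    "length us = Suc k" "length vs = Suc k" "length ws = Suc k"
    using assms(1-3) by (metis simplicesE)
  obtain x y where xy: "0 < x" "frame_det k us vs x" "0 < y" "frame_det k vs ws y"
    and hull: "affine hull (set us) = affine hull (set vs)" "affine hull (set vs) = affine hull (set ws)"
    using assms(4,5) unfolding *(1-3) same_orientation_iff[OF *(4,5)] same_orientation_iff[OF *(5,6)]
    by blast
  have "0 < x * y" "frame_det k us ws (x * y)"
    using xy by (auto intro: frame_det_trans)
  with hull show ?thesis
    unfolding *(1-3) same_orientation_iff[OF *(4,6)] by metis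
qed

lemma same_orientation_sym:
  fixes \<sigma> \<tau> :: "'a::euclidean_space osimplex"
  assumes "\<sigma> \<in> simplices k UNIV" "\<tau> \<in> simplices k UNIV" "same_orientation k \<sigma> \<tau>"
  shows "same_orientation k \<tau> \<sigma>"
proof -
  obtain us vs where *: "\<sigma> = osimplex us" "\<tau> = osimplex vs" "length us = Suc k" "length vs = Suc k"
    using assms(1-2) by (metis simplicesE)
  obtain x where "0 < x" "frame_det k us vs x" "affine hull (set us) = affine hull (set vs)"
    using assms(3) unfolding *(1,2) same_orientation_iff[OF *(3,4)] by blast
  then have "0 < 1 / x" "frame_det k vs us (1 / x)" "affine hull (set vs) = affine hull (set us)"
    by (auto intro: frame_det_sym)
  then show ?thesis unfolding *(1,2) same_orientation_iff[OF *(4,3)] by blast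
qed

text \<open>Exchanging the first two vertices represents the opposite orientation. A list with a
  single vertex has no odd reordering, hence \<open>0 < k\<close>.\<close>

lemma opposite_simplices:
  assumes "\<sigma> \<in> simplices k K" "0 < k"
  obtains vs vs' where "\<sigma> = osimplex vs" "opposite \<sigma> = osimplex vs'" "simplex_vertices k vs"
    "simplex_vertices k vs'" "set vs' = set vs" "frame_det k vs vs' (- 1)"
proof -
  obtain vs where vs: "\<sigma> = osimplex vs" "simplex_vertices k vs" "length vs = Suc k"
    using assms(1) by (rule simplicesE)
  define ws where "ws = permute_list (Transposition.transpose 0 1) vs"
  have p: "Transposition.transpose 0 1 permutes {..<length vs}"
    using vs assms(2) by (intro permutes_swap_id) auto
  have "opposite \<sigma> = osimplex ws" unfolding ws_def vs(1)
    using vs assms(2) by (intro opposite_osimplex_swap) simp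
  moreover have "set ws = set vs" using p by (simp add: ws_def)
  moreover have "length ws = Suc k" by (simp add: ws_def vs)
  then have "simplex_vertices k ws"
    using vs(2) \<open>set ws = set vs\<close> by (simp add: simplex_vertices_iff_aff_dim)
  moreover have "frame_det k vs ws (- 1)"
    unfolding ws_def using vs assms(2) by (intro frame_det_transpose) auto
  ultimately show thesis using that vs by blast
qed

section \<open>Norms and iterated bisection\<close>

text \<open>In contrast to \<open>dissect_concat\<close>, the further cuts of a leaf are attached to
  its position rather than to its vertices. This suits \<open>cells\<close>, where the next
  bisections also depend on an order stored with the leaf.\<close>

lemma dissect_refine:
  "dissect vs L \<Longrightarrow> list_all2 dissect L Ls \<Longrightarrow> dissect vs (concat Ls)"
proof (induction arbitrary: Ls rule: dissect.induct)
  case (trivial vs)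
  then show ?case by (auto simp: list_all2_Cons1)
next
  case (cut i vs j t z L M)
  then obtain Ls1 Ls2 where "Ls = Ls1 @ Ls2" "list_all2 dissect L Ls1" "list_all2 dissect M Ls2"
    by (auto simp: list_all2_append1)
  then show ?case using cut by (auto intro: dissect.cut)
qed

section \<open>Diameters in an arbitrary norm\<close>

locale arbitrary_norm =
  fixes N :: "'a::euclidean_space \<Rightarrow> real"
  assumes is_norm: "is_norm N"
begin

lemma N_nonneg [simp]: "0 \<le> N x"
  and N_eq_0_iff [simp]: "N x = 0 \<longleftrightarrow> x = 0"
  and N_scaleR [simp]: "N (c *\<^sub>R x) = \<bar>c\<bar> * N x"
  and N_triangle: "N (x + y) \<le> N x + N y"
  using is_norm unfolding is_norm_def by auto

lemma N_zero [simp]: "N 0 = 0"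
  by simp

lemma N_minus_commute: "N (x - y) = N (y - x)"
  using N_scaleR[of "-1" "x - y"] by simp

lemma N_triangle_diff: "N (x - z) \<le> N (x - y) + N (y - z)"
  using N_triangle[of "x - y" "y - z"] by simp

lemma N_le_norm: "\<exists>C>0. \<forall>x. N x \<le> C * norm x"
proof -
  define C where "C = (\<Sum>b\<in>Basis. N b) + 1"
  have sum: "N (\<Sum>b\<in>B. f b) \<le> (\<Sum>b\<in>B. N (f b))" if "finite B" for B and f :: "'a \<Rightarrow> 'a"
    using that by (induction B) (auto intro: order_trans[OF N_triangle])
  have "N x \<le> C * norm x" for x
  proof -
    have "N x \<le> (\<Sum>b\<in>Basis. N ((x \<bullet> b) *\<^sub>R b))"
      using sum[of Basis "\<lambda>b. (x \<bullet> b) *\<^sub>R b"] by (simp add: euclidean_representation)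
    also have "\<dots> \<le> (\<Sum>b\<in>Basis. norm x * N b)"
      by (intro sum_mono) (auto intro!: mult_right_mono Basis_le_norm)
    also have "\<dots> \<le> C * norm x"
      unfolding C_def sum_distrib_left[symmetric] by (simp add: distrib_left mult.commute)
    finally show ?thesis .
  qed
  moreover have "0 < C" unfolding C_def by (simp add: add_nonneg_pos sum_nonneg)
  ultimately show ?thesis by blast
qed

lemma norm_le_N: "\<exists>C>0. \<forall>x. norm x \<le> C * N x"
proof -
  obtain C where C: "0 < C" "\<And>x. N x \<le> C * norm x" using N_le_norm by blast
  have "\<bar>N x - N y\<bar> \<le> C * dist x y" for x y
    using N_triangle[of "x - y" y] N_triangle[of "y - x" x] C(2)[of "x - y"] N_minus_commute[of x y]
    by (simp add: dist_norm)
  then have "C-lipschitz_on UNIV N"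
    using C(1) by (intro lipschitz_onI) (auto simp: dist_real_def)
  then have "continuous_on (sphere 0 1) N"
    using lipschitz_on_continuous_on continuous_on_subset by blast
  moreover have "compact (sphere (0::'a) 1)" by simp
  moreover have "sphere (0::'a) 1 \<noteq> {}" by simp
  ultimately obtain a where a: "a \<in> sphere 0 1" "\<And>x. x \<in> sphere 0 1 \<Longrightarrow> N a \<le> N x"
    using continuous_attains_inf[of "sphere (0::'a) 1" N] by auto
  have "a \<noteq> 0" using a(1) by auto
  then have pos: "0 < N a" using N_nonneg[of a] N_eq_0_iff[of a] by linarith
  have "norm x \<le> (1 / N a) * N x" for x
  proof (cases "x = 0")
    case False
    then have "N a \<le> N ((1 / norm x) *\<^sub>R x)" by (intro a(2)) simp
    then show ?thesis using False pos by (simp add: field_simps)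
  qed simp
  then show ?thesis using pos by (intro exI[of _ "1 / N a"]) auto
qed

text \<open>Closed \<open>N\<close>-balls are convex, so the bound passes from \<open>A\<close> to
  its hull in one argument at a time.\<close>

lemma N_diff_hull_le:
  assumes "\<And>p q. p \<in> A \<Longrightarrow> q \<in> A \<Longrightarrow> N (p - q) \<le> D" "x \<in> convex hull A" "y \<in> convex hull A"
  shows "N (x - y) \<le> D"
proof -
  have conv: "convex {x. N (x - y) \<le> D}" for y
  proof (rule convexI)
    fix p q u v assume a: "p \<in> {x. N (x - y) \<le> D}" "q \<in> {x. N (x - y) \<le> D}"
      and uv: "0 \<le> u" "0 \<le> v" "u + v = (1::real)"
    have "u *\<^sub>R p + v *\<^sub>R q - y = u *\<^sub>R p + v *\<^sub>R q - (u + v) *\<^sub>R y" using uv by simp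
    also have "\<dots> = u *\<^sub>R (p - y) + v *\<^sub>R (q - y)" by (simp add: algebra_simps)
    finally have "N (u *\<^sub>R p + v *\<^sub>R q - y) \<le> u * N (p - y) + v * N (q - y)"
      using N_triangle[of "u *\<^sub>R (p - y)" "v *\<^sub>R (q - y)"] uv by simp
    also have "\<dots> \<le> u * D + v * D" using a uv by (intro add_mono mult_left_mono) auto
    also have "\<dots> = D" using uv by (simp flip: distrib_right)
    finally show "u *\<^sub>R p + v *\<^sub>R q \<in> {x. N (x - y) \<le> D}" by simp
  qed
  have 1: "N (x - q) \<le> D" if "q \<in> A" for q
  proof -
    have "convex hull A \<subseteq> {x. N (x - q) \<le> D}"
      using assms(1) that by (intro hull_minimal conv) auto
    then show ?thesis using assms(2) by auto
  qed
  have "convex hull A \<subseteq> {y. N (y - x) \<le> D}"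
    using 1 by (intro hull_minimal conv) (auto simp: N_minus_commute[of _ x])
  then show ?thesis using assms(3) by (auto simp: N_minus_commute[of _ x])
qed

lemma ediam_le:
  assumes "\<And>x y. x \<in> S \<Longrightarrow> y \<in> S \<Longrightarrow> N (x - y) \<le> D"
  shows "ediam N S \<le> ennreal D"
  unfolding ediam_def by (intro SUP_least ennreal_leI assms)

lemma ediam_hull_le:
  assumes "\<And>p q. p \<in> A \<Longrightarrow> q \<in> A \<Longrightarrow> N (p - q) \<le> D"
  shows "ediam N (convex hull A) \<le> ennreal D"
  using N_diff_hull_le[OF assms] by (intro ediam_le) blast

lemma ediam_hull_finite:
  assumes "finite A"
  shows "ediam N (convex hull A) < \<infinity>"
proof -
  have "N (p - q) \<le> (\<Sum>p\<in>A. \<Sum>q\<in>A. N (p - q))" if "p \<in> A" "q \<in> A" for p q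
    using assms that
    by (intro order_trans[OF member_le_sum[of q A "\<lambda>q. N (p - q)"]]
        order_trans[OF _ member_le_sum[of p A "\<lambda>p. \<Sum>q\<in>A. N (p - q)"]] sum_nonneg) auto
  then have "ediam N (convex hull A) \<le> ennreal (\<Sum>p\<in>A. \<Sum>q\<in>A. N (p - q))"
    by (rule ediam_hull_le)
  then show ?thesis using le_less_trans ennreal_less_top by fastforce
qed

lemma N_diff_le_diam:
  assumes "x \<in> convex hull (set vs)" "y \<in> convex hull (set vs)"
  shows "N (x - y) \<le> diam N (osimplex vs)"
proof -
  have "ennreal (N (x - y)) \<le> ediam N (convex hull (set vs))"
    unfolding ediam_def using assms by (meson SUP_upper2 order_refl)
  moreover have "ediam N (convex hull (set vs)) < \<infinity>" by (rule ediam_hull_finite) simp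
  ultimately have "enn2real (ennreal (N (x - y))) \<le> enn2real (ediam N (convex hull (set vs)))"
    by (intro enn2real_mono) auto
  then show ?thesis by (simp add: diam_def)
qed

lemma diam_osimplex_le:
  assumes "0 \<le> D" "\<And>p q. p \<in> set vs \<Longrightarrow> q \<in> set vs \<Longrightarrow> N (p - q) \<le> D"
  shows "diam N (osimplex vs) \<le> D"
  using ediam_hull_le[OF assms(2)] assms(1) unfolding diam_def
  by (simp add: enn2real_leI)

lemma diam_nonneg [simp]: "0 \<le> diam N \<sigma>"
  by (simp add: diam_def)

lemma diam_pos:
  assumes "simplex_vertices k vs" "0 < k"
  shows "0 < diam N (osimplex vs)"
proof -
  have "vs ! 0 \<noteq> vs ! 1" "0 < length vs" "1 < length vs"
    using assms by (auto simp: simplex_vertices_def nth_eq_iff_index_eq)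
  then have "0 < N (vs ! 0 - vs ! 1)"
    using N_nonneg[of "vs ! 0 - vs ! 1"] N_eq_0_iff[of "vs ! 0 - vs ! 1"]
    by (simp add: less_le del: N_nonneg)
  also have "\<dots> \<le> diam N (osimplex vs)"
    using \<open>0 < length vs\<close> \<open>1 < length vs\<close> by (intro N_diff_le_diam hull_inc) auto
  finally show ?thesis .
qed

lemma diam_mono:
  assumes "convex hull (set ws) \<subseteq> convex hull (set vs)"
  shows "diam N (osimplex ws) \<le> diam N (osimplex vs)"
  using assms hull_subset[of "set ws" convex]
  by (intro diam_osimplex_le N_diff_le_diam) auto

end

text \<open>The vertices indexed by \<open>us\<close> form a path which is still to be bisected, those indexed by
  \<open>zs\<close> are midpoints that were already inserted in the current round. Bisecting the edge between
  the two ends of the path leaves a path shorter by one in either half (Maubach's rule), so that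
  the edges do not degenerate under iteration.\<close>

function halve ::
    "'a::real_vector list \<Rightarrow> nat list \<Rightarrow> nat list \<Rightarrow> ('a list \<times> nat list) list" where
  "halve vs (u # v # us) zs =
     (let w = last (v # us); m = midpoint (vs ! u) (vs ! w) in
       halve (vs[w := m]) (u # butlast (v # us)) (w # zs) @ halve (vs[u := m]) (v # us) (u # zs))"
| "halve vs [u] zs = [(vs, u # zs)]"
| "halve vs [] zs = [(vs, zs)]"
  by pat_completeness auto
termination by (relation "Wellfounded.measure (\<lambda>(vs, us, zs). length us)") auto

text \<open>The second component is the path along which the next round bisects; keeping it apart
  leaves the positions in the vertex list, and thereby the orientation, untouched. One step is a
  whole round of k successive bisections, not a single one.\<close>

primrec cells :: "nat \<Rightarrow> 'a::real_vector list \<Rightarrow> ('a list \<times> nat list) list" where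
  "cells 0 vs = [(vs, [0..<length vs])]"
| "cells (Suc n) vs = concat (map (\<lambda>(ws, us). halve ws us []) (cells n vs))"

definition vertex_order :: "'a list \<Rightarrow> nat list \<Rightarrow> bool" where
  "vertex_order vs us \<longleftrightarrow> distinct us \<and> set us = {..<length vs}"

text \<open>Bookkeeping for the two recursive calls of \<open>halve\<close>: the index of the end
  that is replaced by the midpoint leaves the path and moves to the front of
  \<open>zs\<close>.\<close>

lemma vertex_order_step:
  assumes "vertex_order vs ((u # v # us) @ zs)" and "w = last (v # us)"
  shows "u < length vs" "w < length vs" "u \<noteq> w" "w \<notin> set (u # butlast (v # us))"
    "w \<notin> set zs" "u \<notin> set (v # us)" "u \<notin> set zs"
    "vertex_order (vs[w := m]) ((u # butlast (v # us)) @ w # zs)"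
    "vertex_order (vs[u := m]) ((v # us) @ u # zs)"
proof -
  have e: "v # us = butlast (v # us) @ [w]" using assms(2) by simp
  have *: "distinct (u # (butlast (v # us) @ [w]) @ zs)"
    "set (u # (butlast (v # us) @ [w]) @ zs) = {..<length vs}"
    using assms(1) unfolding vertex_order_def e[symmetric] by simp_all
  have "w \<in> set (v # us)" using assms(2) by simp
  then show "u < length vs" "w < length vs" "u \<noteq> w"
    using assms(1) unfolding vertex_order_def by auto
  show "w \<notin> set (u # butlast (v # us))" "w \<notin> set zs" using * by (auto simp del: butlast.simps)
  show "u \<notin> set (v # us)" "u \<notin> set zs" using assms(1) by (auto simp: vertex_order_def)
  show "vertex_order (vs[w := m]) ((u # butlast (v # us)) @ w # zs)"
    using * by (auto simp: vertex_order_def simp del: butlast.simps)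
  show "vertex_order (vs[u := m]) ((v # us) @ u # zs)"
    using assms(1) by (auto simp: vertex_order_def)
qed

lemma nth_list_update_notin: "i \<notin> A \<Longrightarrow> j \<in> A \<Longrightarrow> xs[i := x] ! j = xs ! j"
  by (metis nth_list_update_neq)

lemma halve_vertex_order:
  "vertex_order vs (us @ zs) \<Longrightarrow> (ws, os) \<in> set (halve vs us zs) \<Longrightarrow>
    length ws = length vs \<and> vertex_order ws os"
proof (induction vs us zs rule: halve.induct)
  case (1 vs u v us zs)
  define w where "w = last (v # us)"
  define m where "m = midpoint (vs ! u) (vs ! w)"
  note step = vertex_order_step[OF "1.prems"(1) w_def]
  show ?case
    using "1.IH"[OF w_def m_def] "1.prems"(2) step(8,9)[of m]
    by (auto simp: Let_def w_def m_def simp del: butlast.simps)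
qed auto

lemma halve_dissect:
  "vertex_order vs (us @ zs) \<Longrightarrow> dissect vs (map fst (halve vs us zs))"
proof (induction vs us zs rule: halve.induct)
  case (1 vs u v us zs)
  define w where "w = last (v # us)"
  define m where "m = midpoint (vs ! u) (vs ! w)"
  note step = vertex_order_step[OF "1.prems"(1) w_def]
  have "m = (1 - 1/2) *\<^sub>R vs ! w + (1/2) *\<^sub>R vs ! u"
    by (simp add: m_def midpoint_def scaleR_add_right)
  moreover have "dissect (vs[w := m]) (map fst (halve (vs[w := m]) (u # butlast (v # us)) (w # zs)))"
    "dissect (vs[u := m]) (map fst (halve (vs[u := m]) (v # us) (u # zs)))"
    using "1.IH"[OF w_def m_def] step(8,9)[of m] by auto
  ultimately have "dissect vs (map fst (halve (vs[w := m]) (u # butlast (v # us)) (w # zs)) @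
      map fst (halve (vs[u := m]) (v # us) (u # zs)))"
    using step(1-3) by (intro dissect.cut[of w vs u "1/2" m]) auto
  then show ?case
    by (simp add: Let_def w_def m_def del: butlast.simps)
qed (auto intro: dissect.trivial)

lemma halve_length: "us \<noteq> [] \<Longrightarrow> length (halve vs us zs) = 2 ^ (length us - 1)"
  by (induction vs us zs rule: halve.induct) (auto simp: Let_def)

text \<open>Only edges between path vertices are bisected, and these still have the positions they
  had at the start of the round. No midpoint of a midpoint occurs within a round, so
  \<open>A\<close> and \<open>B\<close> can be lattices whose scales differ by a single factor
  2.\<close>

lemma halve_vertices:
  assumes "\<And>x y. x \<in> A \<Longrightarrow> y \<in> A \<Longrightarrow> midpoint x y \<in> B" "A \<subseteq> B"
  shows "vertex_order vs (us @ zs) \<Longrightarrow> (\<forall>u\<in>set us. vs ! u \<in> A) \<Longrightarrow> (\<forall>z\<in>set zs. vs ! z \<in> B) \<Longrightarrow>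
    (ws, os) \<in> set (halve vs us zs) \<Longrightarrow> set ws \<subseteq> B"
proof (induction vs us zs rule: halve.induct)
  case (1 vs u v us zs)
  define w where "w = last (v # us)"
  define m where "m = midpoint (vs ! u) (vs ! w)"
  note step = vertex_order_step[OF "1.prems"(1) w_def]
  have mB: "m \<in> B" unfolding m_def using "1.prems"(2) by (intro assms(1)) (auto simp: w_def)
  have sub: "set (butlast (v # us)) \<subseteq> set (v # us)" by (meson in_set_butlastD subsetI)
  from "1.prems"(4) consider
    "(ws, os) \<in> set (halve (vs[w := m]) (u # butlast (v # us)) (w # zs))"
    | "(ws, os) \<in> set (halve (vs[u := m]) (v # us) (u # zs))"
    by (auto simp: Let_def w_def m_def simp del: butlast.simps)
  then show ?case
  proof cases
    case 1
    have "\<forall>i\<in>set (u # butlast (v # us)). vs[w := m] ! i \<in> A"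
      using "1.prems"(2) sub
      by (auto simp: nth_list_update_notin[OF step(4)] simp del: butlast.simps)
    moreover have "\<forall>i\<in>set (w # zs). vs[w := m] ! i \<in> B"
      using "1.prems"(3) step(2,5) mB by (auto simp: nth_list_update)
    ultimately show ?thesis using "1.IH"(1)[OF w_def m_def step(8)] 1 by blast
  next
    case 2
    have "\<forall>i\<in>set (v # us). vs[u := m] ! i \<in> A"
      using "1.prems"(2) by (auto simp: nth_list_update_notin[OF step(6)])
    moreover have "\<forall>i\<in>set (u # zs). vs[u := m] ! i \<in> B"
      using "1.prems"(3) step(1,7) mB by (auto simp: nth_list_update)
    ultimately show ?thesis using "1.IH"(2)[OF w_def m_def step(9)] 2 by blast
  qed
next
  case (2 vs u zs)
  then have "vs ! i \<in> B" if "i < length vs" for i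
    using that assms(2) unfolding vertex_order_def by (metis UnE lessThan_iff set_append subsetD)
  then show ?case using 2 by (auto simp: in_set_conv_nth)
next
  case (3 vs zs)
  then have "vs ! i \<in> B" if "i < length vs" for i
    using that unfolding vertex_order_def by (metis append_Nil lessThan_iff)
  then show ?case using 3 by (auto simp: in_set_conv_nth)
qed

text \<open>The invariant: steps are at most \<open>D\<close> along the path, at most
  \<open>D / 2\<close> along the inserted midpoints, and the midpoint to be inserted next is within
  \<open>D / 2\<close> of the latest one. The last part persists because dropping an end of the path
  moves the midpoint of its ends by half of the dropped step.\<close>

lemma (in arbitrary_norm) halve_steps:
  assumes "us \<noteq> []" "vertex_order vs (us @ zs)"
    "successively (\<lambda>a b. N (vs ! a - vs ! b) \<le> D) us"
    "successively (\<lambda>a b. N (vs ! a - vs ! b) \<le> D / 2) zs"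
    "zs \<noteq> [] \<Longrightarrow> N (midpoint (vs ! hd us) (vs ! last us) - vs ! hd zs) \<le> D / 2"
    "(ws, os) \<in> set (halve vs us zs)"
  shows "successively (\<lambda>a b. N (ws ! a - ws ! b) \<le> D / 2) os"
  using assms
proof (induction vs us zs rule: halve.induct)
  case (1 vs u v us zs)
  define w where "w = last (v # us)"
  define m where "m = midpoint (vs ! u) (vs ! w)"
  note step = vertex_order_step[OF "1.prems"(2) w_def]
  have e: "v # us = butlast (v # us) @ [w]" by (simp add: w_def)
  have cong: "successively (\<lambda>a b. N (vs[i := m] ! a - vs[i := m] ! b) \<le> d) xs"
    if "successively (\<lambda>a b. N (vs ! a - vs ! b) \<le> d) xs" "i \<notin> set xs" for i d xs
    using that(1)
    by (subst successively_cong[where Q = "\<lambda>a b. N (vs ! a - vs ! b) \<le> d"])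
      (auto simp: nth_list_update_notin[OF that(2)])
  have zs: "zs \<noteq> [] \<Longrightarrow> N (m - vs ! hd zs) \<le> D / 2"
    using "1.prems"(5) by (simp add: m_def w_def)
  from "1.prems"(6) consider
    "(ws, os) \<in> set (halve (vs[w := m]) (u # butlast (v # us)) (w # zs))"
    | "(ws, os) \<in> set (halve (vs[u := m]) (v # us) (u # zs))"
    by (auto simp: Let_def w_def m_def simp del: butlast.simps)
  then show ?case
  proof cases
    case 1
    let ?xs = "u # butlast (v # us)"
    have s: "successively (\<lambda>a b. N (vs ! a - vs ! b) \<le> D) (?xs @ [w])"
      using "1.prems"(3) unfolding append_Cons e[symmetric] .
    then have sx: "successively (\<lambda>a b. N (vs ! a - vs ! b) \<le> D) ?xs"
      and last: "N (vs ! last ?xs - vs ! w) \<le> D"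
      unfolding successively_append_iff by simp_all
    have lx: "last ?xs \<in> set ?xs" by (intro last_in_set) simp
    show ?thesis
    proof (rule "1.IH"(1)[OF w_def m_def _ step(8) _ _ _ 1])
      show "successively (\<lambda>a b. N (vs[w := m] ! a - vs[w := m] ! b) \<le> D) ?xs"
        by (rule cong[OF sx step(4)])
      show "successively (\<lambda>a b. N (vs[w := m] ! a - vs[w := m] ! b) \<le> D / 2) (w # zs)"
      proof (cases zs)
        case (Cons z zs')
        then have "z \<noteq> w" using step(5) by auto
        moreover have "successively (\<lambda>a b. N (vs[w := m] ! a - vs[w := m] ! b) \<le> D / 2) zs"
          by (rule cong[OF "1.prems"(4) step(5)])
        ultimately show ?thesis using zs Cons step(2) by simp
      qed simp
      have "midpoint (vs ! u) (vs ! last ?xs) - m = (1/2) *\<^sub>R (vs ! last ?xs - vs ! w)"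
        by (simp add: m_def midpoint_def algebra_simps)
      then have "N (midpoint (vs ! u) (vs ! last ?xs) - m) \<le> D / 2"
        using last by simp
      moreover have "vs[w := m] ! last ?xs = vs ! last ?xs" "vs[w := m] ! u = vs ! u"
        using lx by (simp_all add: nth_list_update_notin[OF step(4)] del: butlast.simps last.simps)
      ultimately show "N (midpoint (vs[w := m] ! hd ?xs) (vs[w := m] ! last ?xs)
          - vs[w := m] ! hd (w # zs)) \<le> D / 2"
        using step(2) by simp
    qed simp
  next
    case 2
    have sx: "successively (\<lambda>a b. N (vs ! a - vs ! b) \<le> D) (v # us)" and uv: "N (vs ! u - vs ! v) \<le> D"
      using "1.prems"(3) by auto
    have "v \<noteq> u" using step(6) by auto
    show ?thesis
    proof (rule "1.IH"(2)[OF w_def m_def _ step(9) _ _ _ 2])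
      show "successively (\<lambda>a b. N (vs[u := m] ! a - vs[u := m] ! b) \<le> D) (v # us)"
        by (rule cong[OF sx step(6)])
      show "successively (\<lambda>a b. N (vs[u := m] ! a - vs[u := m] ! b) \<le> D / 2) (u # zs)"
      proof (cases zs)
        case (Cons z zs')
        then have "z \<noteq> u" using step(7) by auto
        moreover have "successively (\<lambda>a b. N (vs[u := m] ! a - vs[u := m] ! b) \<le> D / 2) zs"
          by (rule cong[OF "1.prems"(4) step(7)])
        ultimately show ?thesis using zs Cons step(1) by simp
      qed simp
      have "midpoint (vs ! v) (vs ! w) - m = (1/2) *\<^sub>R (vs ! v - vs ! u)"
        by (simp add: m_def midpoint_def algebra_simps)
      then have "N (midpoint (vs ! v) (vs ! w) - m) \<le> D / 2"
        using uv by (simp add: N_minus_commute)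
      then show "N (midpoint (vs[u := m] ! hd (v # us)) (vs[u := m] ! last (v # us))
          - vs[u := m] ! hd (u # zs)) \<le> D / 2"
        using step(1,3) \<open>v \<noteq> u\<close> unfolding w_def[symmetric] by simp
    qed simp
  qed
next
  case (2 vs u zs)
  \<comment> \<open>The path has shrunk to \<open>u\<close>, which is its own midpoint, so the
    assumption on the next midpoint supplies the missing step from \<open>u\<close> to
    \<open>hd zs\<close>.\<close>
  then show ?case by (cases zs) auto
qed auto

lemma cells_vertex_order:
  "(ws, us) \<in> set (cells n vs) \<Longrightarrow> length ws = length vs \<and> vertex_order ws us"
proof (induction n arbitrary: ws us)
  case 0
  then show ?case by (auto simp: vertex_order_def)
next
  case (Suc n)
  then obtain w o' where "(w, o') \<in> set (cells n vs)" "(ws, us) \<in> set (halve w o' [])" by auto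
  then show ?case using Suc.IH[of w o'] halve_vertex_order[of w o' "[]" ws us] by auto
qed

lemma cells_dissect: "dissect vs (map fst (cells n vs))"
proof (induction n)
  case 0
  then show ?case by (auto intro: dissect.trivial)
next
  case (Suc n)
  have "list_all2 dissect (map fst (cells n vs))
      (map (\<lambda>(ws, us). map fst (halve ws us [])) (cells n vs))"
    unfolding list_all2_map1 list_all2_map2 list_all2_same
    using cells_vertex_order[of _ _ n vs] by (auto intro!: halve_dissect)
  from dissect_refine[OF Suc this] show ?case
    by (simp add: map_concat comp_def split_def)
qed

lemma cells_length:
  assumes "length vs = Suc k"
  shows "length (cells n vs) = 2 ^ (k * n)"
proof (induction n)
  case (Suc n)
  have "length (halve ws us []) = 2 ^ k" if "(ws, us) \<in> set (cells n vs)" for ws us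
  proof -
    from cells_vertex_order[OF that] have "length us = Suc k"
      using assms by (metis card_lessThan distinct_card vertex_order_def)
    then show ?thesis by (subst halve_length) auto
  qed
  then have "map (length \<circ> (\<lambda>(ws, us). halve ws us [])) (cells n vs) = map (\<lambda>_. 2 ^ k) (cells n vs)"
    by (intro map_cong) auto
  then show ?case using Suc
    unfolding cells.simps length_concat map_map
    by (simp add: sum_list_triv power_add mult.commute del: map_eq_conv)
qed simp

context arbitrary_norm
begin

lemma successively_bound:
  "successively (\<lambda>a b. N (f a - f b) \<le> D) xs \<Longrightarrow> 0 \<le> D \<Longrightarrow> a \<in> set xs \<Longrightarrow> b \<in> set xs \<Longrightarrow>
    N (f a - f b) \<le> real (length xs - 1) * D"
proof (induction xs arbitrary: a b)
  case (Cons x xs)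
  have 1: "N (f x - f b) \<le> real (length xs) * D" if b: "b \<in> set xs" for b
  proof -
    obtain y ys where xs: "xs = y # ys" using b by (cases xs) auto
    have "N (f x - f b) \<le> N (f x - f y) + N (f y - f b)" by (rule N_triangle_diff)
    also have "\<dots> \<le> D + real (length xs - 1) * D"
      using Cons.prems Cons.IH[of y b] b xs by (intro add_mono) auto
    finally show ?thesis using xs by (simp add: algebra_simps)
  qed
  have 2: "N (f a - f b) \<le> real (length xs) * D" if "a \<in> set xs" "b \<in> set xs" for a b
  proof -
    have "N (f a - f b) \<le> real (length xs - 1) * D"
      using Cons.prems that by (intro Cons.IH) (auto simp: successively_Cons)
    also have "\<dots> \<le> real (length xs) * D" using Cons.prems by (intro mult_right_mono) auto
    finally show ?thesis .
  qed
  have "0 \<le> real (length xs) * D" using Cons.prems by simp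
  then show ?case
    using Cons.prems(3,4) 1[of a] 1[of b] 2[of a b] N_minus_commute[of "f x"] by auto
qed simp

lemma cells_steps:
  assumes "length vs = Suc k" "\<And>p q. p \<in> set vs \<Longrightarrow> q \<in> set vs \<Longrightarrow> N (p - q) \<le> D"
  shows "(ws, us) \<in> set (cells n vs) \<Longrightarrow> successively (\<lambda>a b. N (ws ! a - ws ! b) \<le> D / 2 ^ n) us"
proof (induction n arbitrary: ws us)
  case 0
  have "successively (\<lambda>a b. N (vs ! a - vs ! b) \<le> D) [0..<length vs]"
    using assms(2) by (auto simp: successively_conv_nth)
  then show ?case using 0 by simp
next
  case (Suc n)
  then obtain w o' where w: "(w, o') \<in> set (cells n vs)" "(ws, us) \<in> set (halve w o' [])" by auto
  have vo: "vertex_order w o'" "length w = Suc k" using cells_vertex_order[OF w(1)] assms(1) by auto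
  have "0 \<in> set o'" using vo unfolding vertex_order_def by simp
  then have "o' \<noteq> []" by auto
  then show ?case
    using halve_steps[of o' w "[]" "D / 2 ^ n", OF _ _ Suc.IH[OF w(1)] _ _ w(2)] vo
    by (simp add: mult.commute)
qed

text \<open>Only consecutive vertices on the path are controlled directly; the factor
  \<open>k\<close> is the number of steps of a path through all k + 1 vertices.\<close>

lemma cells_diameter:
  assumes "length vs = Suc k" "\<And>p q. p \<in> set vs \<Longrightarrow> q \<in> set vs \<Longrightarrow> N (p - q) \<le> D"
    and "(ws, us) \<in> set (cells n vs)" "p \<in> set ws" "q \<in> set ws"
  shows "N (p - q) \<le> real k * D / 2 ^ n"
proof -
  have vo: "distinct us" "set us = {..<length ws}" "length ws = Suc k"
    using cells_vertex_order[OF assms(3)] assms(1) by (auto simp: vertex_order_def)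
  then have len: "length us = Suc k" by (metis card_lessThan distinct_card)
  have "vs \<noteq> []" using assms(1) by auto
  then have "0 \<le> D" using assms(2)[of "hd vs" "hd vs"] by simp
  obtain a b where ab: "a < length ws" "b < length ws" "p = ws ! a" "q = ws ! b"
    using assms(4,5) by (auto simp: in_set_conv_nth)
  then have "N (ws ! a - ws ! b) \<le> real (length us - 1) * (D / 2 ^ n)"
    using vo \<open>0 \<le> D\<close> by (intro successively_bound[OF cells_steps[OF assms(1-3)]]) auto
  then show ?thesis using ab len by simp
qed

end

text \<open>The integer coefficients are not confined to the simplex, so rescaled differences of
  lattice points form a group that is the same for all scales \<open>h\<close>.\<close>

definition lattice_points :: "real \<Rightarrow> nat \<Rightarrow> 'a::real_vector list \<Rightarrow> 'a set" where
  "lattice_points h k vs =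
     {vs ! 0 + h *\<^sub>R (\<Sum>i<k. of_int (m i) *\<^sub>R (vs ! Suc i - vs ! 0)) | m :: nat \<Rightarrow> int. True}"

lemma midpoint_lattice_points:
  assumes "x \<in> lattice_points h k vs" "y \<in> lattice_points h k vs"
  shows "midpoint x y \<in> lattice_points (h / 2) k vs"
proof -
  obtain a where x: "x = vs ! 0 + h *\<^sub>R (\<Sum>i<k. of_int (a i) *\<^sub>R (vs ! Suc i - vs ! 0))"
    using assms(1) by (auto simp: lattice_points_def)
  obtain b where y: "y = vs ! 0 + h *\<^sub>R (\<Sum>i<k. of_int (b i) *\<^sub>R (vs ! Suc i - vs ! 0))"
    using assms(2) by (auto simp: lattice_points_def)
  define A where "A = (\<Sum>i<k. of_int (a i) *\<^sub>R (vs ! Suc i - vs ! 0))"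
  define B where "B = (\<Sum>i<k. of_int (b i) *\<^sub>R (vs ! Suc i - vs ! 0))"
  have AB: "A + B = (\<Sum>i<k. of_int (a i + b i) *\<^sub>R (vs ! Suc i - vs ! 0))"
    by (simp add: A_def B_def sum.distrib scaleR_add_left)
  have "midpoint x y = (1/2) *\<^sub>R (vs ! 0 + vs ! 0) + (h / 2) *\<^sub>R (A + B)"
    unfolding x y A_def[symmetric] B_def[symmetric] midpoint_def by (simp add: algebra_simps)
  also have "(1/2) *\<^sub>R (vs ! 0 + vs ! 0) = vs ! 0"
    by (simp flip: scaleR_2)
  finally show ?thesis unfolding AB lattice_points_def mem_Collect_eq
    by (intro exI[of _ "\<lambda>i. a i + b i"]) simp
qed

lemma lattice_points_half_mono: "lattice_points h k vs \<subseteq> lattice_points (h / 2) k vs"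
  using midpoint_lattice_points[of _ h k vs] midpoint_idem by (metis subsetI)

lemma cells_lattice:
  assumes "length vs = Suc k"
  shows "(ws, us) \<in> set (cells n vs) \<Longrightarrow> set ws \<subseteq> lattice_points (1 / 2 ^ n) k vs"
proof (induction n arbitrary: ws us)
  case 0
  have "vs ! j \<in> lattice_points 1 k vs" if "j < Suc k" for j
  proof -
    define m where "m = (\<lambda>i. if Suc i = j then 1 else 0 :: int)"
    have "(\<Sum>i<k. of_int (m i) *\<^sub>R (vs ! Suc i - vs ! 0)) = vs ! j - vs ! 0"
    proof (cases j)
      case (Suc r)
      have "(\<Sum>i<k. of_int (m i) *\<^sub>R (vs ! Suc i - vs ! 0))
        = (\<Sum>i<k. if r = i then vs ! Suc i - vs ! 0 else 0)"
        by (intro sum.cong) (auto simp: m_def Suc)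
      then show ?thesis using that Suc by simp
    qed (simp add: m_def)
    then have "vs ! j = vs ! 0 + 1 *\<^sub>R (\<Sum>i<k. of_int (m i) *\<^sub>R (vs ! Suc i - vs ! 0))" by simp
    then show ?thesis unfolding lattice_points_def by blast
  qed
  then show ?case using 0 assms by (auto simp: in_set_conv_nth)
next
  case (Suc n)
  then obtain w o' where w: "(w, o') \<in> set (cells n vs)" "(ws, us) \<in> set (halve w o' [])" by auto
  have vo: "vertex_order w o'" using cells_vertex_order[OF w(1)] by auto
  then have "\<forall>u\<in>set o'. w ! u \<in> lattice_points (1 / 2 ^ n) k vs"
    using Suc.IH[OF w(1)] by (auto simp: vertex_order_def)
  moreover have "lattice_points (1 / 2 ^ n) k vs \<subseteq> lattice_points (1 / 2 ^ Suc n) k vs"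
    using lattice_points_half_mono[of "1 / 2 ^ n" k vs] by (simp add: mult.commute)
  moreover have "midpoint x y \<in> lattice_points (1 / 2 ^ Suc n) k vs"
    if "x \<in> lattice_points (1 / 2 ^ n) k vs" "y \<in> lattice_points (1 / 2 ^ n) k vs" for x y
    using midpoint_lattice_points[OF that] by (simp add: mult.commute)
  ultimately show ?case
    using halve_vertices[of "lattice_points (1 / 2 ^ n) k vs" "lattice_points (1 / 2 ^ Suc n) k vs"
        w o' "[]" ws us] vo w(2) by auto
qed

section \<open>Hausdorff measure of simplices\<close>

context arbitrary_norm
begin

lemma Vol_mono: "A \<subseteq> B \<Longrightarrow> Vol N k A \<le> Vol N k B"
  unfolding Vol_def hausdorff_pre_def by (intro SUP_mono' INF_superset_mono) auto

text \<open>With \<open>k = m + 1\<close> points, generation n of \<open>cells\<close> covers the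
  hull by 2^(m n) sets of diameter at most m D / 2^n. The sum of the k-th powers of the diameters is
  then (m D)^k / 2^n, which tends to zero.\<close>

lemma Vol_hull_eq_0:
  assumes "length fs = k" "0 < k"
  shows "Vol N k (convex hull (set fs)) = 0"
proof -
  obtain m where m: "k = Suc m" using assms(2) by (cases k) auto
  define D where "D = (\<Sum>p\<in>set fs. \<Sum>q\<in>set fs. N (p - q))"
  have D: "N (p - q) \<le> D" if "p \<in> set fs" "q \<in> set fs" for p q
    unfolding D_def using that
    by (intro order_trans[OF member_le_sum[of q "set fs" "\<lambda>q. N (p - q)"]]
        order_trans[OF _ member_le_sum[of p "set fs" "\<lambda>p. \<Sum>q\<in>set fs. N (p - q)"]] sum_nonneg) auto
  have D0: "0 \<le> D" unfolding D_def by (intro sum_nonneg) auto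
  define r where "r = (\<lambda>n. real m * D / 2 ^ n)"
  have r0: "0 \<le> r n" for n using D0 by (simp add: r_def)
  have le: "hausdorff_pre N k \<delta> (convex hull (set fs)) \<le> ennreal ((real m * D) ^ k / 2 ^ n)"
    if n: "r n \<le> \<delta>" for n \<delta>
  proof -
    define L where "L = map fst (cells n fs)"
    define C where "C = (\<lambda>i. if i < length L then convex hull (set (L ! i)) else {})"
    have ed: "ediam N (C i) \<le> ennreal (r n)" for i
    proof (cases "i < length L")
      case True
      then obtain us where "(L ! i, us) \<in> set (cells n fs)"
        by (metis L_def fst_conv in_set_conv_nth length_map nth_map prod.collapse)
      then have "N (p - q) \<le> r n" if "p \<in> set (L ! i)" "q \<in> set (L ! i)" for p q
        unfolding r_def using that assms m by (intro cells_diameter[OF _ D]) auto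
      then show ?thesis using True unfolding C_def by (simp add: ediam_hull_le)
    qed (simp add: C_def ediam_def bot_ennreal)
    have "convex hull (set fs) = (\<Union>ws\<in>set L. convex hull (set ws))"
      unfolding L_def by (rule dissect_hull[OF cells_dissect])
    also have "\<dots> = (\<Union>i. C i)"
      by (fastforce simp: C_def in_set_conv_nth split: if_splits)
    finally have cover: "convex hull (set fs) = (\<Union>i. C i)" .
    have "hausdorff_pre N k \<delta> (convex hull (set fs)) \<le> (\<Sum>i. (if C i = {} then 0 else ediam N (C i) ^ k))"
      unfolding hausdorff_pre_def
      using cover order_trans[OF ed ennreal_leI[OF n]] by (intro INF_lower) auto
    also have "\<dots> = (\<Sum>i<length L. (if C i = {} then 0 else ediam N (C i) ^ k))"
      by (intro suminf_finite) (auto simp: C_def)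
    also have "\<dots> \<le> (\<Sum>i<length L. ennreal (r n) ^ k)"
      by (intro sum_mono) (auto intro!: power_mono ed)
    also have "\<dots> = ennreal (real (length L) * r n ^ k)"
      using r0[of n] by (simp add: ennreal_power ennreal_mult ennreal_of_nat_eq_real_of_nat)
    also have "length L = 2 ^ (m * n)"
      unfolding L_def using assms m by (simp add: cells_length)
    also have "real (2 ^ (m * n)) * r n ^ k = (real m * D) ^ k / 2 ^ n"
      by (simp add: r_def m power_divide power_mult_distrib power_mult[symmetric] mult.commute power_add field_simps)
    finally show ?thesis .
  qed
  have "hausdorff_pre N k \<delta> (convex hull (set fs)) \<le> 0" if "0 < \<delta>" for \<delta>
  proof -
    have "(\<lambda>n. real m * D * (1/2) ^ n) \<longlonglongrightarrow> real m * D * 0"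
      by (intro tendsto_mult_left LIMSEQ_realpow_zero) auto
    then have "r \<longlonglongrightarrow> 0" by (simp add: r_def[abs_def] power_one_over field_simps)
    then have "eventually (\<lambda>n. r n < \<delta>) sequentially" using \<open>0 < \<delta>\<close> by (rule order_tendstoD)
    then have ev: "eventually (\<lambda>n. hausdorff_pre N k \<delta> (convex hull (set fs))
        \<le> ennreal ((real m * D) ^ k / 2 ^ n)) sequentially"
      by eventually_elim (auto intro: le)
    have "(\<lambda>n. (real m * D) ^ k * (1/2) ^ n) \<longlonglongrightarrow> (real m * D) ^ k * 0"
      by (intro tendsto_mult_left LIMSEQ_realpow_zero) auto
    then have "(\<lambda>n. (real m * D) ^ k / 2 ^ n) \<longlonglongrightarrow> 0" by (simp add: power_one_over field_simps)
    then have "(\<lambda>n. ennreal ((real m * D) ^ k / 2 ^ n)) \<longlonglongrightarrow> ennreal 0" by (rule tendsto_ennrealI)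
    from tendsto_lowerbound[OF this ev] show ?thesis by simp
  qed
  then have "Vol N k (convex hull (set fs)) \<le> 0"
    unfolding Vol_def by (intro SUP_least) auto
  then show ?thesis by simp
qed

text \<open>Additive constants cancel in differences, so the barycentric functionals of the vertices
  1 to k are dual to the edge vectors. Equivalence of norms bounds them by \<open>N\<close>.\<close>

lemma edge_dual_functionals:
  assumes vs: "simplex_vertices k vs"
  obtains a B where
    "\<And>i j. i < k \<Longrightarrow> j < k \<Longrightarrow> inner (a i) (vs ! Suc j - vs ! 0) = (if i = j then 1 else 0)"
    "0 < B" "\<And>i x. i < k \<Longrightarrow> \<bar>inner (a i) x\<bar> \<le> B * N x"
proof -
  have len: "length vs = Suc k" and di: "distinct vs" and ind: "\<not> affine_dependent (set vs)"
    using vs by (auto simp: simplex_vertices_def)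
  define e where "e = (\<lambda>j. vs ! Suc j - vs ! 0)"
  have "\<exists>a. \<forall>j<k. inner a (e j) = (if i = j then 1 else 0)" if "i < k" for i
  proof -
    have "vs ! Suc i \<in> set vs" using that len by simp
    then obtain a b where ab: "inner a (vs ! Suc i) + b = 1"
      "\<forall>q\<in>set vs - {vs ! Suc i}. inner a q + b = 0"
      using barycentric_functional[OF ind] by blast
    have "inner a (vs ! j) + b = (if j = Suc i then 1 else 0)" if "j \<le> k" for j
      using ab that \<open>i < k\<close> len di by (auto simp: nth_eq_iff_index_eq)
    note v = this
    have "inner a (e j) = (if i = j then 1 else 0)" if "j < k" for j
      using v[of 0] v[of "Suc j"] that
      by (cases "i = j") (simp_all add: e_def inner_diff_right)
    then show ?thesis by blast
  qed
  then obtain a where a: "\<And>i j. i < k \<Longrightarrow> j < k \<Longrightarrow> inner (a i) (e j) = (if i = j then 1 else 0)"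
    by metis
  obtain C where C: "0 < C" "\<And>x. norm x \<le> C * N x" using norm_le_N by blast
  \<comment> \<open>The summand 1 makes \<open>B\<close> positive even if the sum is empty.\<close>
  define B where "B = (1 + (\<Sum>i<k. norm (a i))) * C"
  have Bpos: "0 < B" unfolding B_def using C by (intro mult_pos_pos add_pos_nonneg sum_nonneg) auto
  then have B0: "0 \<le> B" by simp
  have B: "\<bar>inner (a i) x\<bar> \<le> B * N x" if "i < k" for i x
  proof -
    have "\<bar>inner (a i) x\<bar> \<le> norm (a i) * norm x" by (rule Cauchy_Schwarz_ineq2)
    also have "norm (a i) \<le> (\<Sum>i<k. norm (a i))"
      using that by (intro member_le_sum) auto
    then have "norm (a i) * norm x \<le> (1 + (\<Sum>i<k. norm (a i))) * (C * N x)"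
      using C by (intro mult_mono) (auto intro!: add_nonneg_nonneg sum_nonneg)
    finally show ?thesis by (simp add: B_def mult.assoc)
  qed
  show thesis using that[of a B] a Bpos B unfolding e_def by blast
qed

text \<open>Coordinates on the plane of the simplex are placed in \<open>k\<close> of the coordinates of the
  ambient space, so that a cover of the simplex gives a cover of a cube by boxes.\<close>

lemma Vol_simplex_neq_0:
  assumes vs: "simplex_vertices k vs" and k: "0 < k"
  shows "Vol N k (convex hull (set vs)) \<noteq> 0"
proof -
  have len: "length vs = Suc k" using vs by (simp add: simplex_vertices_def)
  define e where "e = (\<lambda>j. vs ! Suc j - vs ! 0)"
  obtain a B where a: "\<And>i j. i < k \<Longrightarrow> j < k \<Longrightarrow> inner (a i) (e j) = (if i = j then 1 else 0)"
    and Bpos: "0 < B" and B: "\<And>i x. i < k \<Longrightarrow> \<bar>inner (a i) x\<bar> \<le> B * N x"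
    using edge_dual_functionals[OF vs] unfolding e_def by blast
  have B0: "0 \<le> B" using Bpos by simp
  have "int k \<le> int DIM('a)"
    using vs aff_dim_le_DIM[of "set vs"] by (simp add: simplex_vertices_iff_aff_dim)
  then have kD: "k \<le> DIM('a)" by simp
  then have "card {..<k} \<le> card (Basis :: 'a set)" by simp
  then obtain \<beta> :: "nat \<Rightarrow> 'a" where \<beta>: "inj_on \<beta> {..<k}" "\<beta> ` {..<k} \<subseteq> Basis"
    using card_le_inj[of "{..<k}" "Basis :: 'a set"] by auto
  \<comment> \<open>The volume contributed by the coordinates that carry no edge coefficient, each
    running over an interval of length 1/k.\<close>
  define c where "c = (1 / real k) ^ (DIM('a) - k)"
  have c: "0 < c" using k by (simp add: c_def)
  \<comment> \<open>Side 1/k keeps the sum of k coordinates at most 1, so the edge coefficients read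
    off from a point of \<open>Q\<close> stay in the simplex.\<close>
  define Q :: "'a set" where "Q = cbox 0 ((1 / real k) *\<^sub>R One)"
  have Qm: "emeasure lborel Q = ennreal ((1 / real k) ^ DIM('a))"
    unfolding Q_def using k by (subst emeasure_lborel_cbox) (auto simp: prod_ennreal)
  \<comment> \<open>If \<open>X\<close> has diameter d, every edge coefficient of its points lies
    within \<open>B * d\<close> of that of a fixed \<open>p\<close> in \<open>X\<close>. The points
    of \<open>Q\<close> sent into \<open>X\<close> thus lie in a box of volume (2 B d)^k c, which is
    proportional to the Hausdorff summand d^k.\<close>
  have box: "\<exists>Y. Y \<in> sets lborel \<and>
      emeasure lborel Y \<le> (if X = {} then 0 else ediam N X ^ k) * ennreal ((2 * B) ^ k * c) \<and>
      (\<forall>x\<in>Q. vs ! 0 + (\<Sum>j<k. inner x (\<beta> j) *\<^sub>R e j) \<in> X \<longrightarrow> x \<in> Y)"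
    if X: "ediam N X \<le> ennreal 1" for X
  proof (cases "X = {}")
    case False
    then obtain p where p: "p \<in> X" by blast
    define d where "d = enn2real (ediam N X)"
    have d: "ediam N X = ennreal d" "0 \<le> d"
      using X by (auto simp: d_def top.extremum_unique intro!: ennreal_enn2real[symmetric] le_less_trans[OF X])
    have pd: "N (y - p) \<le> d" if "y \<in> X" for y
    proof -
      have "ennreal (N (y - p)) \<le> ediam N X"
        unfolding ediam_def using that p by (meson SUP_upper2 order_refl)
      then show ?thesis using d by simp
    qed
    define g where "g = the_inv_into {..<k} \<beta>"
    have g: "g (\<beta> j) = j" if "j < k" for j
      unfolding g_def using \<beta>(1) that by (simp add: the_inv_into_f_f)
    define l where "l = (\<Sum>b\<in>Basis. (if b \<in> \<beta> ` {..<k} then inner (a (g b)) (p - vs ! 0) - B * d else 0) *\<^sub>R b)"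
    define u where "u = (\<Sum>b\<in>Basis. (if b \<in> \<beta> ` {..<k} then inner (a (g b)) (p - vs ! 0) + B * d else 1 / real k) *\<^sub>R b)"
    have lu: "inner l b = (if b \<in> \<beta> ` {..<k} then inner (a (g b)) (p - vs ! 0) - B * d else 0)"
      "inner u b = (if b \<in> \<beta> ` {..<k} then inner (a (g b)) (p - vs ! 0) + B * d else 1 / real k)"
      if "b \<in> Basis" for b
      using that by (simp_all add: l_def u_def inner_sum_left_Basis)
    have "emeasure lborel (cbox l u) = ennreal (\<Prod>b\<in>Basis. inner (u - l) b)"
      using B0 d(2) by (subst emeasure_lborel_cbox) (auto simp: lu)
    also have "(\<Prod>b\<in>Basis. inner (u - l) b) = (\<Prod>b\<in>Basis. if b \<in> \<beta> ` {..<k} then 2 * B * d else 1 / real k)"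
      by (intro prod.cong) (auto simp: inner_diff_left lu)
    also have "\<dots> = (2 * B * d) ^ k * c"
    proof -
      have "Basis \<inter> \<beta> ` {..<k} = \<beta> ` {..<k}" using \<beta> by blast
      moreover have "card (\<beta> ` {..<k}) = k" using \<beta> by (simp add: card_image)
      moreover have "card (Basis - \<beta> ` {..<k}) = DIM('a) - k"
        using \<beta> calculation by (subst card_Diff_subset) auto
      moreover have "Basis \<inter> - \<beta> ` {..<k} = Basis - \<beta> ` {..<k}" by blast
      ultimately show ?thesis by (simp add: prod.If_cases c_def Collect_mem_eq)
    qed
    also have "\<dots> = d ^ k * ((2 * B) ^ k * c)" by (simp add: power_mult_distrib)
    also have "ennreal \<dots> = ediam N X ^ k * ennreal ((2 * B) ^ k * c)"
      using d B0 c by (simp add: ennreal_mult ennreal_power)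
    finally have "emeasure lborel (cbox l u) = ediam N X ^ k * ennreal ((2 * B) ^ k * c)" .
    moreover have "x \<in> cbox l u" if x: "x \<in> Q" "vs ! 0 + (\<Sum>j<k. inner x (\<beta> j) *\<^sub>R e j) \<in> X" for x
    proof -
      let ?y = "vs ! 0 + (\<Sum>j<k. inner x (\<beta> j) *\<^sub>R e j)"
      have "inner l b \<le> inner x b \<and> inner x b \<le> inner u b" if b: "b \<in> Basis" for b
      proof (cases "b \<in> \<beta> ` {..<k}")
        case True
        then obtain i where i: "i < k" "b = \<beta> i" by auto
        have "inner (a i) (?y - vs ! 0) = (\<Sum>j<k. inner x (\<beta> j) * inner (a i) (e j))"
          by (simp add: inner_sum_right)
        also have "\<dots> = (\<Sum>j<k. if i = j then inner x (\<beta> j) else 0)"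
          using i by (intro sum.cong) (auto simp: a)
        finally have "inner (a i) (?y - vs ! 0) = inner x b" using i by simp
        moreover have "inner (a i) (?y - p) = inner (a i) (?y - vs ! 0) - inner (a i) (p - vs ! 0)"
          by (simp add: inner_diff_right inner_add_right)
        moreover have "\<bar>inner (a i) (?y - p)\<bar> \<le> B * d"
          using B[OF i(1), of "?y - p"] mult_left_mono[OF pd[OF x(2)] B0] by linarith
        ultimately show ?thesis
          using i b by (auto simp: lu g abs_le_iff)
      next
        case False
        then show ?thesis using x(1) b by (auto simp: lu Q_def mem_box)
      qed
      then show ?thesis by (simp add: mem_box)
    qed
    ultimately show ?thesis using False by (intro exI[of _ "cbox l u"]) auto
  qed (auto intro!: exI[of _ "{}"])
  have hull: "vs ! 0 + (\<Sum>j<k. inner x (\<beta> j) *\<^sub>R e j) \<in> convex hull (set vs)" if x: "x \<in> Q" for x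
  proof -
    define t where "t = (\<lambda>j. inner x (\<beta> j))"
    have t: "0 \<le> t j" "t j \<le> 1 / real k" if "j < k" for j
      using x \<beta> that by (auto simp: t_def Q_def mem_box)
    have "(\<Sum>j<k. t j) \<le> (\<Sum>j<k. 1 / real k)" by (intro sum_mono) (auto intro: t)
    then have s: "(\<Sum>j<k. t j) \<le> 1" using k by simp
    define w where "w = (\<lambda>i. case i of 0 \<Rightarrow> 1 - (\<Sum>j<k. t j) | Suc j \<Rightarrow> t j)"
    have "(\<Sum>i<length vs. w i) = 1"
      unfolding len sum.lessThan_Suc_shift by (simp add: w_def)
    moreover have "\<forall>i<length vs. 0 \<le> w i"
      using s t by (auto simp: w_def len split: nat.splits)
    moreover have "(\<Sum>i<length vs. w i *\<^sub>R vs ! i) = vs ! 0 + (\<Sum>j<k. t j *\<^sub>R e j)"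
    proof -
      have "(\<Sum>i<length vs. w i *\<^sub>R vs ! i) = (1 - (\<Sum>j<k. t j)) *\<^sub>R vs ! 0 + (\<Sum>j<k. t j *\<^sub>R vs ! Suc j)"
        unfolding len sum.lessThan_Suc_shift by (simp add: w_def)
      then show ?thesis
        by (simp add: e_def scaleR_diff_right scaleR_diff_left sum_subtractf scaleR_sum_left)
    qed
    ultimately show ?thesis
      unfolding convex_hull_list mem_Collect_eq by (intro exI[of _ w]) (simp add: t_def)
  qed
  define \<kappa> where "\<kappa> = (2 * B) ^ k * c"
  have \<kappa>: "0 < \<kappa>" using Bpos c by (simp add: \<kappa>_def)
  \<comment> \<open>A single scale suffices, because \<open>Vol\<close> is the supremum over all
    scales; scale 1 makes the diameters of the covering sets finite.\<close>
  have "ennreal ((1 / real k) ^ DIM('a) / \<kappa>) \<le> hausdorff_pre N k 1 (convex hull (set vs))"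
    unfolding hausdorff_pre_def
  proof (rule INF_greatest)
    fix X :: "nat \<Rightarrow> 'a set"
    assume "X \<in> {C. convex hull (set vs) \<subseteq> (\<Union>i. C i) \<and> (\<forall>i. ediam N (C i) \<le> ennreal 1)}"
    then have X: "convex hull (set vs) \<subseteq> (\<Union>i. X i)" "\<And>i. ediam N (X i) \<le> ennreal 1" by auto
    define I where "I = (\<Sum>i. (if X i = {} then 0 else ediam N (X i) ^ k))"
    have "\<forall>i. \<exists>Y. Y \<in> sets lborel \<and>
      emeasure lborel Y \<le> (if X i = {} then 0 else ediam N (X i) ^ k) * ennreal \<kappa> \<and>
      (\<forall>x\<in>Q. vs ! 0 + (\<Sum>j<k. inner x (\<beta> j) *\<^sub>R e j) \<in> X i \<longrightarrow> x \<in> Y)"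
      unfolding \<kappa>_def by (intro allI box X(2))
    from choice[OF this] obtain Y where Y: "\<And>i. Y i \<in> sets lborel"
      "\<And>i. emeasure lborel (Y i) \<le> (if X i = {} then 0 else ediam N (X i) ^ k) * ennreal \<kappa>"
      "\<And>i x. x \<in> Q \<Longrightarrow> vs ! 0 + (\<Sum>j<k. inner x (\<beta> j) *\<^sub>R e j) \<in> X i \<Longrightarrow> x \<in> Y i"
      by blast
    have "Q \<subseteq> (\<Union>i. Y i)" using hull X(1) Y(3) by blast
    then have "emeasure lborel Q \<le> emeasure lborel (\<Union>i. Y i)"
      using Y(1) by (intro emeasure_mono) auto
    also have "\<dots> \<le> (\<Sum>i. emeasure lborel (Y i))"
      using Y(1) by (intro emeasure_subadditive_countably) auto
    also have "\<dots> \<le> (\<Sum>i. (if X i = {} then 0 else ediam N (X i) ^ k) * ennreal \<kappa>)"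
      by (intro suminf_le Y(2)) auto
    also have "\<dots> = I * ennreal \<kappa>" unfolding I_def by (rule ennreal_suminf_multc)
    finally have main: "ennreal ((1 / real k) ^ DIM('a)) \<le> I * ennreal \<kappa>" unfolding Qm .
    have "ennreal ((1 / real k) ^ DIM('a) / \<kappa>) \<le> I"
    proof (cases I rule: ennreal_cases)
      case (real s)
      then have "(1 / real k) ^ DIM('a) \<le> s * \<kappa>"
        using main \<kappa> by (simp flip: ennreal_mult)
      then have "(1 / real k) ^ DIM('a) / \<kappa> \<le> s" unfolding pos_divide_le_eq[OF \<kappa>] .
      then show ?thesis unfolding real by (rule ennreal_leI)
    qed simp
    then show "ennreal ((1 / real k) ^ DIM('a) / \<kappa>)
        \<le> (\<Sum>i. (if X i = {} then 0 else ediam N (X i) ^ k))" by (simp only: I_def)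
  qed
  moreover have "0 < (1 / real k) ^ DIM('a) / \<kappa>" using k \<kappa> by simp
  ultimately have "0 < hausdorff_pre N k 1 (convex hull (set vs))"
    by (metis ennreal_less_zero_iff less_le_trans)
  moreover have "hausdorff_pre N k 1 (convex hull (set vs)) \<le> Vol N k (convex hull (set vs))"
    unfolding Vol_def by (intro SUP_upper) auto
  ultimately show ?thesis by auto
qed

end

section \<open>Common refinements\<close>

lemma distinct_iff_sorted_wrt_neq: "distinct xs \<longleftrightarrow> sorted_wrt (\<noteq>) xs"
  by (induction xs) auto

section \<open>Convex sets and finitely many hyperplanes\<close>

lemma finite_affine_zeros:
  fixes \<alpha> \<beta> :: real
  assumes "\<alpha> \<noteq> 0 \<or> \<beta> \<noteq> 0"
  shows "finite {s. (1 - s) * \<alpha> + s * \<beta> = 0}"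
proof -
  have "{s. (1 - s) * \<alpha> + s * \<beta> = 0} \<subseteq> {\<alpha> / (\<alpha> - \<beta>)}"
  proof
    fix s assume "s \<in> {s. (1 - s) * \<alpha> + s * \<beta> = 0}"
    then have s: "s * (\<alpha> - \<beta>) = \<alpha>" by (simp add: algebra_simps)
    then have "\<alpha> - \<beta> \<noteq> 0" using assms by auto
    then show "s \<in> {\<alpha> / (\<alpha> - \<beta>)}" using s by (simp add: eq_divide_eq)
  qed
  then show ?thesis by (rule finite_subset) simp
qed

lemma inner_affine_segment:
  "inner a ((1 - s) *\<^sub>R x + s *\<^sub>R y) + b = (1 - s) * (inner a x + b) + s * (inner a y + b)"
  by (simp add: inner_add_right algebra_simps)

text \<open>A functional that does not vanish at both ends has at most one zero on the line, so only
  finitely many parameters are excluded. Small \<open>r\<close> gives such points arbitrarily close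
  to \<open>x\<close>.\<close>

lemma segment_avoids_hyperplanes:
  fixes G :: "('a::real_inner \<times> real) set"
  assumes "finite G" "\<And>a b. (a, b) \<in> G \<Longrightarrow> inner a x + b \<noteq> 0 \<or> inner a y + b \<noteq> 0" "0 < r"
  shows "\<exists>s. 0 < s \<and> s < r \<and> (\<forall>(a, b)\<in>G. inner a ((1 - s) *\<^sub>R x + s *\<^sub>R y) + b \<noteq> 0)"
proof -
  define Z where "Z = (\<Union>(a, b)\<in>G. {s. (1 - s) * (inner a x + b) + s * (inner a y + b) = 0})"
  have "finite Z"
    unfolding Z_def using assms(2)
    by (intro finite_UN_I[OF assms(1)]) (auto intro: finite_affine_zeros)
  moreover have "infinite {0<..<r}" using assms(3) by (rule infinite_Ioo)
  ultimately have "\<not> {0<..<r} \<subseteq> Z" using finite_subset by blast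
  then obtain s where "s \<in> {0<..<r}" and "s \<notin> Z" by blast
  then have s: "0 < s" "s < r" "s \<notin> Z" by auto
  then have "inner a ((1 - s) *\<^sub>R x + s *\<^sub>R y) + b \<noteq> 0" if "(a, b) \<in> G" for a b
    using that unfolding inner_affine_segment by (auto simp: Z_def)
  then show ?thesis using s(1,2) by (intro exI[of _ s]) auto
qed

text \<open>Induction on the hyperplanes: let \<open>y\<close> avoid the old ones and
  \<open>p\<close> the new one. No functional vanishes at both \<open>y\<close> and
  \<open>p\<close>, so some point between them avoids all.\<close>

lemma convex_avoids_hyperplanes:
  fixes S :: "'a::real_inner set"
  assumes "convex S" "S \<noteq> {}"
  shows "finite G \<Longrightarrow> (\<forall>(a, b)\<in>G. \<exists>p\<in>S. inner a p + b \<noteq> 0) \<Longrightarrow>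
    \<exists>y\<in>S. \<forall>(a, b)\<in>G. inner a y + b \<noteq> 0"
proof (induction G rule: finite_induct)
  case (insert g G)
  then obtain y where y: "y \<in> S" "\<forall>(a, b)\<in>G. inner a y + b \<noteq> 0" by auto
  obtain c d where g: "g = (c, d)" by (cases g)
  then obtain p where p: "p \<in> S" "inner c p + d \<noteq> 0" using insert by auto
  obtain s where s: "0 < s" "s < 1" "\<forall>(a, b)\<in>insert g G. inner a ((1 - s) *\<^sub>R y + s *\<^sub>R p) + b \<noteq> 0"
    using segment_avoids_hyperplanes[of "insert g G" y p 1] y(2) p(2) insert.hyps g by auto
  have "(1 - s) *\<^sub>R y + s *\<^sub>R p \<in> S"
    using s y p by (intro convexD[OF assms(1)]) auto
  then show ?case using s(3) by blast
qed (use assms in auto)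

text \<open>The points of \<open>S\<close> off the hyperplanes are dense in \<open>S\<close>: any
  \<open>x\<close> is approached along the segment to one such point \<open>y\<close>. A closed set
  containing them contains \<open>S\<close>.\<close>

lemma convex_subset_closed_if_covered:
  fixes S :: "'a::real_inner set"
  assumes "convex S" "closed F" "finite G"
    and nz: "\<And>a b. (a, b) \<in> G \<Longrightarrow> \<exists>p\<in>S. inner a p + b \<noteq> 0"
    and cover: "\<And>x. x \<in> S \<Longrightarrow> x \<in> F \<or> (\<exists>(a, b)\<in>G. inner a x + b = 0)"
  shows "S \<subseteq> F"
proof
  fix x assume x: "x \<in> S"
  then obtain y where y: "y \<in> S" "\<forall>(a, b)\<in>G. inner a y + b \<noteq> 0"
    using convex_avoids_hyperplanes[OF assms(1) _ assms(3)] nz by fastforce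
  show "x \<in> F"
  proof (rule ccontr)
    assume "x \<notin> F"
    define f where "f = (\<lambda>s. (1 - s) *\<^sub>R x + s *\<^sub>R y)"
    have "open (- F)" using assms(2) by auto
    moreover have "continuous_on UNIV f" unfolding f_def by (intro continuous_intros)
    ultimately have "open (f -` (- F))" by (rule open_vimage)
    moreover have "0 \<in> f -` (- F)" using \<open>x \<notin> F\<close> by (simp add: f_def)
    ultimately obtain r where r: "0 < r" "\<And>s. \<bar>s\<bar> < r \<Longrightarrow> f s \<notin> F"
      unfolding open_dist by (force simp: dist_real_def)
    obtain s where s: "0 < s" "s < min r 1" "\<forall>(a, b)\<in>G. inner a (f s) + b \<noteq> 0"
      unfolding f_def using segment_avoids_hyperplanes[of G x y "min r 1"] y(2) r(1) assms(3) by fastforce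
    have "f s \<in> S" unfolding f_def using s x y by (intro convexD[OF assms(1)]) auto
    then show False using cover[of "f s"] s r(2)[of s] by auto
  qed
qed

text \<open>Cutting \<open>vs\<close> by the k + 1 barycentric functionals of \<open>ws\<close>
  gives each of them a constant sign on every piece. If all signs are nonnegative the piece lies in
  \<open>ws\<close>; otherwise some functional is nonpositive on the piece and nonnegative on
  \<open>ws\<close>, so both meet only in its zero set.\<close>

lemma dissect_along_simplex:
  fixes vs ws :: "'a::euclidean_space list"
  assumes vs: "simplex_vertices k vs" and ws: "simplex_vertices k ws"
    and aff: "affine hull (set vs) = affine hull (set ws)"
  obtains L G where "dissect vs L" "length L \<le> 2 ^ (Suc k * Suc k)" "finite G"
    "\<And>a b. (a, b) \<in> G \<Longrightarrow> \<exists>p\<in>convex hull (set vs). inner a p + b \<noteq> 0"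
    "\<And>a b. (a, b) \<in> G \<Longrightarrow> \<exists>p\<in>convex hull (set ws). inner a p + b \<noteq> 0"
    "\<And>us x. us \<in> set L \<Longrightarrow> \<not> convex hull (set us) \<subseteq> convex hull (set ws) \<Longrightarrow>
      x \<in> convex hull (set us) \<Longrightarrow> x \<in> convex hull (set ws) \<Longrightarrow> \<exists>(a, b)\<in>G. inner a x + b = 0"
proof -
  have ind: "\<not> affine_dependent (set ws)" and len: "length vs = Suc k" "length ws = Suc k"
    using assms by (auto simp: simplex_vertices_def)
  obtain A B where AB: "\<And>p. p \<in> set ws \<Longrightarrow> inner (A p) p + B p = 1"
    "\<And>p q. p \<in> set ws \<Longrightarrow> q \<in> set ws \<Longrightarrow> q \<noteq> p \<Longrightarrow> inner (A p) q + B p = 0"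
    using barycentric_functional[OF ind] by (metis DiffI singletonD)
  define gs where "gs = map (\<lambda>p. (A p, B p)) ws"
  obtain L where L: "dissect vs L" "length L \<le> 2 ^ (length vs * length gs)"
    "\<forall>us\<in>set L. \<forall>(a, b)\<in>set gs.
      (\<forall>p\<in>set us. 0 \<le> inner a p + b) \<or> (\<forall>p\<in>set us. inner a p + b \<le> 0)"
    using dissect_by_functionals by blast
  have mem: "x \<in> convex hull (set ws)"
    if x: "x \<in> affine hull (set ws)" "\<And>p. p \<in> set ws \<Longrightarrow> 0 \<le> inner (A p) x + B p" for x
  proof -
    obtain u where u: "sum u (set ws) = 1" "(\<Sum>v\<in>set ws. u v *\<^sub>R v) = x"
      using x(1) by (auto simp: affine_hull_finite)
    have "u p = inner (A p) x + B p" if "p \<in> set ws" for p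
    proof -
      have "inner (A p) x + B p = (\<Sum>q\<in>set ws. u q * (inner (A p) q + B p))"
        using inner_affine_sum[OF u(1), of "A p" "\<lambda>q. q" "B p"] u(2) by simp
      also have "\<dots> = (\<Sum>q\<in>set ws. if p = q then u q else 0)"
        using AB that by (intro sum.cong) auto
      finally show ?thesis using that by simp
    qed
    then have "\<forall>p\<in>set ws. 0 \<le> u p" using x(2) by simp
    then show ?thesis using u by (auto simp: convex_hull_finite intro!: exI[of _ u])
  qed
  \<comment> \<open>Excludes hyperplanes containing all of \<open>vs\<close>. A piece that sticks
    out of \<open>ws\<close> has a vertex where its functional is negative, so the hyperplane used
    for that piece belongs to \<open>G\<close>.\<close>
  define G where "G = {(a, b) \<in> set gs. \<exists>p\<in>convex hull (set vs). inner a p + b \<noteq> 0}"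
  show thesis
  proof (rule that)
    show "dissect vs L" by (rule L)
    show "length L \<le> 2 ^ (Suc k * Suc k)" using L(2) by (simp add: gs_def len)
    show "finite G" unfolding G_def by (rule finite_subset[of _ "set gs"]) auto
    show "\<exists>p\<in>convex hull (set vs). inner a p + b \<noteq> 0" if "(a, b) \<in> G" for a b
      using that by (auto simp: G_def)
    show "\<exists>p\<in>convex hull (set ws). inner a p + b \<noteq> 0" if "(a, b) \<in> G" for a b
    proof -
      from that obtain p where p: "p \<in> set ws" "a = A p" "b = B p" by (auto simp: G_def gs_def)
      have "inner a p + b \<noteq> 0" unfolding p(2,3) AB(1)[OF p(1)] by simp
      then show ?thesis using p(1) hull_inc by fast
    qed
    show "\<exists>(a, b)\<in>G. inner a x + b = 0"
      if us: "us \<in> set L" "\<not> convex hull (set us) \<subseteq> convex hull (set ws)"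
        "x \<in> convex hull (set us)" "x \<in> convex hull (set ws)" for us x
    proof -
      have sub: "set us \<subseteq> convex hull (set vs)" by (rule dissect_subset[OF L(1) us(1)])
      have "\<not> set us \<subseteq> convex hull (set ws)"
        using us(2) by (metis convex_convex_hull hull_minimal)
      then obtain q where q: "q \<in> set us" "q \<notin> convex hull (set ws)" by blast
      have "q \<in> affine hull (set ws)"
        using dissect_affine_hull[OF L(1) us(1)] q(1) aff hull_inc by fast
      then obtain p where p: "p \<in> set ws" "inner (A p) q + B p < 0"
        using mem[of q] q(2) by force
      have gs: "(A p, B p) \<in> set gs" using p by (simp add: gs_def)
      then have "\<forall>r\<in>set us. inner (A p) r + B p \<le> 0"
        using bspec[OF bspec[OF L(3) us(1)] gs] p(2) q(1) by force
      then have "inner (A p) x + B p \<le> 0" using inner_le_on_hull us(3) by blast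
      moreover have "0 \<le> inner (A p) x + B p"
        using inner_ge_on_hull[of "set ws" "A p" "B p" x] AB p(1) us(4)
        by (metis order_refl zero_le_one)
      moreover have "(A p, B p) \<in> G"
        unfolding G_def using gs p(2) q(1) sub by force
      ultimately show ?thesis by (intro bexI[of _ "(A p, B p)"]) auto
    qed
  qed
qed

section \<open>Dissections as subdivisions\<close>

context arbitrary_norm
begin

text \<open>Pieces from different sides of a cut meet inside the hull of the \<open>k\<close> points
  given by \<open>edge_cut_inter\<close>, which is null by \<open>Vol_hull_eq_0\<close>.\<close>

lemma dissect_pairwise_null:
  assumes "0 < k"
  shows "dissect vs L \<Longrightarrow> simplex_vertices k vs \<Longrightarrow>
    sorted_wrt (\<lambda>us ws. Vol N k (convex hull (set us) \<inter> convex hull (set ws)) = 0) L"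
proof (induction rule: dissect.induct)
  case (cut i vs j t z L M)
  obtain fs where fs: "length fs = k"
    "convex hull (set (vs[i := z])) \<inter> convex hull (set (vs[j := z])) \<subseteq> convex hull (set fs)"
    using edge_cut_inter[OF cut.prems cut.hyps(1-6)] by blast
  have "Vol N k (convex hull (set us) \<inter> convex hull (set ws)) = 0"
    if "us \<in> set L" "ws \<in> set M" for us ws
  proof -
    have "convex hull (set us) \<inter> convex hull (set ws) \<subseteq> convex hull (set fs)"
      using fs(2) dissect_hull[OF cut.hyps(7)] dissect_hull[OF cut.hyps(8)] that by blast
    then show ?thesis
      using Vol_mono[of _ "convex hull (set fs)" k] Vol_hull_eq_0[OF fs(1) assms] by (metis le_zero_eq)
  qed
  moreover have "dissect vs [vs[i := z], vs[j := z]]"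
    using dissect.cut[OF cut.hyps(1-6) dissect.trivial dissect.trivial] by simp
  then have "simplex_vertices k (vs[i := z])" "simplex_vertices k (vs[j := z])"
    using dissect_simplex_vertices[OF _ _ cut.prems] by auto
  ultimately show ?case using cut.IH by (auto simp: sorted_wrt_append)
qed simp

lemma carrier_Vol_neq_0:
  assumes "\<sigma> \<in> simplices k K" "0 < k"
  shows "Vol N k (carrier_of \<sigma>) \<noteq> 0"
  using assms Vol_simplex_neq_0 by (auto elim!: simplicesE)

text \<open>Two equal pieces would make a k-simplex its own null intersection. Hence counts and sums
  over the list of pieces agree with those over the set of oriented simplices.\<close>

lemma dissect_distinct:
  fixes vs :: "'a list"
  assumes "dissect vs L" "simplex_vertices k vs" "0 < k"
  shows "distinct (map osimplex L)"
proof -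
  have "sorted_wrt (\<lambda>us ws. osimplex us \<noteq> osimplex ws) L"
  proof (rule sorted_wrt_mono_rel[OF _ dissect_pairwise_null[OF assms(3,1,2)]])
    fix us ws assume *: "us \<in> set L" "ws \<in> set L"
      "Vol N k (convex hull (set us) \<inter> convex hull (set ws)) = 0"
    show "osimplex us \<noteq> osimplex ws"
    proof
      assume "osimplex us = osimplex ws"
      then have "convex hull (set us) = convex hull (set ws)" by (metis carrier_of_osimplex)
      then show False
        using * Vol_simplex_neq_0[OF dissect_simplex_vertices[OF assms(1) *(1) assms(2)] assms(3)] by simp
    qed
  qed
  then show ?thesis by (simp add: distinct_iff_sorted_wrt_neq sorted_wrt_map)
qed

lemma dissect_null:
  assumes "dissect vs L" "simplex_vertices k vs" "0 < k"
    and "us \<in> set L" "ws \<in> set L" "osimplex us \<noteq> osimplex ws"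
  shows "Vol N k (convex hull (set us) \<inter> convex hull (set ws)) = 0"
proof -
  obtain i j where ij: "i < length L" "j < length L" "us = L ! i" "ws = L ! j"
    using assms(4,5) by (auto simp: in_set_conv_nth)
  then have "i \<noteq> j" using assms(6) by auto
  then show ?thesis
    using dissect_pairwise_null[OF assms(3,1,2)] ij
    unfolding sorted_wrt_iff_nth_less by (metis Int_commute linorder_neqE_nat)
qed

lemma subdivision_dissect:
  assumes "dissect vs L" "simplex_vertices k vs" "0 < k"
  shows "subdivision N k (osimplex vs) (osimplex ` set L)"
  unfolding subdivision_def
proof (intro conjI ballI impI)
  have len: "length vs = Suc k" using assms(2) by (simp add: simplex_vertices_def)
  have sv: "simplex_vertices k us" if "us \<in> set L" for us
    by (rule dissect_simplex_vertices[OF assms(1) that assms(2)])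
  show "osimplex ` set L \<subseteq> simplices k UNIV" using sv by (auto simp: simplices_def)
  show "same_orientation k (osimplex vs) \<tau>" if \<tau>: "\<tau> \<in> osimplex ` set L" for \<tau>
  proof -
    obtain us where us: "us \<in> set L" "\<tau> = osimplex us" using \<tau> by blast
    show ?thesis
      using dissect_frame_det[OF assms(1) us(1) len] dissect_affine_hull[OF assms(1) us(1)]
        dissect_length[OF assms(1) us(1)] len unfolding us(2)
      by (subst same_orientation_iff) auto
  qed
  show "Vol N k (carrier_of \<tau> \<inter> carrier_of \<tau>') = 0"
    if "\<tau> \<in> osimplex ` set L" "\<tau>' \<in> osimplex ` set L" "\<tau> \<noteq> \<tau>'" for \<tau> \<tau>'
    using that by (auto intro!: dissect_null[OF assms])
  show "\<Union> (carrier_of ` osimplex ` set L) = carrier_of (osimplex vs)"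
    using dissect_hull[OF assms(1)] by auto
qed simp

lemma subdivisionD:
  assumes "subdivision N k \<sigma> P"
  shows "finite P" "P \<subseteq> simplices k UNIV" "\<And>\<tau>. \<tau> \<in> P \<Longrightarrow> same_orientation k \<sigma> \<tau>"
    "\<And>\<tau> \<tau>'. \<tau> \<in> P \<Longrightarrow> \<tau>' \<in> P \<Longrightarrow> \<tau> \<noteq> \<tau>' \<Longrightarrow> Vol N k (carrier_of \<tau> \<inter> carrier_of \<tau>') = 0"
    "(\<Union>\<tau>\<in>P. carrier_of \<tau>) = carrier_of \<sigma>"
  using assms unfolding subdivision_def by simp_all

lemma simplices_iff_carrier: "\<sigma> \<in> simplices k K \<longleftrightarrow> \<sigma> \<in> simplices k UNIV \<and> carrier_of \<sigma> \<subseteq> K"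
  unfolding simplices_def by auto

lemma subdivision_simplices:
  assumes "\<sigma> \<in> simplices k K" "subdivision N k \<sigma> P" "\<tau> \<in> P"
  shows "\<tau> \<in> simplices k K"
proof -
  have "carrier_of \<tau> \<subseteq> carrier_of \<sigma>" using subdivisionD(5)[OF assms(2)] assms(3) by blast
  moreover have "carrier_of \<sigma> \<subseteq> K" using assms(1) unfolding simplices_iff_carrier[of \<sigma> k K] by simp
  moreover have "\<tau> \<in> simplices k UNIV" using subdivisionD(2)[OF assms(2)] assms(3) by blast
  ultimately show ?thesis unfolding simplices_iff_carrier[of \<tau> k K] by blast
qed

lemma Vol_null_subset: "Vol N k B = 0 \<Longrightarrow> A \<subseteq> B \<Longrightarrow> Vol N k A = 0"
  using Vol_mono[of A B k] by simp

lemma no_simplex_in_null_set: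
  assumes "\<sigma> \<in> simplices k K" "0 < k" "carrier_of \<sigma> \<subseteq> A"
  shows "Vol N k A \<noteq> 0"
  using assms carrier_Vol_neq_0 Vol_null_subset by blast

text \<open>Disjointness lets sums over the union split into sums over the members of
  \<open>P\<close>: an oriented simplex common to two of the \<open>Q \<tau>\<close> would be a
  k-simplex inside a null set.\<close>

lemma subdivision_refine:
  assumes k: "0 < k" and \<sigma>: "\<sigma> \<in> simplices k UNIV" and P: "subdivision N k \<sigma> P"
    and Q: "\<And>\<tau>. \<tau> \<in> P \<Longrightarrow> subdivision N k \<tau> (Q \<tau>)"
  shows "subdivision N k \<sigma> (\<Union>\<tau>\<in>P. Q \<tau>)"
    and "\<And>\<tau> \<tau>'. \<tau> \<in> P \<Longrightarrow> \<tau>' \<in> P \<Longrightarrow> \<tau> \<noteq> \<tau>' \<Longrightarrow> Q \<tau> \<inter> Q \<tau>' = {}"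
proof -
  have sub: "carrier_of u \<subseteq> carrier_of \<tau>" if "\<tau> \<in> P" "u \<in> Q \<tau>" for \<tau> u
    using subdivisionD(5)[OF Q[OF that(1)]] that(2) by blast
  show "subdivision N k \<sigma> (\<Union>\<tau>\<in>P. Q \<tau>)"
    unfolding subdivision_def
  proof (intro conjI ballI impI)
    show "finite (\<Union>\<tau>\<in>P. Q \<tau>)" using subdivisionD(1)[OF P] subdivisionD(1)[OF Q] by blast
    show "(\<Union>\<tau>\<in>P. Q \<tau>) \<subseteq> simplices k UNIV" using subdivisionD(2)[OF Q] by blast
    show "same_orientation k \<sigma> u" if "u \<in> (\<Union>\<tau>\<in>P. Q \<tau>)" for u
      using that subdivisionD(2,3)[OF Q] subdivisionD(2,3)[OF P] same_orientation_trans[OF \<sigma>] by blast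
    show "Vol N k (carrier_of u \<inter> carrier_of u') = 0"
      if u: "u \<in> (\<Union>\<tau>\<in>P. Q \<tau>)" "u' \<in> (\<Union>\<tau>\<in>P. Q \<tau>)" "u \<noteq> u'" for u u'
    proof -
      obtain \<tau> \<tau>' where \<tau>: "\<tau> \<in> P" "u \<in> Q \<tau>" "\<tau>' \<in> P" "u' \<in> Q \<tau>'" using u by blast
      show ?thesis
      proof (cases "\<tau> = \<tau>'")
        case True
        then show ?thesis using subdivisionD(4)[OF Q] \<tau> u(3) by blast
      next
        case False
        then show ?thesis
          using subdivisionD(4)[OF P \<tau>(1,3)] sub[OF \<tau>(1,2)] sub[OF \<tau>(3,4)]
          by - (rule Vol_null_subset[of k "carrier_of \<tau> \<inter> carrier_of \<tau>'"], blast+)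
      qed
    qed
    show "\<Union> (carrier_of ` (\<Union>\<tau>\<in>P. Q \<tau>)) = carrier_of \<sigma>"
      using subdivisionD(5)[OF P] subdivisionD(5)[OF Q] by (simp add: UN_UN_flatten)
  qed
  show "Q \<tau> \<inter> Q \<tau>' = {}" if \<tau>: "\<tau> \<in> P" "\<tau>' \<in> P" "\<tau> \<noteq> \<tau>'" for \<tau> \<tau>'
  proof (rule ccontr)
    assume "Q \<tau> \<inter> Q \<tau>' \<noteq> {}"
    then obtain u where u: "u \<in> Q \<tau>" "u \<in> Q \<tau>'" by blast
    then have "u \<in> simplices k UNIV" using subdivisionD(2)[OF Q[OF \<tau>(1)]] by blast
    from no_simplex_in_null_set[OF this k, of "carrier_of \<tau> \<inter> carrier_of \<tau>'"] show False
      using u sub \<tau> subdivisionD(4)[OF P \<tau>] by blast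
  qed
qed

text \<open>Here \<open>c\<close> stands for the cells of another subdivision and \<open>T j\<close>
  for the pieces kept in \<open>carrier_of w \<inter> c j\<close>. The assumption
  \<open>thin\<close> allows points to be missed on finitely many hyperplanes not containing
  \<open>w\<close>; \<open>convex_subset_closed_if_covered\<close> fills them in. Both halves of
  \<open>common_refinement\<close> are instances, with \<open>\<sigma>\<close> as common reference
  for the orientation.\<close>

lemma subdivision_assemble:
  fixes \<sigma> w :: "'a osimplex" and c :: "'j \<Rightarrow> 'a set"
  assumes \<sigma>: "\<sigma> \<in> simplices k UNIV" and w: "w \<in> simplices k UNIV" "same_orientation k \<sigma> w"
    and J: "finite J" "carrier_of w \<subseteq> (\<Union>j\<in>J. c j)"
    and null: "\<And>i j. i \<in> J \<Longrightarrow> j \<in> J \<Longrightarrow> i \<noteq> j \<Longrightarrow> Vol N k (c i \<inter> c j) = 0"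
    and T: "\<And>j. j \<in> J \<Longrightarrow> finite (T j)"
      "\<And>j u. j \<in> J \<Longrightarrow> u \<in> T j \<Longrightarrow> u \<in> simplices k UNIV \<and> same_orientation k \<sigma> u \<and>
         carrier_of u \<subseteq> carrier_of w \<inter> c j"
      "\<And>j u u'. j \<in> J \<Longrightarrow> u \<in> T j \<Longrightarrow> u' \<in> T j \<Longrightarrow> u \<noteq> u' \<Longrightarrow>
         Vol N k (carrier_of u \<inter> carrier_of u') = 0"
    and thin: "\<And>j. j \<in> J \<Longrightarrow> \<exists>G. finite G \<and>
       (\<forall>(a, b)\<in>G. \<exists>p\<in>carrier_of w. inner a p + b \<noteq> 0) \<and>
       (\<forall>x\<in>carrier_of w \<inter> c j. x \<in> (\<Union>u\<in>T j. carrier_of u) \<or> (\<exists>(a, b)\<in>G. inner a x + b = 0))"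
  shows "subdivision N k w (\<Union>j\<in>J. T j)"
  unfolding subdivision_def
proof (intro conjI ballI impI)
  show "finite (\<Union>j\<in>J. T j)" using J T(1) by blast
  show "(\<Union>j\<in>J. T j) \<subseteq> simplices k UNIV" using T(2) by blast
  show "same_orientation k w u" if "u \<in> (\<Union>j\<in>J. T j)" for u
    using that T(2) same_orientation_sym[OF \<sigma> w] same_orientation_trans[OF w(1) \<sigma>] by blast
  show "Vol N k (carrier_of u \<inter> carrier_of u') = 0"
    if u: "u \<in> (\<Union>j\<in>J. T j)" "u' \<in> (\<Union>j\<in>J. T j)" "u \<noteq> u'" for u u'
  proof -
    obtain i j where ij: "i \<in> J" "u \<in> T i" "j \<in> J" "u' \<in> T j" using u by blast
    show ?thesis
    proof (cases "i = j")
      case True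
      then show ?thesis using T(3) ij u(3) by blast
    next
      case False
      then show ?thesis
        using null[OF ij(1,3)] T(2)[OF ij(1,2)] T(2)[OF ij(3,4)]
        by - (rule Vol_null_subset[of k "c i \<inter> c j"], blast+)
    qed
  qed
  define thin_set where "thin_set = (\<lambda>j G. finite G \<and>
       (\<forall>(a, b)\<in>G. \<exists>p\<in>carrier_of w. inner a p + b \<noteq> 0) \<and>
       (\<forall>x\<in>carrier_of w \<inter> c j. x \<in> (\<Union>u\<in>T j. carrier_of u) \<or> (\<exists>(a, b)\<in>G. inner a x + b = 0)))"
  have "\<forall>j\<in>J. \<exists>G. thin_set j G" using thin unfolding thin_set_def by (rule ballI)
  then obtain G where "\<forall>j\<in>J. thin_set j (G j)" by (rule bchoice[THEN exE])
  then have G: "finite (G j)" "\<forall>(a, b)\<in>G j. \<exists>p\<in>carrier_of w. inner a p + b \<noteq> 0"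
    "\<forall>x\<in>carrier_of w \<inter> c j. x \<in> (\<Union>u\<in>T j. carrier_of u) \<or> (\<exists>(a, b)\<in>G j. inner a x + b = 0)"
    if "j \<in> J" for j
    using that unfolding thin_set_def by simp_all
  have "convex (carrier_of w)" by (simp add: carrier_of_def)
  moreover have "closed (\<Union>u\<in>(\<Union>j\<in>J. T j). carrier_of u)"
  proof (intro closed_UN)
    show "finite (\<Union>j\<in>J. T j)" using J T(1) by blast
    show "\<forall>u\<in>(\<Union>j\<in>J. T j). closed (carrier_of u)"
    proof
      fix u assume "u \<in> (\<Union>j\<in>J. T j)"
      then obtain us where "u = osimplex us" using T(2) by (blast elim: simplicesE)
      then show "closed (carrier_of u)"
        by (simp add: compact_imp_closed finite_imp_compact_convex_hull)
    qed
  qed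
  moreover have "finite (\<Union>j\<in>J. G j)" using J G(1) by blast
  ultimately have "carrier_of w \<subseteq> (\<Union>u\<in>(\<Union>j\<in>J. T j). carrier_of u)"
  proof (rule convex_subset_closed_if_covered)
    show "\<exists>p\<in>carrier_of w. inner a p + b \<noteq> 0" if "(a, b) \<in> (\<Union>j\<in>J. G j)" for a b
      using that G(2) by blast
    show "x \<in> (\<Union>u\<in>(\<Union>j\<in>J. T j). carrier_of u) \<or> (\<exists>(a, b)\<in>(\<Union>j\<in>J. G j). inner a x + b = 0)"
      if x: "x \<in> carrier_of w" for x
    proof -
      obtain j where "j \<in> J" "x \<in> c j" using x J(2) by blast
      then show ?thesis using G(3)[of j] x by blast
    qed
  qed
  then show "\<Union> (carrier_of ` (\<Union>j\<in>J. T j)) = carrier_of w" using T(2) by blast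
qed

text \<open>Each \<open>w\<close> is cut along each \<open>w'\<close> separately, and the pieces
  inside \<open>w'\<close> form \<open>T w w'\<close>. The same pieces subdivide \<open>w\<close>
  when \<open>w'\<close> varies and \<open>w'\<close> when \<open>w\<close> varies. The bound comes
  from k + 1 functionals, each with at most k + 1 vertices off its hyperplane. Different pairs share
  no piece, since it would lie in a null intersection within \<open>A\<close> or within
  \<open>B\<close>.\<close>

lemma common_refinement:
  assumes k: "0 < k" and \<sigma>: "\<sigma> \<in> simplices k UNIV"
    and A: "subdivision N k \<sigma> A" and B: "subdivision N k \<sigma> B"
  obtains T where
    "\<And>w. w \<in> A \<Longrightarrow> subdivision N k w (\<Union>w'\<in>B. T w w')"
    "\<And>w'. w' \<in> B \<Longrightarrow> subdivision N k w' (\<Union>w\<in>A. T w w')"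
    "\<And>w w'. w \<in> A \<Longrightarrow> w' \<in> B \<Longrightarrow> finite (T w w') \<and> card (T w w') \<le> 2 ^ (Suc k * Suc k)"
    "\<And>w w'. w \<in> A \<Longrightarrow> w' \<in> B \<Longrightarrow> carrier_of w \<inter> carrier_of w' = {} \<Longrightarrow> T w w' = {}"
    "\<And>w w' v v'. w \<in> A \<Longrightarrow> w' \<in> B \<Longrightarrow> v \<in> A \<Longrightarrow> v' \<in> B \<Longrightarrow> (w, w') \<noteq> (v, v') \<Longrightarrow>
      T w w' \<inter> T v v' = {}"
proof -
  \<comment> \<open>The hyperplanes must not contain either carrier, because the kept pieces have to
    cover \<open>w\<close> as well as \<open>w'\<close>.\<close>
  define refines where "refines = (\<lambda>w vs w' L G. dissect vs L \<and> length L \<le> 2 ^ (Suc k * Suc k) \<and>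
      finite (G :: ('a \<times> real) set) \<and>
      (\<forall>(a, b)\<in>G. (\<exists>p\<in>carrier_of w. inner a p + b \<noteq> 0) \<and> (\<exists>p\<in>carrier_of w'. inner a p + b \<noteq> 0)) \<and>
      (\<forall>us\<in>set L. \<not> convex hull (set us) \<subseteq> carrier_of w' \<longrightarrow>
        (\<forall>x\<in>convex hull (set us) \<inter> carrier_of w'. \<exists>(a, b)\<in>G. inner a x + b = 0)))"
  have ex: "\<exists>L G. refines w vs w' L G"
    if "w \<in> A" "w' \<in> B" "w = osimplex vs" "simplex_vertices k vs" for w w' vs
  proof -
    have uni: "w \<in> simplices k UNIV" "w' \<in> simplices k UNIV"
      using subdivisionD(2)[OF A] subdivisionD(2)[OF B] that by auto
    have "same_orientation k w w'"
      using same_orientation_trans[OF uni(1) \<sigma> uni(2)] same_orientation_sym[OF \<sigma> uni(1)]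
        subdivisionD(3)[OF A that(1)] subdivisionD(3)[OF B that(2)] by blast
    moreover obtain ws where ws: "w' = osimplex ws" "simplex_vertices k ws"
      using uni(2) by (rule simplicesE)
    ultimately have "affine hull (set vs) = affine hull (set ws)"
      using that(3,4) by (simp add: same_orientation_iff simplex_vertices_def)
    from dissect_along_simplex[OF that(4) ws(2) this] obtain L G where
      "dissect vs L" "length L \<le> 2 ^ (Suc k * Suc k)" "finite G"
      "\<And>a b. (a, b) \<in> G \<Longrightarrow> \<exists>p\<in>convex hull (set vs). inner a p + b \<noteq> 0"
      "\<And>a b. (a, b) \<in> G \<Longrightarrow> \<exists>p\<in>convex hull (set ws). inner a p + b \<noteq> 0"
      "\<And>us x. us \<in> set L \<Longrightarrow> \<not> convex hull (set us) \<subseteq> convex hull (set ws) \<Longrightarrow>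
        x \<in> convex hull (set us) \<Longrightarrow> x \<in> convex hull (set ws) \<Longrightarrow> \<exists>(a, b)\<in>G. inner a x + b = 0"
      by blast
    then have "refines w vs w' L G"
      unfolding refines_def that(3) ws(1) carrier_of_osimplex by blast
    then show ?thesis by blast
  qed
  have "\<forall>w\<in>A. \<exists>vs. w = osimplex vs \<and> simplex_vertices k vs"
    using subdivisionD(2)[OF A] by (auto simp: simplices_def)
  then obtain V where V': "\<forall>w\<in>A. w = osimplex (V w) \<and> simplex_vertices k (V w)"
    by (rule bchoice[THEN exE])
  then have V: "w = osimplex (V w)" "simplex_vertices k (V w)" if "w \<in> A" for w using that by blast+
  have "\<forall>w\<in>A. \<forall>w'\<in>B. \<exists>L G. refines w (V w) w' L G" using ex V by blast
  then obtain L G where LG: "\<And>w w'. w \<in> A \<Longrightarrow> w' \<in> B \<Longrightarrow> refines w (V w) w' (L w w') (G w w')"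
    by metis
  \<comment> \<open>Pieces of \<open>w\<close> not contained in \<open>w'\<close> are dropped: they
    meet \<open>w'\<close> only on the hyperplanes in \<open>G w w'\<close>.\<close>
  define T where "T = (\<lambda>w w'. osimplex ` {us \<in> set (L w w'). convex hull (set us) \<subseteq> carrier_of w'})"
  have diss: "dissect (V w) (L w w')" if "w \<in> A" "w' \<in> B" for w w' using LG[OF that] by (simp add: refines_def)
  have G: "finite (G w w')" "\<forall>(a, b)\<in>G w w'. \<exists>p\<in>carrier_of w. inner a p + b \<noteq> 0"
    "\<forall>(a, b)\<in>G w w'. \<exists>p\<in>carrier_of w'. inner a p + b \<noteq> 0" if "w \<in> A" "w' \<in> B" for w w'
    using LG[OF that] unfolding refines_def by auto
  have fin: "finite (T w w')" for w w' by (simp add: T_def)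
  have sub: "u \<in> simplices k UNIV \<and> same_orientation k \<sigma> u \<and> carrier_of u \<subseteq> carrier_of w \<inter> carrier_of w'"
    if w: "w \<in> A" "w' \<in> B" and u: "u \<in> T w w'" for w w' u
  proof -
    have P: "subdivision N k w (osimplex ` set (L w w'))"
      using subdivision_dissect[OF diss[OF w] V(2)[OF w(1)] k] V(1)[OF w(1)] by simp
    have u': "u \<in> osimplex ` set (L w w')" "carrier_of u \<subseteq> carrier_of w'" using u by (auto simp: T_def)
    then have us: "u \<in> simplices k UNIV" "same_orientation k w u" "carrier_of u \<subseteq> carrier_of w"
      using subdivisionD(2,3,5)[OF P] by blast+
    then show ?thesis
      using same_orientation_trans[OF \<sigma> _ us(1) subdivisionD(3)[OF A w(1)] us(2)]
        subdivisionD(2)[OF A] w(1) u'(2) by blast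
  qed
  have null: "Vol N k (carrier_of u \<inter> carrier_of u') = 0"
    if w: "w \<in> A" "w' \<in> B" and u: "u \<in> T w w'" "u' \<in> T w w'" "u \<noteq> u'" for w w' u u'
  proof -
    have "subdivision N k w (osimplex ` set (L w w'))"
      using subdivision_dissect[OF diss[OF w] V(2)[OF w(1)] k] V(1)[OF w(1)] by simp
    moreover have "u \<in> osimplex ` set (L w w')" "u' \<in> osimplex ` set (L w w')"
      using u by (auto simp: T_def)
    ultimately show ?thesis using u(3) by (rule subdivisionD(4))
  qed
  have cover: "x \<in> (\<Union>u\<in>T w w'. carrier_of u) \<or> (\<exists>(a, b)\<in>G w w'. inner a x + b = 0)"
    if w: "w \<in> A" "w' \<in> B" and x: "x \<in> carrier_of w \<inter> carrier_of w'" for w w' x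
  proof -
    have "carrier_of w = convex hull (set (V w))"
      by (subst V(1)[OF w(1)]) simp
    then obtain us where us: "us \<in> set (L w w')" "x \<in> convex hull (set us)"
      using x dissect_hull[OF diss[OF w]] by blast
    show ?thesis
    proof (cases "convex hull (set us) \<subseteq> carrier_of w'")
      case True
      then show ?thesis using us by (auto simp: T_def)
    next
      case False
      then show ?thesis using LG[OF w] us x unfolding refines_def by blast
    qed
  qed
  show thesis
  proof (rule that[of T])
    fix w assume w: "w \<in> A"
    show "subdivision N k w (\<Union>w'\<in>B. T w w')"
    proof (rule subdivision_assemble[where \<sigma> = \<sigma> and c = carrier_of])
      show "w \<in> simplices k UNIV" "same_orientation k \<sigma> w" using w subdivisionD[OF A] by auto
      show "carrier_of w \<subseteq> \<Union> (carrier_of ` B)"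
        using w subdivisionD(5)[OF A] subdivisionD(5)[OF B] by blast
      show "\<exists>G. finite G \<and> (\<forall>(a, b)\<in>G. \<exists>p\<in>carrier_of w. inner a p + b \<noteq> 0) \<and>
        (\<forall>x\<in>carrier_of w \<inter> carrier_of w'. x \<in> \<Union> (carrier_of ` T w w') \<or> (\<exists>(a, b)\<in>G. inner a x + b = 0))"
        if "w' \<in> B" for w'
        using G(1,2)[OF w that] cover[OF w that] by (intro exI[of _ "G w w'"] conjI ballI) auto
      show "u \<in> simplices k UNIV \<and> same_orientation k \<sigma> u \<and> carrier_of u \<subseteq> carrier_of w \<inter> carrier_of w'"
        if "w' \<in> B" "u \<in> T w w'" for w' u using sub[OF w that] .
      show "Vol N k (carrier_of u \<inter> carrier_of u') = 0"
        if "w' \<in> B" "u \<in> T w w'" "u' \<in> T w w'" "u \<noteq> u'" for w' u u' using null[OF w that] .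
      show "finite (T w w')" if "w' \<in> B" for w' by (rule fin)
    qed (fact \<sigma> subdivisionD(1)[OF B] subdivisionD(4)[OF B])+
  next
    fix w' assume w': "w' \<in> B"
    show "subdivision N k w' (\<Union>w\<in>A. T w w')"
    proof (rule subdivision_assemble[where \<sigma> = \<sigma> and c = carrier_of])
      show "w' \<in> simplices k UNIV" "same_orientation k \<sigma> w'" using w' subdivisionD[OF B] by auto
      show "carrier_of w' \<subseteq> \<Union> (carrier_of ` A)"
        using w' subdivisionD(5)[OF A] subdivisionD(5)[OF B] by blast
      show "\<exists>G. finite G \<and> (\<forall>(a, b)\<in>G. \<exists>p\<in>carrier_of w'. inner a p + b \<noteq> 0) \<and>
        (\<forall>x\<in>carrier_of w' \<inter> carrier_of w. x \<in> \<Union> (carrier_of ` T w w') \<or> (\<exists>(a, b)\<in>G. inner a x + b = 0))"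
        if "w \<in> A" for w
        using G(1,3)[OF that w'] cover[OF that w'] by (intro exI[of _ "G w w'"] conjI ballI) auto
      show "u \<in> simplices k UNIV \<and> same_orientation k \<sigma> u \<and> carrier_of u \<subseteq> carrier_of w' \<inter> carrier_of w"
        if "w \<in> A" "u \<in> T w w'" for w u using sub[OF that(1) w' that(2)] by blast
      show "Vol N k (carrier_of u \<inter> carrier_of u') = 0"
        if "w \<in> A" "u \<in> T w w'" "u' \<in> T w w'" "u \<noteq> u'" for w u u' using null[OF that(1) w' that(2-)] .
      show "finite (T w w')" if "w \<in> A" for w by (rule fin)
    qed (fact \<sigma> subdivisionD(1)[OF A] subdivisionD(4)[OF A])+
  next
    fix w w' assume w: "w \<in> A" "w' \<in> B"
    have "card (T w w') \<le> card {us \<in> set (L w w'). convex hull (set us) \<subseteq> carrier_of w'}"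
      unfolding T_def by (intro card_image_le) auto
    also have "\<dots> \<le> card (set (L w w'))" by (intro card_mono) auto
    also have "\<dots> \<le> length (L w w')" by (rule card_length)
    finally show "finite (T w w') \<and> card (T w w') \<le> 2 ^ (Suc k * Suc k)"
      using LG[OF w] fin unfolding refines_def by (meson order_trans)
    show "T w w' = {}" if "carrier_of w \<inter> carrier_of w' = {}"
    proof (rule ccontr)
      assume "T w w' \<noteq> {}"
      then obtain u where "u \<in> T w w'" by blast
      from sub[OF w this] have u: "u \<in> simplices k UNIV" "carrier_of u \<subseteq> {}" using that by auto
      obtain us where "u = osimplex us" "length us = Suc k" using u(1) by (rule simplicesE)
      then show False using u(2) by auto
    qed
    fix v v' assume v: "v \<in> A" "v' \<in> B" and neq: "(w, w') \<noteq> (v, v')"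
    show "T w w' \<inter> T v v' = {}"
    proof (rule ccontr)
      assume "T w w' \<inter> T v v' \<noteq> {}"
      then obtain u where u: "u \<in> T w w'" "u \<in> T v v'" by blast
      have s: "u \<in> simplices k UNIV" "carrier_of u \<subseteq> carrier_of w \<inter> carrier_of v"
        "carrier_of u \<subseteq> carrier_of w' \<inter> carrier_of v'"
        using sub[OF w u(1)] sub[OF v u(2)] by auto
      show False
      proof (cases "w = v")
        case True
        then show ?thesis
          using no_simplex_in_null_set[OF s(1) k s(3)] subdivisionD(4)[OF B w(2) v(2)] neq by auto
      next
        case False
        then show ?thesis
          using no_simplex_in_null_set[OF s(1) k s(2)] subdivisionD(4)[OF A w(1) v(1)] by auto
      qed
    qed
  qed
qed

end

section \<open>Convergence of the sums over cells\<close>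

definition cell_set :: "nat \<Rightarrow> 'a::real_vector list \<Rightarrow> 'a osimplex set" where
  "cell_set n vs = osimplex ` fst ` set (cells n vs)"

definition cell_sum :: "('a::real_vector osimplex \<Rightarrow> real) \<Rightarrow> nat \<Rightarrow> 'a list \<Rightarrow> real" where
  "cell_sum \<Xi> n vs = (\<Sum>\<tau>\<in>cell_set n vs. \<Xi> \<tau>)"

text \<open>Defined on vertex lists because the cells depend on the order of the vertices. The value
  of \<open>lim\<close> is meaningful once convergence is known from
  \<open>cell_sum_limit\<close>.\<close>

definition sewn :: "('a::real_vector osimplex \<Rightarrow> real) \<Rightarrow> 'a list \<Rightarrow> real" where
  "sewn \<Xi> vs = lim (\<lambda>n. cell_sum \<Xi> n vs)"

text \<open>A geometric series with ratio 2^(k - \<gamma>). The factor 2^k counts the children of a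
  cell in one generation, and k^\<gamma> comes from the diameter bound for cells.\<close>

definition sewing_const :: "nat \<Rightarrow> real \<Rightarrow> real" where
  "sewing_const k \<gamma> = 2 ^ k * real k powr \<gamma> / (1 - 2 powr (real k - \<gamma>))"

lemma sum_list_map_concat: "sum_list (map f (concat xss)) = (\<Sum>xs\<leftarrow>xss. sum_list (map f xs))"
  for f :: "'b \<Rightarrow> real"
  by (induction xss) auto

lemma sewing_const_nonneg: "real k < \<gamma> \<Longrightarrow> 0 \<le> sewing_const k \<gamma>"
  unfolding sewing_const_def
  by (intro divide_nonneg_nonneg mult_nonneg_nonneg) (auto simp: powr_le_one_le powr_less_one less_imp_le)

text \<open>The number of cells times the error per cell is geometric in the generation; its ratio
  is below 1 precisely for \<gamma> > k.\<close>

lemma powr_cell_scale: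
  assumes "0 \<le> D"
  shows "2 ^ (k * n) * (D / 2 ^ n) powr \<gamma> = D powr \<gamma> * (2 powr (real k - \<gamma>)) ^ n"
proof -
  have "(2::real) ^ n = 2 powr real n" by (simp add: powr_realpow)
  then have "(D / 2 ^ n) powr \<gamma> = D powr \<gamma> / 2 powr (real n * \<gamma>)"
    using assms by (simp add: powr_divide powr_powr)
  moreover have "(2::real) ^ (k * n) = 2 powr (real k * real n)" by (simp add: powr_realpow flip: of_nat_mult)
  moreover have "(2 powr (real k - \<gamma>)) ^ n = 2 powr (real k * real n) / 2 powr (real n * \<gamma>)"
    by (simp add: powr_power powr_diff[symmetric] algebra_simps)
  ultimately show ?thesis by simp
qed

context arbitrary_norm
begin

lemma subdivision_cell_set:
  assumes "simplex_vertices k vs" "0 < k"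
  shows "subdivision N k (osimplex vs) (cell_set n vs)"
  using subdivision_dissect[OF cells_dissect assms] by (simp add: cell_set_def)

lemma distinct_cells:
  fixes vs :: "'a list"
  assumes "simplex_vertices k vs" "0 < k"
  shows "distinct (map osimplex (map fst (cells n vs)))"
  by (rule dissect_distinct[OF cells_dissect assms])

lemma finite_cell_set: "finite (cell_set n vs)"
  by (simp add: cell_set_def)

lemma card_cell_set:
  fixes vs :: "'a list"
  assumes "simplex_vertices k vs" "0 < k"
  shows "card (cell_set n vs) = 2 ^ (k * n)"
  using distinct_card[OF distinct_cells[OF assms, of n]] cells_length[of vs k n] assms(1)
  by (simp add: cell_set_def simplex_vertices_def image_image)

lemma sum_cell_set:
  fixes vs :: "'a list"
  assumes "simplex_vertices k vs" "0 < k"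
  shows "(\<Sum>\<tau>\<in>cell_set n vs. f \<tau>) = (\<Sum>(ws, us)\<leftarrow>cells n vs. f (osimplex ws))"
  using sum_list_distinct_conv_sum_set[OF distinct_cells[OF assms, of n], of f]
  by (simp add: cell_set_def comp_def split_def image_image)

lemma diam_cell:
  assumes "length vs = Suc k" "(ws, us) \<in> set (cells n vs)"
  shows "diam N (osimplex ws) \<le> real k * diam N (osimplex vs) / 2 ^ n"
  by (rule diam_osimplex_le)
    (auto intro!: cells_diameter[OF assms(1) _ assms(2)] N_diff_le_diam hull_inc)

lemma diam_cell_set:
  assumes "simplex_vertices k vs" "\<tau> \<in> cell_set n vs"
  shows "diam N \<tau> \<le> real k * diam N (osimplex vs) / 2 ^ n"
  using assms by (auto simp: cell_set_def simplex_vertices_def intro!: diam_cell)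

text \<open>The content of a finite \<open>seminorm_delta\<close>, with a real constant
  \<open>E\<close> in place of the extended supremum and the quotient multiplied out.\<close>

definition almost_additive :: "nat \<Rightarrow> 'a set \<Rightarrow> real \<Rightarrow> real \<Rightarrow> ('a osimplex \<Rightarrow> real) \<Rightarrow> bool" where
  "almost_additive k K \<gamma> E \<Xi> \<longleftrightarrow> 0 \<le> E \<and> (\<forall>\<sigma>\<in>simplices k K. \<forall>P. subdivision N k \<sigma> P \<longrightarrow>
     \<bar>\<Xi> \<sigma> - (\<Sum>\<tau>\<in>P. \<Xi> \<tau>)\<bar> \<le> E * real (card P) * diam N \<sigma> powr \<gamma>)"

text \<open>Passing to the next generation subdivides each of the 2^(k n) cells into 2^k children,
  at the cost of \<open>E\<close> times 2^k times the \<gamma>-th power of the cell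
  diameter.\<close>

lemma cell_sum_step:
  assumes \<Xi>: "almost_additive k K \<gamma> E \<Xi>" and k: "0 < k" and \<gamma>: "0 \<le> \<gamma>"
    and vs: "simplex_vertices k vs" "convex hull (set vs) \<subseteq> K"
  shows "\<bar>cell_sum \<Xi> (Suc n) vs - cell_sum \<Xi> n vs\<bar>
    \<le> E * 2 ^ k * (real k * diam N (osimplex vs)) powr \<gamma> * (2 powr (real k - \<gamma>)) ^ n"
proof -
  have E: "0 \<le> E" using \<Xi> by (simp add: almost_additive_def)
  have len: "length vs = Suc k" using vs by (simp add: simplex_vertices_def)
  define r where "r = real k * diam N (osimplex vs) / 2 ^ n"
  define g where "g = (\<lambda>(ws, us). \<Sum>(u, us')\<leftarrow>halve ws us []. \<Xi> (osimplex u))"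
  have bound: "\<bar>g (ws, us) - \<Xi> (osimplex ws)\<bar> \<le> E * 2 ^ k * r powr \<gamma>"
    if c: "(ws, us) \<in> set (cells n vs)" for ws us
  proof -
    have vo: "vertex_order ws us" "length ws = Suc k" using cells_vertex_order[OF c] len by auto
    have "length us = Suc k"
      using vo by (metis card_lessThan distinct_card vertex_order_def)
    then have us: "length (halve ws us []) = 2 ^ k" by (subst halve_length) auto
    define L where "L = map fst (halve ws us [])"
    have d: "dissect ws L" unfolding L_def using vo by (intro halve_dissect) simp
    have cin: "ws \<in> set (map fst (cells n vs))" using c by force
    have sv: "simplex_vertices k ws"
      by (rule dissect_simplex_vertices[OF cells_dissect cin vs(1)])
    have "convex hull (set ws) \<subseteq> K"
      using dissect_hull[OF cells_dissect[of vs n]] cin vs(2) by blast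
    then have in_K: "osimplex ws \<in> simplices k K" using sv unfolding simplices_def by blast
    have dist: "distinct (map osimplex L)" by (rule dissect_distinct[OF d sv k])
    have "card (osimplex ` set L) = 2 ^ k"
      using distinct_card[OF dist] us by (simp add: L_def image_image)
    moreover have "(\<Sum>\<tau>\<in>osimplex ` set L. \<Xi> \<tau>) = g (ws, us)"
      using sum_list_distinct_conv_sum_set[OF dist, of \<Xi>] by (simp add: g_def L_def comp_def split_def image_image)
    ultimately have "\<bar>\<Xi> (osimplex ws) - g (ws, us)\<bar> \<le> E * real (2 ^ k) * diam N (osimplex ws) powr \<gamma>"
      using \<Xi> in_K subdivision_dissect[OF d sv k] unfolding almost_additive_def by metis
    also have "\<dots> \<le> E * real (2 ^ k) * r powr \<gamma>"
      unfolding r_def using E \<gamma> diam_cell[OF len c] by (intro mult_left_mono powr_mono2) auto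
    finally show ?thesis by (simp add: abs_minus_commute)
  qed
  have "cell_sum \<Xi> (Suc n) vs = (\<Sum>c\<leftarrow>cells n vs. g c)"
    unfolding cell_sum_def sum_cell_set[OF vs(1) k] g_def
    by (simp add: sum_list_map_concat split_def comp_def)
  moreover have "cell_sum \<Xi> n vs = (\<Sum>c\<leftarrow>cells n vs. \<Xi> (osimplex (fst c)))"
    unfolding cell_sum_def sum_cell_set[OF vs(1) k] by (simp add: split_def)
  ultimately have "\<bar>cell_sum \<Xi> (Suc n) vs - cell_sum \<Xi> n vs\<bar>
      = \<bar>\<Sum>c\<leftarrow>cells n vs. g c - \<Xi> (osimplex (fst c))\<bar>"
    by (simp add: sum_list_subtractf)
  also have "\<dots> \<le> (\<Sum>c\<leftarrow>cells n vs. \<bar>g c - \<Xi> (osimplex (fst c))\<bar>)"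
    using sum_list_abs[of "map (\<lambda>c. g c - \<Xi> (osimplex (fst c))) (cells n vs)"] by (simp add: comp_def)
  also have "\<dots> \<le> (\<Sum>c\<leftarrow>cells n vs. E * 2 ^ k * r powr \<gamma>)"
    using bound by (intro sum_list_mono) auto
  also have "\<dots> = E * 2 ^ k * (2 ^ (k * n) * r powr \<gamma>)"
    by (simp add: sum_list_triv cells_length[OF len])
  also have "\<dots> = E * 2 ^ k * (real k * diam N (osimplex vs)) powr \<gamma> * (2 powr (real k - \<gamma>)) ^ n"
    unfolding r_def by (subst powr_cell_scale) auto
  finally show ?thesis .
qed

lemma cell_sum_0:
  "cell_sum \<Xi> 0 vs = \<Xi> (osimplex vs)"
  by (simp add: cell_sum_def cell_set_def)

text \<open>The increments are dominated by a geometric series. As generation 0 is the simplex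
  itself, the total of that series bounds the distance of the limit from the value of
  \<open>\<Xi>\<close>.\<close>

lemma cell_sum_limit:
  assumes \<Xi>: "almost_additive k K \<gamma> E \<Xi>" and k: "0 < k" and \<gamma>: "real k < \<gamma>"
    and vs: "simplex_vertices k vs" "convex hull (set vs) \<subseteq> K"
  shows "(\<lambda>n. cell_sum \<Xi> n vs) \<longlonglongrightarrow> sewn \<Xi> vs"
    and "\<bar>sewn \<Xi> vs - \<Xi> (osimplex vs)\<bar> \<le> sewing_const k \<gamma> * E * diam N (osimplex vs) powr \<gamma>"
proof -
  have \<gamma>0: "0 \<le> \<gamma>" using \<gamma> by simp
  define q where "q = 2 powr (real k - \<gamma>)"
  have q: "0 \<le> q" "q < 1" using \<gamma> by (auto simp: q_def powr_less_one)
  define c where "c = E * 2 ^ k * (real k * diam N (osimplex vs)) powr \<gamma>"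
  define d where "d = (\<lambda>n. cell_sum \<Xi> (Suc n) vs - cell_sum \<Xi> n vs)"
  have d: "\<bar>d n\<bar> \<le> c * q ^ n" for n
    unfolding d_def c_def q_def by (rule cell_sum_step[OF \<Xi> k \<gamma>0 vs])
  have geo: "summable (\<lambda>n. c * q ^ n)" using q by (intro summable_mult summable_geometric) auto
  have abs: "summable (\<lambda>n. \<bar>d n\<bar>)" by (rule summable_comparison_test'[OF geo, of 0]) (simp add: d)
  then have "summable d" by (rule summable_rabs_cancel)
  then have "(\<lambda>n. \<Sum>i<n. d i) \<longlonglongrightarrow> suminf d" by (rule summable_LIMSEQ)
  moreover have "(\<Sum>i<n. d i) = cell_sum \<Xi> n vs - cell_sum \<Xi> 0 vs" for n
    by (induction n) (simp_all add: d_def)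
  ultimately have "(\<lambda>n. cell_sum \<Xi> n vs - cell_sum \<Xi> 0 vs) \<longlonglongrightarrow> suminf d" by simp
  from tendsto_add[OF this tendsto_const[of "cell_sum \<Xi> 0 vs"]]
  have lim: "(\<lambda>n. cell_sum \<Xi> n vs) \<longlonglongrightarrow> suminf d + cell_sum \<Xi> 0 vs" by simp
  then have s: "sewn \<Xi> vs = suminf d + cell_sum \<Xi> 0 vs" unfolding sewn_def by (rule limI)
  show "(\<lambda>n. cell_sum \<Xi> n vs) \<longlonglongrightarrow> sewn \<Xi> vs" using lim s by simp
  have "\<bar>suminf d\<bar> \<le> (\<Sum>n. \<bar>d n\<bar>)" by (rule summable_rabs[OF abs])
  also have "\<dots> \<le> (\<Sum>n. c * q ^ n)" by (rule suminf_le[OF d abs geo])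
  also have "\<dots> = c / (1 - q)" using q by (simp add: suminf_mult suminf_geometric summable_geometric)
  also have "\<dots> = sewing_const k \<gamma> * E * diam N (osimplex vs) powr \<gamma>"
    by (simp add: c_def q_def sewing_const_def powr_mult)
  finally show "\<bar>sewn \<Xi> vs - \<Xi> (osimplex vs)\<bar> \<le> sewing_const k \<gamma> * E * diam N (osimplex vs) powr \<gamma>"
    by (simp add: s cell_sum_0)
qed

text \<open>The error made on the cells of \<open>A\<close> (or of \<open>B\<close>) is proportional to the number of pieces of
  the common refinement, which is why the number of intersecting pairs is all that matters.\<close>

lemma subdivision_sums_close:
  assumes \<Xi>: "almost_additive k K \<gamma> E \<Xi>" and k: "0 < k" and \<gamma>: "0 \<le> \<gamma>"
    and \<sigma>: "\<sigma> \<in> simplices k K"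
    and A: "subdivision N k \<sigma> A" and B: "subdivision N k \<sigma> B"
    and r: "\<And>w. w \<in> A \<union> B \<Longrightarrow> diam N w \<le> r"
    and m: "card {(w, w') \<in> A \<times> B. carrier_of w \<inter> carrier_of w' \<noteq> {}} \<le> m"
  shows "\<bar>(\<Sum>w\<in>A. \<Xi> w) - (\<Sum>w\<in>B. \<Xi> w)\<bar> \<le> 2 * E * 2 ^ (Suc k * Suc k) * real m * r powr \<gamma>"
proof -
  have E: "0 \<le> E" using \<Xi> by (simp add: almost_additive_def)
  have \<sigma>': "\<sigma> \<in> simplices k UNIV" using \<sigma> simplices_iff_carrier by blast
  have fin: "finite A" "finite B" using subdivisionD(1)[OF A] subdivisionD(1)[OF B] .
  obtain T where T:
    "\<And>w. w \<in> A \<Longrightarrow> subdivision N k w (\<Union>w'\<in>B. T w w')"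
    "\<And>w'. w' \<in> B \<Longrightarrow> subdivision N k w' (\<Union>w\<in>A. T w w')"
    "\<And>w w'. w \<in> A \<Longrightarrow> w' \<in> B \<Longrightarrow> finite (T w w') \<and> card (T w w') \<le> 2 ^ (Suc k * Suc k)"
    "\<And>w w'. w \<in> A \<Longrightarrow> w' \<in> B \<Longrightarrow> carrier_of w \<inter> carrier_of w' = {} \<Longrightarrow> T w w' = {}"
    "\<And>w w' v v'. w \<in> A \<Longrightarrow> w' \<in> B \<Longrightarrow> v \<in> A \<Longrightarrow> v' \<in> B \<Longrightarrow> (w, w') \<noteq> (v, v') \<Longrightarrow>
      T w w' \<inter> T v v' = {}"
    using common_refinement[OF k \<sigma>' A B] by blast
  define S where "S = (\<lambda>w w'. \<Sum>u\<in>T w w'. \<Xi> u)"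
  define n where "n = (\<lambda>w w'. real (card (T w w')))"
  have one: "\<bar>\<Xi> w - (\<Sum>j\<in>J. \<Sum>u\<in>U j. \<Xi> u)\<bar> \<le> E * (\<Sum>j\<in>J. real (card (U j))) * r powr \<gamma>"
    if w: "w \<in> A \<union> B" and J: "finite J" "\<And>j. j \<in> J \<Longrightarrow> finite (U j)"
      "\<And>i j. i \<in> J \<Longrightarrow> j \<in> J \<Longrightarrow> i \<noteq> j \<Longrightarrow> U i \<inter> U j = {}"
      "subdivision N k w (\<Union>j\<in>J. U j)" for w J and U :: "'a osimplex \<Rightarrow> 'a osimplex set"
  proof -
    have "w \<in> simplices k K"
      using w subdivision_simplices[OF \<sigma> A] subdivision_simplices[OF \<sigma> B] by blast
    then have "\<bar>\<Xi> w - (\<Sum>u\<in>(\<Union>j\<in>J. U j). \<Xi> u)\<bar> \<le> E * real (card (\<Union>j\<in>J. U j)) * diam N w powr \<gamma>"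
      using \<Xi> J(4) unfolding almost_additive_def by blast
    also have "(\<Sum>u\<in>(\<Union>j\<in>J. U j). \<Xi> u) = (\<Sum>j\<in>J. \<Sum>u\<in>U j. \<Xi> u)"
      using J by (intro sum.UNION_disjoint) auto
    also have "card (\<Union>j\<in>J. U j) = (\<Sum>j\<in>J. card (U j))"
      using J by (intro card_UN_disjoint) auto
    also have "E * real (\<Sum>j\<in>J. card (U j)) * diam N w powr \<gamma> \<le> E * (\<Sum>j\<in>J. real (card (U j))) * r powr \<gamma>"
      using E \<gamma> r[OF w] unfolding of_nat_sum
      by (intro mult_left_mono powr_mono2) (auto intro!: mult_nonneg_nonneg sum_nonneg)
    finally show ?thesis .
  qed
  have A': "\<bar>\<Xi> w - (\<Sum>w'\<in>B. S w w')\<bar> \<le> E * (\<Sum>w'\<in>B. n w w') * r powr \<gamma>" if "w \<in> A" for w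
    unfolding S_def n_def using that T(1,3) T(5)[OF that _ that] fin by (intro one) auto
  have B': "\<bar>\<Xi> w' - (\<Sum>w\<in>A. S w w')\<bar> \<le> E * (\<Sum>w\<in>A. n w w') * r powr \<gamma>" if "w' \<in> B" for w'
    unfolding S_def n_def using that T(2,3) T(5)[OF _ that _ that] fin by (intro one) auto
  \<comment> \<open>Both sums are compared with the sum \<open>Z\<close> over the common refinement;
    \<open>M\<close> is its number of pieces.\<close>
  define Z where "Z = (\<Sum>w\<in>A. \<Sum>w'\<in>B. S w w')"
  define M where "M = (\<Sum>w\<in>A. \<Sum>w'\<in>B. n w w')"
  have Z': "Z = (\<Sum>w'\<in>B. \<Sum>w\<in>A. S w w')" unfolding Z_def by (rule sum.swap)
  have M': "M = (\<Sum>w'\<in>B. \<Sum>w\<in>A. n w w')" unfolding M_def by (rule sum.swap)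
  have "\<bar>(\<Sum>w\<in>A. \<Xi> w) - Z\<bar> \<le> E * M * r powr \<gamma>"
  proof -
    have "\<bar>(\<Sum>w\<in>A. \<Xi> w) - Z\<bar> = \<bar>\<Sum>w\<in>A. \<Xi> w - (\<Sum>w'\<in>B. S w w')\<bar>" by (simp add: Z_def sum_subtractf)
    also have "\<dots> \<le> (\<Sum>w\<in>A. \<bar>\<Xi> w - (\<Sum>w'\<in>B. S w w')\<bar>)" by (rule sum_abs)
    also have "\<dots> \<le> (\<Sum>w\<in>A. E * (\<Sum>w'\<in>B. n w w') * r powr \<gamma>)" by (intro sum_mono A')
    also have "\<dots> = E * M * r powr \<gamma>" by (simp add: M_def sum_distrib_left sum_distrib_right mult.assoc)
    finally show ?thesis .
  qed
  moreover have "\<bar>(\<Sum>w\<in>B. \<Xi> w) - Z\<bar> \<le> E * M * r powr \<gamma>"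
  proof -
    have "\<bar>(\<Sum>w\<in>B. \<Xi> w) - Z\<bar> = \<bar>\<Sum>w'\<in>B. \<Xi> w' - (\<Sum>w\<in>A. S w w')\<bar>" by (simp add: Z' sum_subtractf)
    also have "\<dots> \<le> (\<Sum>w'\<in>B. \<bar>\<Xi> w' - (\<Sum>w\<in>A. S w w')\<bar>)" by (rule sum_abs)
    also have "\<dots> \<le> (\<Sum>w'\<in>B. E * (\<Sum>w\<in>A. n w w') * r powr \<gamma>)" by (intro sum_mono B')
    also have "\<dots> = E * M * r powr \<gamma>" by (simp add: M' sum_distrib_left sum_distrib_right mult.assoc)
    finally show ?thesis .
  qed
  ultimately have "\<bar>(\<Sum>w\<in>A. \<Xi> w) - (\<Sum>w\<in>B. \<Xi> w)\<bar> \<le> 2 * (E * M * r powr \<gamma>)" by linarith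
  also have "M \<le> 2 ^ (Suc k * Suc k) * real m"
  proof -
    define R where "R = {(w, w') \<in> A \<times> B. carrier_of w \<inter> carrier_of w' \<noteq> {}}"
    have "M = (\<Sum>(w, w')\<in>A \<times> B. n w w')" unfolding M_def by (rule sum.cartesian_product)
    \<comment> \<open>Pairs of cells that do not meet have no pieces in common and drop out of the
      count.\<close>
    also have "\<dots> = (\<Sum>(w, w')\<in>R. n w w')"
      using fin T(4) by (intro sum.mono_neutral_right) (auto simp: R_def n_def)
    also have "\<dots> \<le> (\<Sum>(w, w')\<in>R. 2 ^ (Suc k * Suc k))"
    proof (intro sum_mono)
      fix p assume "p \<in> R"
      then obtain w w' where "p = (w, w')" "w \<in> A" "w' \<in> B" by (auto simp: R_def)
      then show "(case p of (w, w') \<Rightarrow> n w w') \<le> (case p of (w, w') \<Rightarrow> 2 ^ (Suc k * Suc k))"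
        using T(3)[of w w'] of_nat_mono[of "card (T w w')" "2 ^ (Suc k * Suc k)", where ?'a = real]
        by (simp add: n_def)
    qed
    also have "\<dots> = 2 ^ (Suc k * Suc k) * real (card R)" by (simp add: split_def)
    also have "\<dots> \<le> 2 ^ (Suc k * Suc k) * real m" using m by (intro mult_left_mono) (auto simp: R_def)
    finally show ?thesis .
  qed
  then have "2 * (E * M * r powr \<gamma>) \<le> 2 * (E * (2 ^ (Suc k * Suc k) * real m) * r powr \<gamma>)"
    using E by (intro mult_left_mono mult_right_mono) auto
  finally show ?thesis by (simp add: mult.assoc)
qed

end

section \<open>Additivity of the limit\<close>

context arbitrary_norm
begin

text \<open>The functionals dual to the edges read off the integer coefficients, so a bound on
  \<open>N p\<close> leaves finitely many values for each of them.\<close>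

lemma finite_lattice_ball:
  assumes "simplex_vertices k vs"
  shows "finite {p. (\<exists>m :: nat \<Rightarrow> int. p = (\<Sum>i<k. of_int (m i) *\<^sub>R (vs ! Suc i - vs ! 0))) \<and> N p \<le> R}"
    (is "finite ?S")
proof -
  define e where "e = (\<lambda>j. vs ! Suc j - vs ! 0)"
  obtain a B where a: "\<And>i j. i < k \<Longrightarrow> j < k \<Longrightarrow> inner (a i) (e j) = (if i = j then 1 else 0)"
    and B0: "0 < B" and B: "\<And>i x. i < k \<Longrightarrow> \<bar>inner (a i) x\<bar> \<le> B * N x"
    using edge_dual_functionals[OF assms] unfolding e_def by blast
  define c where "c = \<lceil>B * R\<rceil>"
  have "?S \<subseteq> (\<lambda>m. \<Sum>i<k. of_int (m i) *\<^sub>R e i) ` ({..<k} \<rightarrow>\<^sub>E {- c..c})"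
  proof
    fix p assume "p \<in> ?S"
    then obtain m :: "nat \<Rightarrow> int" where p: "p = (\<Sum>i<k. of_int (m i) *\<^sub>R e i)" and R: "N p \<le> R"
      by (auto simp: e_def)
    have "m i \<in> {- c..c}" if "i < k" for i
    proof -
      have "inner (a i) p = (\<Sum>j<k. of_int (m j) * inner (a i) (e j))"
        by (simp add: p inner_sum_right)
      also have "\<dots> = (\<Sum>j<k. if i = j then of_int (m j) else 0)"
        using that by (intro sum.cong) (auto simp: a)
      finally have "inner (a i) p = of_int (m i)" using that by simp
      then have "\<bar>of_int (m i)\<bar> \<le> B * R"
        using order_trans[OF B[OF that, of p] mult_left_mono[OF R less_imp_le[OF B0]]] by simp
      then have "of_int \<bar>m i\<bar> \<le> (of_int c :: real)"
        unfolding c_def using le_of_int_ceiling[of "B * R"] by linarith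
      then have "\<bar>m i\<bar> \<le> c" by (simp only: of_int_le_iff)
      then show ?thesis by auto
    qed
    moreover have "p = (\<Sum>i<k. of_int (restrict m {..<k} i) *\<^sub>R e i)" unfolding p by (intro sum.cong) auto
    ultimately show "p \<in> (\<lambda>m. \<Sum>i<k. of_int (m i) *\<^sub>R e i) ` ({..<k} \<rightarrow>\<^sub>E {- c..c})"
      by (intro image_eqI[of _ _ "restrict m {..<k}"]) auto
  qed
  then show ?thesis by (rule finite_subset) (intro finite_imageI finite_PiE, auto)
qed

text \<open>Differences of lattice points lie in a discrete group, hence the uniform bound.\<close>

lemma card_lattice_points_in_ball:
  assumes "simplex_vertices k vs"
  obtains l where
    "\<And>n y. finite {p \<in> lattice_points (1 / 2 ^ n) k vs. N (p - y) \<le> R / 2 ^ n} \<and>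
      card {p \<in> lattice_points (1 / 2 ^ n) k vs. N (p - y) \<le> R / 2 ^ n} \<le> l"
proof -
  \<comment> \<open>The radius doubles because two points of a ball around an arbitrary
    \<open>y\<close> are compared with each other.\<close>
  define \<Lambda> where "\<Lambda> = {p. (\<exists>m :: nat \<Rightarrow> int. p = (\<Sum>i<k. of_int (m i) *\<^sub>R (vs ! Suc i - vs ! 0))) \<and> N p \<le> 2 * R}"
  have fin: "finite \<Lambda>" unfolding \<Lambda>_def by (rule finite_lattice_ball[OF assms])
  have "finite F \<and> card F \<le> card \<Lambda>"
    if F: "F = {p \<in> lattice_points (1 / 2 ^ n) k vs. N (p - y) \<le> R / 2 ^ n}" for F n y
  proof (cases "F = {}")
    case False
    then obtain p0 where p0: "p0 \<in> F" by blast
    \<comment> \<open>Rescaled differences to one point of the ball land in the same finite set for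
      all generations, so the bound depends neither on \<open>n\<close> nor on
      \<open>y\<close>.\<close>
    define f where "f = (\<lambda>p. (2 ^ n) *\<^sub>R (p - p0))"
    have inj: "inj_on f F" by (intro inj_onI) (simp add: f_def)
    have "f p \<in> \<Lambda>" if p: "p \<in> F" for p
    proof -
      obtain m m0 :: "nat \<Rightarrow> int" where
        m: "p = vs ! 0 + (1 / 2 ^ n) *\<^sub>R (\<Sum>i<k. of_int (m i) *\<^sub>R (vs ! Suc i - vs ! 0))"
        "p0 = vs ! 0 + (1 / 2 ^ n) *\<^sub>R (\<Sum>i<k. of_int (m0 i) *\<^sub>R (vs ! Suc i - vs ! 0))"
        using p p0 unfolding F lattice_points_def by blast
      have "f p = (\<Sum>i<k. of_int (m i) *\<^sub>R (vs ! Suc i - vs ! 0)) - (\<Sum>i<k. of_int (m0 i) *\<^sub>R (vs ! Suc i - vs ! 0))"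
        unfolding f_def m by (simp add: scaleR_diff_right[symmetric])
      also have "\<dots> = (\<Sum>i<k. of_int (m i - m0 i) *\<^sub>R (vs ! Suc i - vs ! 0))"
        unfolding of_int_diff scaleR_diff_left sum_subtractf ..
      finally have "\<exists>m :: nat \<Rightarrow> int. f p = (\<Sum>i<k. of_int (m i) *\<^sub>R (vs ! Suc i - vs ! 0))"
        by (rule exI[of _ "\<lambda>i. m i - m0 i"])
      moreover have "N (f p) \<le> 2 * R"
      proof -
        have "N (p - p0) \<le> R / 2 ^ n + R / 2 ^ n"
          using p p0 N_triangle_diff[of p p0 y] N_minus_commute[of y p0] unfolding F by auto
        then have "2 ^ n * N (p - p0) \<le> 2 * R" by (simp add: field_simps)
        then show ?thesis unfolding f_def N_scaleR by simp
      qed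
      ultimately show ?thesis unfolding \<Lambda>_def by blast
    qed
    then have sub: "f ` F \<subseteq> \<Lambda>" by blast
    show ?thesis using inj_on_finite[OF inj sub fin] card_inj_on_le[OF inj sub fin] by blast
  qed simp
  then show thesis using that[of "card \<Lambda>"] by blast
qed

text \<open>All vertices of a cell meeting \<open>X\<close> lie in a ball of radius
  \<open>R' / 2 ^ n\<close> about a point of \<open>X\<close>, where \<open>R'\<close> adds the cell
  diameter to \<open>R\<close>. A cell comes from k + 1 of the boundedly many lattice points in that
  ball.\<close>

lemma card_cells_meeting:
  assumes vs: "simplex_vertices k vs"
  obtains l where
    "\<And>n X. (\<And>x y. x \<in> X \<Longrightarrow> y \<in> X \<Longrightarrow> N (x - y) \<le> R / 2 ^ n) \<Longrightarrow>
      card {w \<in> cell_set n vs. carrier_of w \<inter> X \<noteq> {}} \<le> l"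
proof -
  have len: "length vs = Suc k" using vs by (simp add: simplex_vertices_def)
  define R' where "R' = real k * diam N (osimplex vs) + R"
  obtain l0 where l0: "\<And>n y. finite {p \<in> lattice_points (1 / 2 ^ n) k vs. N (p - y) \<le> R' / 2 ^ n} \<and>
      card {p \<in> lattice_points (1 / 2 ^ n) k vs. N (p - y) \<le> R' / 2 ^ n} \<le> l0"
    using card_lattice_points_in_ball[OF vs] by blast
  have "card {w \<in> cell_set n vs. carrier_of w \<inter> X \<noteq> {}} \<le> l0 ^ Suc k"
    if X: "\<And>x y. x \<in> X \<Longrightarrow> y \<in> X \<Longrightarrow> N (x - y) \<le> R / 2 ^ n" for n X
  proof (cases "X = {}")
    case False
    then obtain x0 where x0: "x0 \<in> X" by blast
    define F where "F = {p \<in> lattice_points (1 / 2 ^ n) k vs. N (p - x0) \<le> R' / 2 ^ n}"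
    have F: "finite F" "card F \<le> l0" using l0[of n x0] by (auto simp: F_def)
    have "{w \<in> cell_set n vs. carrier_of w \<inter> X \<noteq> {}} \<subseteq> osimplex ` {ws. set ws \<subseteq> F \<and> length ws = Suc k}"
    proof
      fix w assume "w \<in> {w \<in> cell_set n vs. carrier_of w \<inter> X \<noteq> {}}"
      then have "w \<in> cell_set n vs" "carrier_of w \<inter> X \<noteq> {}" by auto
      then obtain ws us where w: "w = osimplex ws" "(ws, us) \<in> set (cells n vs)"
        unfolding cell_set_def by (metis image_iff prod.collapse)
      with \<open>carrier_of w \<inter> X \<noteq> {}\<close> obtain x where x: "x \<in> convex hull (set ws)" "x \<in> X" by auto
      have "p \<in> F" if p: "p \<in> set ws" for p
      proof -
        have "N (p - x) \<le> diam N (osimplex ws)" using p x(1)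
          by (intro N_diff_le_diam) (auto intro: hull_inc)
        also have "\<dots> \<le> real k * diam N (osimplex vs) / 2 ^ n" by (rule diam_cell[OF len w(2)])
        finally have "N (p - x0) \<le> R' / 2 ^ n"
          using N_triangle_diff[of p x0 x] X[OF x(2) x0] by (simp add: R'_def add_divide_distrib)
        then show ?thesis using cells_lattice[OF len w(2)] p by (auto simp: F_def)
      qed
      moreover have "length ws = Suc k" using cells_vertex_order[OF w(2)] len by simp
      ultimately show "w \<in> osimplex ` {ws. set ws \<subseteq> F \<and> length ws = Suc k}" using w(1) by blast
    qed
    moreover have fl: "finite {ws. set ws \<subseteq> F \<and> length ws = Suc k}" by (rule finite_lists_length_eq[OF F(1)])
    ultimately have "card {w \<in> cell_set n vs. carrier_of w \<inter> X \<noteq> {}}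
        \<le> card (osimplex ` {ws. set ws \<subseteq> F \<and> length ws = Suc k})"
      by (intro card_mono finite_imageI)
    also have "\<dots> \<le> card F ^ Suc k"
      using card_image_le[OF fl, of osimplex] card_lists_length_eq[OF F(1), of "Suc k"] by simp
    also have "\<dots> \<le> l0 ^ Suc k" using F(2) by (rule power_mono) simp
    finally show ?thesis .
  qed simp
  then show thesis using that by blast
qed

text \<open>\<open>V\<close> picks arbitrary vertex orders for the members of \<open>P\<close>. In
  particular \<open>P\<close> may consist of the simplex itself with a different order, and this
  instance later yields independence of the order.\<close>

lemma sewn_additive:
  assumes \<Xi>: "almost_additive k K \<gamma> E \<Xi>" and k: "0 < k" and \<gamma>: "real k < \<gamma>"
    and vs: "simplex_vertices k vs" "convex hull (set vs) \<subseteq> K"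
    and P: "subdivision N k (osimplex vs) P"
    and V: "\<And>\<tau>. \<tau> \<in> P \<Longrightarrow> \<tau> = osimplex (V \<tau>)" "\<And>\<tau>. \<tau> \<in> P \<Longrightarrow> simplex_vertices k (V \<tau>)"
  shows "sewn \<Xi> vs = (\<Sum>\<tau>\<in>P. sewn \<Xi> (V \<tau>))"
proof -
  have finP: "finite P" by (rule subdivisionD(1)[OF P])
  have \<sigma>: "osimplex vs \<in> simplices k UNIV" "osimplex vs \<in> simplices k K"
    using vs unfolding simplices_def by auto
  have VK: "convex hull (set (V \<tau>)) \<subseteq> convex hull (set vs)" if "\<tau> \<in> P" for \<tau>
  proof -
    have "carrier_of \<tau> \<subseteq> carrier_of (osimplex vs)"
      using subdivisionD(5)[OF P] that by blast
    then show ?thesis unfolding carrier_of_osimplex by (subst (asm) V(1)[OF that]) simp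
  qed
  \<comment> \<open>The members of \<open>P\<close> lie in the simplex, so the same \<open>D\<close>
    bounds the cells of both families.\<close>
  define D where "D = real k * diam N (osimplex vs)"
  define A where "A = (\<lambda>n. cell_set n vs)"
  define B where "B = (\<lambda>n. \<Union>\<tau>\<in>P. cell_set n (V \<tau>))"
  have subV: "subdivision N k \<tau> (cell_set n (V \<tau>))" if "\<tau> \<in> P" for \<tau> n
    using subdivision_cell_set[OF V(2)[OF that] k] unfolding V(1)[OF that, symmetric] .
  have subA: "subdivision N k (osimplex vs) (A n)" for n
    unfolding A_def by (rule subdivision_cell_set[OF vs(1) k])
  have subB: "subdivision N k (osimplex vs) (B n)" for n
    unfolding B_def by (rule subdivision_refine(1)[OF k \<sigma>(1) P subV])
  have diamA: "diam N w \<le> D / 2 ^ n" if "w \<in> A n" for w n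
    using diam_cell_set[OF vs(1)] that by (simp add: A_def D_def)
  have diamB: "diam N w \<le> D / 2 ^ n" if w: "w \<in> B n" for w n
  proof -
    obtain \<tau> where \<tau>: "\<tau> \<in> P" "w \<in> cell_set n (V \<tau>)" using w by (auto simp: B_def)
    have "diam N w \<le> real k * diam N (osimplex (V \<tau>)) / 2 ^ n"
      by (rule diam_cell_set[OF V(2)[OF \<tau>(1)] \<tau>(2)])
    also have "\<dots> \<le> D / 2 ^ n"
      unfolding D_def using diam_mono[OF VK[OF \<tau>(1)]] by (intro divide_right_mono mult_left_mono) auto
    finally show ?thesis .
  qed
  have "\<exists>l. \<forall>n X. (\<forall>x\<in>X. \<forall>y\<in>X. N (x - y) \<le> D / 2 ^ n) \<longrightarrow>
      card {w \<in> cell_set n (V \<tau>). carrier_of w \<inter> X \<noteq> {}} \<le> l" if \<tau>: "\<tau> \<in> P" for \<tau>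
  proof -
    obtain l where l: "\<And>n X. (\<And>x y. x \<in> X \<Longrightarrow> y \<in> X \<Longrightarrow> N (x - y) \<le> D / 2 ^ n) \<Longrightarrow>
      card {w \<in> cell_set n (V \<tau>). carrier_of w \<inter> X \<noteq> {}} \<le> l"
      using card_cells_meeting[OF V(2)[OF \<tau>], of D] by blast
    show ?thesis
    proof (intro exI allI impI)
      fix n X assume "\<forall>x\<in>X. \<forall>y\<in>X. N (x - y) \<le> D / 2 ^ n"
      then show "card {w \<in> cell_set n (V \<tau>). carrier_of w \<inter> X \<noteq> {}} \<le> l"
        by (intro l) simp
    qed
  qed
  then have "\<forall>\<tau>\<in>P. \<exists>l. \<forall>n X. (\<forall>x\<in>X. \<forall>y\<in>X. N (x - y) \<le> D / 2 ^ n) \<longrightarrow>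
      card {w \<in> cell_set n (V \<tau>). carrier_of w \<inter> X \<noteq> {}} \<le> l" by blast
  then obtain l where l: "\<forall>\<tau>\<in>P. \<forall>n X. (\<forall>x\<in>X. \<forall>y\<in>X. N (x - y) \<le> D / 2 ^ n) \<longrightarrow>
      card {w \<in> cell_set n (V \<tau>). carrier_of w \<inter> X \<noteq> {}} \<le> l \<tau>"
    by (rule bchoice[THEN exE])
  \<comment> \<open>A cell of the simplex meets at most \<open>l \<tau>\<close> cells of each member
    \<open>\<tau>\<close>. These bounds depend on \<open>P\<close> but not on \<open>n\<close>,
    which is all that the limit requires.\<close>
  have pairs: "card {(w, w') \<in> A n \<times> B n. carrier_of w \<inter> carrier_of w' \<noteq> {}} \<le> 2 ^ (k * n) * (\<Sum>\<tau>\<in>P. l \<tau>)"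
    for n
  proof -
    define C where "C = (\<lambda>w \<tau>. {w' \<in> cell_set n (V \<tau>). carrier_of w' \<inter> carrier_of w \<noteq> {}})"
    have finC: "finite (C w \<tau>)" for w \<tau> by (simp add: C_def finite_cell_set)
    have cardC: "card (C w \<tau>) \<le> l \<tau>" if w: "w \<in> A n" and \<tau>: "\<tau> \<in> P" for w \<tau>
    proof -
      obtain ws where ws: "w = osimplex ws" using w by (auto simp: A_def cell_set_def)
      have "N (x - y) \<le> D / 2 ^ n" if "x \<in> carrier_of w" "y \<in> carrier_of w" for x y
        using N_diff_le_diam[of x ws y] diamA[OF w] that by (simp add: ws)
      then show ?thesis unfolding C_def using l \<tau> by blast
    qed
    have finA: "finite (A n)" by (simp add: A_def finite_cell_set)
    have "{(w, w') \<in> A n \<times> B n. carrier_of w \<inter> carrier_of w' \<noteq> {}} \<subseteq> (\<Union>w\<in>A n. \<Union>\<tau>\<in>P. Pair w ` C w \<tau>)"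
      by (auto simp: B_def C_def Int_commute)
    then have "card {(w, w') \<in> A n \<times> B n. carrier_of w \<inter> carrier_of w' \<noteq> {}}
        \<le> card (\<Union>w\<in>A n. \<Union>\<tau>\<in>P. Pair w ` C w \<tau>)"
      using finA finP finC by (intro card_mono finite_UN_I finite_imageI) auto
    also have "\<dots> \<le> (\<Sum>w\<in>A n. card (\<Union>\<tau>\<in>P. Pair w ` C w \<tau>))" by (rule card_UN_le[OF finA])
    also have "\<dots> \<le> (\<Sum>w\<in>A n. \<Sum>\<tau>\<in>P. l \<tau>)"
    proof (rule sum_mono)
      fix w assume w: "w \<in> A n"
      have "card (\<Union>\<tau>\<in>P. Pair w ` C w \<tau>) \<le> (\<Sum>\<tau>\<in>P. card (Pair w ` C w \<tau>))" by (rule card_UN_le[OF finP])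
      also have "\<dots> \<le> (\<Sum>\<tau>\<in>P. l \<tau>)"
        by (intro sum_mono order_trans[OF card_image_le[OF finC] cardC[OF w]])
      finally show "card (\<Union>\<tau>\<in>P. Pair w ` C w \<tau>) \<le> (\<Sum>\<tau>\<in>P. l \<tau>)" .
    qed
    also have "\<dots> = 2 ^ (k * n) * (\<Sum>\<tau>\<in>P. l \<tau>)"
      using card_cell_set[OF vs(1) k] by (simp add: A_def)
    finally show ?thesis .
  qed
  define q where "q = 2 powr (real k - \<gamma>)"
  have q: "0 \<le> q" "q < 1" using \<gamma> by (auto simp: q_def powr_less_one)
  define c where "c = 2 * E * 2 ^ (Suc k * Suc k) * real (\<Sum>\<tau>\<in>P. l \<tau>) * D powr \<gamma>"
  have D0: "0 \<le> D" by (simp add: D_def)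
  have diff: "\<bar>cell_sum \<Xi> n vs - (\<Sum>\<tau>\<in>P. cell_sum \<Xi> n (V \<tau>))\<bar> \<le> c * q ^ n" for n
  proof -
    have "(\<Sum>w\<in>B n. \<Xi> w) = (\<Sum>\<tau>\<in>P. cell_sum \<Xi> n (V \<tau>))"
      unfolding B_def cell_sum_def
    proof (intro sum.UNION_disjoint ballI impI finP finite_cell_set)
      show "cell_set n (V \<tau>) \<inter> cell_set n (V \<tau>') = {}" if "\<tau> \<in> P" "\<tau>' \<in> P" "\<tau> \<noteq> \<tau>'" for \<tau> \<tau>'
        by (rule subdivision_refine(2)[OF k \<sigma>(1) P subV that])
    qed
    then have "\<bar>cell_sum \<Xi> n vs - (\<Sum>\<tau>\<in>P. cell_sum \<Xi> n (V \<tau>))\<bar>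
        = \<bar>(\<Sum>w\<in>A n. \<Xi> w) - (\<Sum>w\<in>B n. \<Xi> w)\<bar>" by (simp add: cell_sum_def A_def)
    also have "\<dots> \<le> 2 * E * 2 ^ (Suc k * Suc k) * real (2 ^ (k * n) * (\<Sum>\<tau>\<in>P. l \<tau>)) * (D / 2 ^ n) powr \<gamma>"
      using \<gamma> diamA diamB
      by (intro subdivision_sums_close[OF \<Xi> k _ \<sigma>(2) subA subB _ pairs]) auto
    also have "\<dots> = 2 * E * 2 ^ (Suc k * Suc k) * real (\<Sum>\<tau>\<in>P. l \<tau>) * (2 ^ (k * n) * (D / 2 ^ n) powr \<gamma>)"
      by simp
    also have "\<dots> = c * q ^ n" unfolding powr_cell_scale[OF D0] c_def q_def by simp
    finally show ?thesis .
  qed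
  have "(\<lambda>n. c * q ^ n) \<longlonglongrightarrow> c * 0" using q by (intro tendsto_mult_left LIMSEQ_realpow_zero) auto
  then have lim: "(\<lambda>n. c * q ^ n) \<longlonglongrightarrow> 0" by simp
  define f where "f = (\<lambda>n. cell_sum \<Xi> n vs - (\<Sum>\<tau>\<in>P. cell_sum \<Xi> n (V \<tau>)))"
  have "\<forall>\<^sub>F n in sequentially. norm (f n) \<le> c * q ^ n"
    using diff by (intro always_eventually allI) (simp only: real_norm_def f_def)
  from Lim_null_comparison[OF this lim] have "f \<longlonglongrightarrow> 0" .
  moreover have "f \<longlonglongrightarrow> sewn \<Xi> vs - (\<Sum>\<tau>\<in>P. sewn \<Xi> (V \<tau>))"
    unfolding f_def using VK vs(2)
    by (intro tendsto_diff tendsto_sum cell_sum_limit(1)[OF \<Xi> k \<gamma>] vs V(2)) auto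
  ultimately have "sewn \<Xi> vs - (\<Sum>\<tau>\<in>P. sewn \<Xi> (V \<tau>)) = 0" by (rule LIMSEQ_unique[symmetric])
  then show ?thesis by simp
qed

end

text \<open>The chosen vertex order is immaterial under the hypotheses of
  \<open>sewing_osimplex\<close>; the value 0 off \<open>simplices k K\<close> is what
  \<open>alternating\<close> prescribes.\<close>

definition sewing :: "nat \<Rightarrow> 'a::euclidean_space set \<Rightarrow> ('a osimplex \<Rightarrow> real) \<Rightarrow> 'a osimplex \<Rightarrow> real" where
  "sewing k K \<Xi> \<sigma> = (if \<sigma> \<in> simplices k K then sewn \<Xi> (SOME vs. vs \<in> \<sigma>) else 0)"

section \<open>The sewing map\<close>

lemma opposite_opposite:
  assumes "\<sigma> \<in> simplices k K" "0 < k"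
  shows "opposite (opposite \<sigma>) = \<sigma>"
proof -
  obtain vs where vs: "\<sigma> = osimplex vs" "length vs = Suc k" using assms(1) by (rule simplicesE)
  let ?t = "Transposition.transpose 0 (1::nat)"
  have t: "?t permutes {..<length vs}" using vs assms(2) by (intro permutes_swap_id) auto
  have "opposite (opposite \<sigma>) = osimplex (permute_list ?t (permute_list ?t vs))"
    unfolding vs(1) using vs(2) assms(2) by (subst opposite_osimplex_swap; simp)+
  also have "permute_list ?t (permute_list ?t vs) = permute_list (?t \<circ> ?t) vs"
    by (rule permute_list_compose[OF t, symmetric])
  also have "\<dots> = vs" by simp
  finally show ?thesis by (simp add: vs(1))
qed

lemma carrier_of_opposite:
  assumes "\<sigma> \<in> simplices k K" "0 < k"
  shows "carrier_of (opposite \<sigma>) = carrier_of \<sigma>"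
proof -
  obtain vs vs' where "\<sigma> = osimplex vs" "opposite \<sigma> = osimplex vs'" "set vs' = set vs"
    using opposite_simplices[OF assms] by blast
  then show ?thesis by simp
qed

lemma opposite_in_simplices:
  assumes "\<sigma> \<in> simplices k K" "0 < k"
  shows "opposite \<sigma> \<in> simplices k K"
proof -
  obtain vs' where "opposite \<sigma> = osimplex vs'" "simplex_vertices k vs'"
    using opposite_simplices[OF assms] by blast
  moreover have "carrier_of (opposite \<sigma>) \<subseteq> K"
    using carrier_of_opposite[OF assms] assms(1) by (auto elim!: simplicesE)
  ultimately show ?thesis unfolding simplices_def by auto
qed

text \<open>Reversing both orientations contributes two factors -1 to the determinant.\<close>

lemma same_orientation_opposite:
  assumes "\<sigma> \<in> simplices k K" "\<tau> \<in> simplices k K'" "0 < k" "same_orientation k \<sigma> \<tau>"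
  shows "same_orientation k (opposite \<sigma>) (opposite \<tau>)"
proof -
  obtain vs vs' where vs: "\<sigma> = osimplex vs" "opposite \<sigma> = osimplex vs'" "simplex_vertices k vs"
    "simplex_vertices k vs'" "set vs' = set vs" "frame_det k vs vs' (- 1)"
    using opposite_simplices[OF assms(1,3)] by blast
  obtain ws ws' where ws: "\<tau> = osimplex ws" "opposite \<tau> = osimplex ws'" "simplex_vertices k ws"
    "simplex_vertices k ws'" "set ws' = set ws" "frame_det k ws ws' (- 1)"
    using opposite_simplices[OF assms(2,3)] by blast
  have len: "length vs = Suc k" "length ws = Suc k" "length vs' = Suc k" "length ws' = Suc k"
    using vs ws by (auto simp: simplex_vertices_def)
  obtain x where x: "0 < x" "frame_det k vs ws x" "affine hull (set vs) = affine hull (set ws)"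
    using assms(4) unfolding vs(1) ws(1) same_orientation_iff[OF len(1,2)] by blast
  have "frame_det k vs' vs (1 / - 1)" using vs(6) by (rule frame_det_sym) simp
  from frame_det_trans[OF frame_det_trans[OF this x(2)] ws(6)] have "frame_det k vs' ws' x" by simp
  then show ?thesis
    unfolding vs(2) ws(2) same_orientation_iff[OF len(3,4)] vs(5) ws(5) using x by blast
qed

context arbitrary_norm
begin

lemma diam_eq_if_carrier_eq: "carrier_of \<sigma> = carrier_of \<tau> \<Longrightarrow> diam N \<sigma> = diam N \<tau>"
  by (simp add: diam_def)

lemma subdivision_opposite:
  assumes k: "0 < k" and \<sigma>: "\<sigma> \<in> simplices k UNIV" and P: "subdivision N k \<sigma> P"
  shows "subdivision N k (opposite \<sigma>) (opposite ` P)"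
proof -
  have Pin: "\<tau> \<in> simplices k UNIV" if "\<tau> \<in> P" for \<tau> using subdivisionD(2)[OF P] that by blast
  have c: "carrier_of (opposite \<tau>) = carrier_of \<tau>" if "\<tau> \<in> P" for \<tau>
    by (rule carrier_of_opposite[OF Pin[OF that] k])
  show ?thesis
    unfolding subdivision_def
  proof (intro conjI ballI impI)
    show "finite (opposite ` P)" using subdivisionD(1)[OF P] by simp
    show "opposite ` P \<subseteq> simplices k UNIV" using opposite_in_simplices[OF Pin k] by blast
    show "same_orientation k (opposite \<sigma>) \<tau>" if \<tau>: "\<tau> \<in> opposite ` P" for \<tau>
    proof -
      obtain \<rho> where "\<rho> \<in> P" "\<tau> = opposite \<rho>" using \<tau> by blast
      then show ?thesis
        using same_orientation_opposite[OF \<sigma> Pin k subdivisionD(3)[OF P]] by simp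
    qed
    show "Vol N k (carrier_of \<tau> \<inter> carrier_of \<tau>') = 0"
      if \<tau>: "\<tau> \<in> opposite ` P" "\<tau>' \<in> opposite ` P" "\<tau> \<noteq> \<tau>'" for \<tau> \<tau>'
    proof -
      obtain \<rho> \<rho>' where \<rho>: "\<rho> \<in> P" "\<tau> = opposite \<rho>" "\<rho>' \<in> P" "\<tau>' = opposite \<rho>'" using \<tau> by blast
      then have "\<rho> \<noteq> \<rho>'" using \<tau>(3) by blast
      then show ?thesis using subdivisionD(4)[OF P \<rho>(1,3)] c \<rho> by simp
    qed
    show "\<Union> (carrier_of ` opposite ` P) = carrier_of (opposite \<sigma>)"
      using subdivisionD(5)[OF P] c carrier_of_opposite[OF \<sigma> k] by (simp add: image_image)
  qed
qed

lemma inj_on_opposite: "0 < k \<Longrightarrow> inj_on opposite (simplices k K)"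
  by (rule inj_on_inverseI[where g = opposite]) (rule opposite_opposite)

text \<open>Two vertex orders of one oriented simplex give the same limit: this is additivity over
  the one-element subdivision, with the cells of its only member built from the other order.\<close>

lemma sewing_osimplex:
  assumes \<Xi>: "almost_additive k K \<gamma> E \<Xi>" and k: "0 < k" and \<gamma>: "real k < \<gamma>"
    and vs: "simplex_vertices k vs" "convex hull (set vs) \<subseteq> K"
  shows "sewing k K \<Xi> (osimplex vs) = sewn \<Xi> vs"
proof -
  define ws where "ws = (SOME ws. ws \<in> osimplex vs)"
  have ws: "ws \<in> osimplex vs" unfolding ws_def by (rule someI, rule mem_osimplex_self)
  have in_K: "osimplex vs \<in> simplices k K" using vs unfolding simplices_def by blast
  have self: "subdivision N k (osimplex vs) {osimplex vs}"
    using subdivision_dissect[OF dissect.trivial vs(1) k] by simp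
  have "sewn \<Xi> vs = (\<Sum>\<tau>\<in>{osimplex vs}. sewn \<Xi> ws)"
  proof (rule sewn_additive[OF \<Xi> k \<gamma> vs self])
    show "\<tau> = osimplex ws" if "\<tau> \<in> {osimplex vs}" for \<tau> using that osimplex_cong[OF ws] by simp
    show "simplex_vertices k ws" using simplex_vertices_mem_osimplex[OF ws] vs(1) by blast
  qed
  then show ?thesis using in_K by (simp add: sewing_def ws_def)
qed

lemma sewing_additive:
  assumes \<Xi>: "almost_additive k K \<gamma> E \<Xi>" and k: "0 < k" and \<gamma>: "real k < \<gamma>"
    and \<sigma>: "\<sigma> \<in> simplices k K" and P: "subdivision N k \<sigma> P"
  shows "sewing k K \<Xi> \<sigma> = (\<Sum>\<tau>\<in>P. sewing k K \<Xi> \<tau>)"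
proof -
  obtain vs where vs: "\<sigma> = osimplex vs" "simplex_vertices k vs" "convex hull (set vs) \<subseteq> K"
    using \<sigma> by (blast elim: simplicesE)
  have "\<forall>\<tau>\<in>P. \<exists>ws. \<tau> = osimplex ws \<and> simplex_vertices k ws \<and> convex hull (set ws) \<subseteq> K"
    using subdivision_simplices[OF \<sigma> P] by (auto simp: simplices_def)
  then obtain V where V': "\<forall>\<tau>\<in>P. \<tau> = osimplex (V \<tau>) \<and> simplex_vertices k (V \<tau>) \<and> convex hull (set (V \<tau>)) \<subseteq> K"
    by (rule bchoice[THEN exE])
  then have V: "\<tau> = osimplex (V \<tau>)" "simplex_vertices k (V \<tau>)" "convex hull (set (V \<tau>)) \<subseteq> K"
    if "\<tau> \<in> P" for \<tau> using that by blast+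
  have "sewing k K \<Xi> \<sigma> = sewn \<Xi> vs"
    unfolding vs(1) by (rule sewing_osimplex[OF \<Xi> k \<gamma> vs(2,3)])
  also have "\<dots> = (\<Sum>\<tau>\<in>P. sewn \<Xi> (V \<tau>))"
    by (rule sewn_additive[OF \<Xi> k \<gamma> vs(2,3) P[unfolded vs(1)] V(1,2)])
  also have "\<dots> = (\<Sum>\<tau>\<in>P. sewing k K \<Xi> \<tau>)"
  proof (rule sum.cong[OF refl])
    fix \<tau> assume "\<tau> \<in> P"
    from sewing_osimplex[OF \<Xi> k \<gamma> V(2,3)[OF this]] V(1)[OF this]
    show "sewn \<Xi> (V \<tau>) = sewing k K \<Xi> \<tau>" by metis
  qed
  finally show ?thesis .
qed

lemma sewing_close:
  assumes \<Xi>: "almost_additive k K \<gamma> E \<Xi>" and k: "0 < k" and \<gamma>: "real k < \<gamma>"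
    and \<sigma>: "\<sigma> \<in> simplices k K"
  shows "\<bar>sewing k K \<Xi> \<sigma> - \<Xi> \<sigma>\<bar> \<le> sewing_const k \<gamma> * E * diam N \<sigma> powr \<gamma>"
proof -
  obtain vs where vs: "\<sigma> = osimplex vs" "simplex_vertices k vs" "convex hull (set vs) \<subseteq> K"
    using \<sigma> by (blast elim: simplicesE)
  show ?thesis
    unfolding vs(1) sewing_osimplex[OF \<Xi> k \<gamma> vs(2,3)] by (rule cell_sum_limit(2)[OF \<Xi> k \<gamma> vs(2,3)])
qed

text \<open>Every simplex has a regular sequence of subdivisions; without one, the limit formula
  would not determine the sewing map.\<close>

lemma regular_cell_sets:
  assumes vs: "simplex_vertices k vs" and k: "0 < k"
  shows "regular_subdivisions N k (osimplex vs) (\<lambda>n. cell_set n vs)"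
  unfolding regular_subdivisions_def
proof (intro conjI allI impI)
  show "subdivision N k (osimplex vs) (cell_set n vs)" for n by (rule subdivision_cell_set[OF vs k])
  fix \<beta> :: real assume \<beta>: "real k < \<beta>"
  define D where "D = real k * diam N (osimplex vs)"
  define q where "q = 2 powr (real k - \<beta>)"
  have q: "0 \<le> q" "q < 1" using \<beta> by (auto simp: q_def powr_less_one)
  have D0: "0 \<le> D" by (simp add: D_def)
  have le: "(\<Sum>w\<in>cell_set n vs. diam N w powr \<beta>) \<le> D powr \<beta> * q ^ n" for n
  proof -
    have "(\<Sum>w\<in>cell_set n vs. diam N w powr \<beta>) \<le> (\<Sum>w\<in>cell_set n vs. (D / 2 ^ n) powr \<beta>)"
      using \<beta> diam_cell_set[OF vs] unfolding D_def by (intro sum_mono powr_mono2) auto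
    also have "\<dots> = 2 ^ (k * n) * (D / 2 ^ n) powr \<beta>" by (simp add: card_cell_set[OF vs k])
    also have "\<dots> = D powr \<beta> * q ^ n" unfolding q_def by (rule powr_cell_scale[OF D0])
    finally show ?thesis .
  qed
  have "(\<lambda>n. D powr \<beta> * q ^ n) \<longlonglongrightarrow> D powr \<beta> * 0"
    using q by (intro tendsto_mult_left LIMSEQ_realpow_zero) auto
  then have lim: "(\<lambda>n. D powr \<beta> * q ^ n) \<longlonglongrightarrow> 0" by simp
  show "(\<lambda>n. \<Sum>w\<in>cell_set n vs. diam N w powr \<beta>) \<longlonglongrightarrow> 0"
  proof (rule tendsto_sandwich[OF _ _ tendsto_const lim])
    show "\<forall>\<^sub>F n in sequentially. 0 \<le> (\<Sum>w\<in>cell_set n vs. diam N w powr \<beta>)"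
      by (intro always_eventually allI sum_nonneg) simp
    show "\<forall>\<^sub>F n in sequentially. (\<Sum>w\<in>cell_set n vs. diam N w powr \<beta>) \<le> D powr \<beta> * q ^ n"
      by (intro always_eventually allI le)
  qed
qed

text \<open>The error of the sum along \<open>P n\<close> is at most \<open>c\<close> times the sum
  of the \<gamma>-th powers of the diameters, and regularity with exponent \<gamma> > k sends this
  to zero. Nothing is assumed on how \<open>J\<close> arises, so this serves for any competitor of
  the sewing map.\<close>

lemma regular_limit:
  assumes \<gamma>: "real k < \<gamma>" and \<sigma>: "\<sigma> \<in> simplices k K" and P: "regular_subdivisions N k \<sigma> P"
    and add: "\<And>Q. subdivision N k \<sigma> Q \<Longrightarrow> J \<sigma> = (\<Sum>\<tau>\<in>Q. J \<tau>)"
    and close: "\<And>\<tau>. \<tau> \<in> simplices_le1 N k K \<Longrightarrow> \<bar>J \<tau> - \<Xi> \<tau>\<bar> \<le> c * diam N \<tau> powr \<gamma>"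
  shows "(\<lambda>n. \<Sum>\<tau>\<in>P n. \<Xi> \<tau>) \<longlonglongrightarrow> J \<sigma>"
proof -
  define s where "s = (\<lambda>n. \<Sum>w\<in>P n. diam N w powr \<gamma>)"
  have sub: "subdivision N k \<sigma> (P n)" for n using P by (simp add: regular_subdivisions_def)
  have s0: "s \<longlonglongrightarrow> 0" using P \<gamma> unfolding regular_subdivisions_def s_def by blast
  \<comment> \<open>Once this sum is below 1, no member of \<open>P n\<close> has diameter above 1,
    so the bound for small simplices applies even if \<open>\<sigma>\<close> itself is
    large.\<close>
  have lt1: "\<forall>\<^sub>F n in sequentially. s n < 1" by (rule order_tendstoD(2)[OF s0]) simp
  then have ev: "\<forall>\<^sub>F n in sequentially. norm ((\<Sum>\<tau>\<in>P n. \<Xi> \<tau>) - J \<sigma>) \<le> c * s n"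
  proof eventually_elim
    case (elim n)
    have small: "diam N \<tau> \<le> 1" if \<tau>: "\<tau> \<in> P n" for \<tau>
    proof (rule ccontr)
      assume "\<not> diam N \<tau> \<le> 1"
      then have "1 \<le> diam N \<tau> powr \<gamma>" using \<gamma> by (intro ge_one_powr_ge_zero) auto
      also have "\<dots> \<le> s n"
        unfolding s_def using subdivisionD(1)[OF sub] \<tau> by (intro member_le_sum) auto
      finally show False using elim by simp
    qed
    have "norm ((\<Sum>\<tau>\<in>P n. \<Xi> \<tau>) - J \<sigma>) = \<bar>\<Sum>\<tau>\<in>P n. J \<tau> - \<Xi> \<tau>\<bar>"
      unfolding add[OF sub[of n]] by (simp add: sum_subtractf abs_minus_commute)
    also have "\<dots> \<le> (\<Sum>\<tau>\<in>P n. \<bar>J \<tau> - \<Xi> \<tau>\<bar>)" by (rule sum_abs)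
    also have "\<dots> \<le> (\<Sum>\<tau>\<in>P n. c * diam N \<tau> powr \<gamma>)"
    proof (intro sum_mono close)
      fix \<tau> assume "\<tau> \<in> P n"
      then show "\<tau> \<in> simplices_le1 N k K"
        using small subdivision_simplices[OF \<sigma> sub] by (simp add: simplices_le1_def)
    qed
    also have "\<dots> = c * s n" by (simp add: s_def sum_distrib_left)
    finally show ?case .
  qed
  have "(\<lambda>n. c * s n) \<longlonglongrightarrow> 0" using tendsto_mult_left[OF s0, of c] by simp
  from Lim_null_comparison[OF ev this] show ?thesis by (rule LIM_zero_cancel)
qed

text \<open>The cells of the opposite simplex need not be the opposites of the cells, since the
  vertex order differs. But the opposites of the cells form a regular sequence for the opposite
  simplex, and \<open>regular_limit\<close> applies to both.\<close>

lemma sewing_opposite: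
  assumes \<Xi>: "almost_additive k K \<gamma> E \<Xi>" and k: "0 < k" and \<gamma>: "real k < \<gamma>"
    and alt: "alternating k K \<Xi>" and \<sigma>: "\<sigma> \<in> simplices k K"
  shows "sewing k K \<Xi> (opposite \<sigma>) = - sewing k K \<Xi> \<sigma>"
proof -
  obtain vs where vs: "\<sigma> = osimplex vs" "simplex_vertices k vs" using \<sigma> by (blast elim: simplicesE)
  define P where "P = (\<lambda>n. cell_set n vs)"
  have reg: "regular_subdivisions N k \<sigma> P" unfolding vs(1) P_def by (rule regular_cell_sets[OF vs(2) k])
  then have sub: "subdivision N k \<sigma> (P n)" for n by (simp add: regular_subdivisions_def)
  have PK: "P n \<subseteq> simplices k K" for n using subdivision_simplices[OF \<sigma> sub] by blast
  have inj: "inj_on opposite (P n)" for n by (rule inj_on_subset[OF inj_on_opposite[OF k] PK])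
  have \<sigma>U: "\<sigma> \<in> simplices k UNIV" using vs unfolding simplices_def by blast
  have "(\<Sum>w\<in>opposite ` P n. diam N w powr \<beta>) = (\<Sum>w\<in>P n. diam N w powr \<beta>)" for n \<beta>
  proof -
    have "diam N (opposite w) = diam N w" if "w \<in> P n" for w
      using carrier_of_opposite[OF subsetD[OF PK that] k] by (rule diam_eq_if_carrier_eq)
    then show ?thesis by (simp add: sum.reindex[OF inj])
  qed
  then have reg': "regular_subdivisions N k (opposite \<sigma>) (\<lambda>n. opposite ` P n)"
    using reg subdivision_opposite[OF k \<sigma>U sub] unfolding regular_subdivisions_def by simp
  have "(\<lambda>n. \<Sum>w\<in>P n. \<Xi> w) \<longlonglongrightarrow> sewing k K \<Xi> \<sigma>"
    by (rule regular_limit[OF \<gamma> \<sigma> reg sewing_additive[OF \<Xi> k \<gamma> \<sigma>]])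
      (auto simp: simplices_le1_def intro: sewing_close[OF \<Xi> k \<gamma>])
  then have "(\<lambda>n. - (\<Sum>w\<in>P n. \<Xi> w)) \<longlonglongrightarrow> - sewing k K \<Xi> \<sigma>" by (rule tendsto_minus)
  moreover have "(\<Sum>w\<in>opposite ` P n. \<Xi> w) = - (\<Sum>w\<in>P n. \<Xi> w)" for n
  proof -
    have "\<Xi> (opposite w) = - \<Xi> w" if "w \<in> P n" for w
      using alt subsetD[OF PK that] by (simp add: alternating_def)
    then show ?thesis by (simp add: sum.reindex[OF inj] sum_negf)
  qed
  moreover have "(\<lambda>n. \<Sum>w\<in>opposite ` P n. \<Xi> w) \<longlonglongrightarrow> sewing k K \<Xi> (opposite \<sigma>)"
    by (rule regular_limit[OF \<gamma> opposite_in_simplices[OF \<sigma> k] reg'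
          sewing_additive[OF \<Xi> k \<gamma> opposite_in_simplices[OF \<sigma> k]]])
      (auto simp: simplices_le1_def intro: sewing_close[OF \<Xi> k \<gamma>])
  ultimately show ?thesis by (simp add: LIMSEQ_unique)
qed

lemma sewing_in_additive_cochains:
  assumes \<Xi>: "almost_additive k K \<gamma> E \<Xi>" and k: "0 < k" and \<gamma>: "real k < \<gamma>"
    and alt: "alternating k K \<Xi>"
  shows "sewing k K \<Xi> \<in> additive_cochains N k K"
  unfolding additive_cochains_def alternating_def
  using sewing_opposite[OF \<Xi> k \<gamma> alt] sewing_additive[OF \<Xi> k \<gamma>] by (auto simp: sewing_def)

end

text \<open>Bisection commutes with the evaluation of lists of functions. This reduces the measurability
  of the sums over cells to that of midpoints.\<close>

lemma halve_parametric:
  fixes gs :: "('v \<Rightarrow> 'a::real_vector) list"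
  assumes mid: "\<And>g h. Q g \<Longrightarrow> Q h \<Longrightarrow> Q (\<lambda>v. midpoint (g v) (h v))"
  shows "vertex_order gs (us @ zs) \<Longrightarrow> (\<forall>g\<in>set gs. Q g) \<Longrightarrow>
    \<exists>F. (\<forall>v. halve (map (\<lambda>g. g v) gs) us zs = map (\<lambda>(c, os). (map (\<lambda>g. g v) c, os)) F) \<and>
      (\<forall>(c, os)\<in>set F. \<forall>g\<in>set c. Q g)"
proof (induction "length us" arbitrary: gs us zs rule: less_induct)
  case less
  consider "us = []" | u where "us = [u]" | u u' us' where "us = u # u' # us'"
    by (metis list.exhaust)
  then show ?case
  proof cases
    case 1
    then show ?thesis using less.prems by (intro exI[of _ "[(gs, zs)]"]) auto
  next
    case 2
    then show ?thesis using less.prems by (intro exI[of _ "[(gs, us @ zs)]"]) auto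
  next
    case 3
    define w where "w = last (u' # us')"
    define m where "m = (\<lambda>v. midpoint ((gs ! u) v) ((gs ! w) v))"
    have vo: "vertex_order gs ((u # u' # us') @ zs)" using less.prems 3 by simp
    note step = vertex_order_step[OF vo w_def]
    have Qm: "Q m" unfolding m_def using less.prems(2) step(1,2) by (intro mid) auto
    have Qi: "\<forall>g\<in>set (gs[i := m]). Q g" for i
      using less.prems(2) Qm set_update_subset_insert[of gs i m] by blast
    have l: "length (u # butlast (u' # us')) < length us" "length (u' # us') < length us"
      using 3 by simp_all
    obtain F where F: "\<And>v. halve (map (\<lambda>g. g v) (gs[w := m])) (u # butlast (u' # us')) (w # zs)
        = map (\<lambda>(c, os). (map (\<lambda>g. g v) c, os)) F" "\<forall>(c, os)\<in>set F. \<forall>g\<in>set c. Q g"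
      using less.hyps[OF l(1) step(8) Qi] by blast
    obtain G where G: "\<And>v. halve (map (\<lambda>g. g v) (gs[u := m])) (u' # us') (u # zs)
        = map (\<lambda>(c, os). (map (\<lambda>g. g v) c, os)) G" "\<forall>(c, os)\<in>set G. \<forall>g\<in>set c. Q g"
      using less.hyps[OF l(2) step(9) Qi] by blast
    have "halve (map (\<lambda>g. g v) gs) us zs = map (\<lambda>(c, os). (map (\<lambda>g. g v) c, os)) (F @ G)" for v
    proof -
      have "midpoint (map (\<lambda>g. g v) gs ! u) (map (\<lambda>g. g v) gs ! w) = m v"
        using step(1,2) by (simp add: m_def)
      then show ?thesis
        unfolding 3 halve.simps Let_def w_def[symmetric] map_append F(1)[symmetric] G(1)[symmetric]
        by (simp add: map_update del: butlast.simps)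
    qed
    moreover have "\<forall>(c, os)\<in>set (F @ G). \<forall>g\<in>set c. Q g" using F(2) G(2) by auto
    ultimately show ?thesis by blast
  qed
qed

text \<open>Which edges are bisected is decided by indices alone. One list \<open>F\<close> of
  vertex functions therefore describes the cells for all parameters \<open>v\<close> at
  once.\<close>

lemma cells_parametric:
  fixes gs :: "('v \<Rightarrow> 'a::real_vector) list"
  assumes mid: "\<And>g h. Q g \<Longrightarrow> Q h \<Longrightarrow> Q (\<lambda>v. midpoint (g v) (h v))"
    and gs: "\<forall>g\<in>set gs. Q g"
  shows "\<exists>F. (\<forall>v. cells n (map (\<lambda>g. g v) gs) = map (\<lambda>(c, os). (map (\<lambda>g. g v) c, os)) F) \<and>
      (\<forall>(c, os)\<in>set F. \<forall>g\<in>set c. Q g)"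
proof (induction n)
  case 0
  then show ?case using gs by (intro exI[of _ "[(gs, [0..<length gs])]"]) auto
next
  case (Suc n)
  then obtain F where F: "\<And>v. cells n (map (\<lambda>g. g v) gs) = map (\<lambda>(c, os). (map (\<lambda>g. g v) c, os)) F"
    "\<forall>(c, os)\<in>set F. \<forall>g\<in>set c. Q g" by blast
  have "\<forall>x\<in>set F. \<exists>G. (\<forall>v. halve (map (\<lambda>g. g v) (fst x)) (snd x) []
      = map (\<lambda>(c, os). (map (\<lambda>g. g v) c, os)) G) \<and> (\<forall>(c, os)\<in>set G. \<forall>g\<in>set c. Q g)"
  proof
    fix x assume x: "x \<in> set F"
    \<comment> \<open>The order conditions concern indices and lengths only, so they can be read off
      at any one parameter.\<close>
    fix v0 :: 'v
    have "(map (\<lambda>g. g v0) (fst x), snd x) \<in> set (cells n (map (\<lambda>g. g v0) gs))"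
      unfolding F(1) using x by force
    from cells_vertex_order[OF this] have "vertex_order (fst x) (snd x @ [])"
      by (simp add: vertex_order_def)
    moreover have "\<forall>g\<in>set (fst x). Q g" using F(2) x by auto
    ultimately show "\<exists>G. (\<forall>v. halve (map (\<lambda>g. g v) (fst x)) (snd x) []
      = map (\<lambda>(c, os). (map (\<lambda>g. g v) c, os)) G) \<and> (\<forall>(c, os)\<in>set G. \<forall>g\<in>set c. Q g)"
      by (rule halve_parametric[where Q = Q, rotated]) (intro mid)
  qed
  then obtain H where H: "\<forall>x\<in>set F. (\<forall>v. halve (map (\<lambda>g. g v) (fst x)) (snd x) []
      = map (\<lambda>(c, os). (map (\<lambda>g. g v) c, os)) (H x)) \<and> (\<forall>(c, os)\<in>set (H x). \<forall>g\<in>set c. Q g)"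
    by (rule bchoice[THEN exE])
  have "cells (Suc n) (map (\<lambda>g. g v) gs) = map (\<lambda>(c, os). (map (\<lambda>g. g v) c, os)) (concat (map H F))" for v
  proof -
    have "map ((\<lambda>(ws, us). halve ws us []) \<circ> (\<lambda>(c, os). (map (\<lambda>g. g v) c, os))) F
      = map (map (\<lambda>(c, os). (map (\<lambda>g. g v) c, os)) \<circ> H) F"
      using H by (intro map_cong) (auto simp: split_def)
    then show ?thesis by (simp only: cells.simps F(1) map_map map_concat)
  qed
  moreover have "\<forall>(c, os)\<in>set (concat (map H F)). \<forall>g\<in>set c. Q g" using H by fastforce
  ultimately show ?case by blast
qed

lemma borel_measurable_midpoint:
  fixes g h :: "'v \<Rightarrow> 'a::euclidean_space"
  assumes "g \<in> borel_measurable M" "h \<in> borel_measurable M"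
  shows "(\<lambda>v. midpoint (g v) (h v)) \<in> borel_measurable M"
  unfolding midpoint_def using assms by (intro borel_measurable_scaleR borel_measurable_add) auto

text \<open>Every cell sum is a finite sum of \<open>\<Xi>\<close> composed with measurable maps of
  vertex tuples, and a pointwise limit of measurable functions is measurable.\<close>

lemma (in arbitrary_norm) measurable_cochain_sewing:
  assumes \<Xi>: "almost_additive k K \<gamma> E \<Xi>" and k: "0 < k" and \<gamma>: "real k < \<gamma>"
    and meas: "measurable_cochain k K \<Xi>"
  shows "measurable_cochain k K (sewing k K \<Xi>)"
proof -
  define S where "S = {v :: nat \<Rightarrow> 'a. simplex_vertices k (map v [0..<Suc k]) \<and> convex hull (v ` {..k}) \<subseteq> K}"
  define M where "M = restrict_space (Pi\<^sub>M {..k} (\<lambda>_. borel :: 'a measure)) S"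
  define vl where "vl = (\<lambda>v :: nat \<Rightarrow> 'a. map v [0..<Suc k])"
  have set_vl: "set (vl v) = v ` {..k}" for v
    by (simp add: vl_def atLeast0AtMost atLeastLessThanSuc_atLeastAtMost del: upt_Suc)
  have spM: "simplex_vertices k (vl v)" "convex hull (set (vl v)) \<subseteq> K" if "v \<in> space M" for v
    using that set_vl[of v] by (auto simp: M_def S_def vl_def space_restrict_space)
  have \<Xi>M: "(\<lambda>v. \<Xi> (osimplex (vl v))) \<in> borel_measurable M"
    using meas by (simp add: measurable_cochain_def M_def S_def vl_def)
  define gs where "gs = map (\<lambda>i (v :: nat \<Rightarrow> 'a). v i) [0..<Suc k]"
  have ev: "map (\<lambda>g. g v) gs = vl v" for v by (simp add: gs_def vl_def)
  have Qgs: "\<forall>g\<in>set gs. g \<in> borel_measurable M"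
  proof
    fix g assume "g \<in> set gs"
    then obtain i where "i \<in> set [0..<Suc k]" "g = (\<lambda>v. v i)"
      unfolding gs_def set_map by (rule imageE)
    then have i: "i \<le> k" "g = (\<lambda>v. v i)" by auto
    show "g \<in> borel_measurable M"
      unfolding i(2) M_def using i(1) by (intro measurable_restrict_space1 measurable_component_singleton) simp
  qed
  have sums: "(\<lambda>v. cell_sum \<Xi> n (vl v)) \<in> borel_measurable M" for n
  proof -
    obtain F where F: "\<And>v. cells n (vl v) = map (\<lambda>(c, os). (map (\<lambda>g. g v) c, os)) F"
      "\<forall>(c, os)\<in>set F. \<forall>g\<in>set c. g \<in> borel_measurable M"
      using cells_parametric[of "\<lambda>g. g \<in> borel_measurable M" gs n] Qgs borel_measurable_midpoint
      unfolding ev by blast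
    have one: "(\<lambda>v. \<Xi> (osimplex (map (\<lambda>g. g v) (fst x)))) \<in> borel_measurable M" if x: "x \<in> set F" for x
    proof -
      \<comment> \<open>Sends the vertices of the simplex to those of one fixed cell. It is cut off
        outside \<open>{..k}\<close> to stay in the extensional product, and it must be shown to
        land in \<open>S\<close>, where \<open>\<Xi>\<close> is known to be measurable.\<close>
      define h where "h = (\<lambda>v. \<lambda>i\<in>{..k}. (fst x ! i) v)"
      have cell: "(map (\<lambda>g. g v) (fst x), snd x) \<in> set (cells n (vl v))" for v
        unfolding F(1) using x by force
      have len: "length (fst x) = Suc k"
        using cells_vertex_order[OF cell[of undefined]] by (simp add: vl_def)
      have vlh: "vl (h v) = map (\<lambda>g. g v) (fst x)" for v
        by (rule nth_equalityI) (auto simp: vl_def h_def len simp del: upt_Suc)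
      have "h \<in> M \<rightarrow>\<^sub>M restrict_space (Pi\<^sub>M {..k} (\<lambda>_. borel)) S"
      proof (rule measurable_restrict_space2)
        show "h \<in> space M \<rightarrow> S"
        proof
          fix v assume v: "v \<in> space M"
          have c: "map (\<lambda>g. g v) (fst x) \<in> set (map fst (cells n (vl v)))"
            using imageI[OF cell[of v], of fst] by simp
          have "simplex_vertices k (vl (h v))"
            unfolding vlh by (rule dissect_simplex_vertices[OF cells_dissect c spM(1)[OF v]])
          moreover have "convex hull (set (vl (h v))) \<subseteq> K"
            unfolding vlh using dissect_hull[OF cells_dissect[of "vl v" n]] c spM(2)[OF v] by blast
          ultimately show "h v \<in> S" unfolding S_def set_vl by (simp add: vl_def)
        qed
        show "h \<in> M \<rightarrow>\<^sub>M Pi\<^sub>M {..k} (\<lambda>_. borel)"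
          unfolding h_def using F(2) x len by (intro measurable_restrict) auto
      qed
      from measurable_compose[OF this \<Xi>M[unfolded M_def]] show ?thesis by (simp add: vlh)
    qed
    \<comment> \<open>The set of cells varies with \<open>v\<close>, but on the space of
      \<open>M\<close>, where cells are distinct, its sum equals one with a fixed index
      range.\<close>
    have "cell_sum \<Xi> n (vl v) = (\<Sum>i<length F. \<Xi> (osimplex (map (\<lambda>g. g v) (fst (F ! i)))))" if "v \<in> space M" for v
    proof -
      have "cell_sum \<Xi> n (vl v) = (\<Sum>x\<leftarrow>F. \<Xi> (osimplex (map (\<lambda>g. g v) (fst x))))"
        unfolding cell_sum_def sum_cell_set[OF spM(1)[OF that] k] F(1) by (simp add: comp_def split_def)
      then show ?thesis by (simp add: sum_list_sum_nth lessThan_atLeast0)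
    qed
    moreover have "(\<lambda>v. \<Sum>i<length F. \<Xi> (osimplex (map (\<lambda>g. g v) (fst (F ! i))))) \<in> borel_measurable M"
      by (intro borel_measurable_sum one) simp
    ultimately show ?thesis by (subst measurable_cong) auto
  qed
  have "(\<lambda>v. sewn \<Xi> (vl v)) \<in> borel_measurable M"
    by (rule borel_measurable_LIMSEQ_real[OF cell_sum_limit(1)[OF \<Xi> k \<gamma> spM] sums])
  moreover have "sewing k K \<Xi> (osimplex (vl v)) = sewn \<Xi> (vl v)" if "v \<in> space M" for v
    by (rule sewing_osimplex[OF \<Xi> k \<gamma> spM[OF that]])
  ultimately have "(\<lambda>v. sewing k K \<Xi> (osimplex (vl v))) \<in> borel_measurable M"
    by (subst measurable_cong) auto
  then show ?thesis by (simp add: measurable_cochain_def M_def S_def vl_def)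
qed

section \<open>The seminorms and the sewing theorem\<close>

context arbitrary_norm
begin

lemma simplices_diam_pos:
  assumes "\<sigma> \<in> simplices k K" "0 < k"
  shows "0 < diam N \<sigma>"
  using assms diam_pos by (auto elim!: simplicesE)

lemma subdivision_card_pos:
  assumes "\<sigma> \<in> simplices k K" "subdivision N k \<sigma> P"
  shows "0 < card P"
proof -
  obtain vs where "\<sigma> = osimplex vs" "length vs = Suc k" using assms(1) by (rule simplicesE)
  then have "carrier_of \<sigma> \<noteq> {}" by auto
  then have "P \<noteq> {}" using subdivisionD(5)[OF assms(2)] by auto
  then show ?thesis using subdivisionD(1)[OF assms(2)] by (simp add: card_gt_0_iff)
qed

lemma C2_finite:
  assumes "\<Xi> \<in> C2 N k K \<eta> \<gamma>"
  shows "seminorm_eta N k K \<eta> \<Xi> < \<infinity>" "seminorm_delta N k K \<gamma> \<Xi> < \<infinity>"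
  using assms by (auto simp: C2_def seminorm_eta_gamma_def)

text \<open>For \<open>0 < k\<close> simplices have positive diameter and subdivisions are nonempty,
  so the denominators in \<open>seminorm_delta\<close> are positive and can be cleared; a zero
  denominator would make the quotient 0 and the bound void.\<close>

lemma C2_almost_additive:
  assumes \<Xi>: "\<Xi> \<in> C2 N k K \<eta> \<gamma>" and k: "0 < k"
  shows "almost_additive k K \<gamma> (enn2real (seminorm_delta N k K \<gamma> \<Xi>)) \<Xi>"
  unfolding almost_additive_def
proof (intro conjI ballI allI impI)
  define E where "E = enn2real (seminorm_delta N k K \<gamma> \<Xi>)"
  fix \<sigma> P assume \<sigma>: "\<sigma> \<in> simplices k K" and P: "subdivision N k \<sigma> P"
  define d where "d = real (card P) * diam N \<sigma> powr \<gamma>"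
  have d: "0 < d"
    using subdivision_card_pos[OF \<sigma> P] simplices_diam_pos[OF \<sigma> k] by (simp add: d_def)
  have "ennreal (\<bar>\<Xi> \<sigma> - (\<Sum>\<tau>\<in>P. \<Xi> \<tau>)\<bar> / d) \<le> seminorm_delta N k K \<gamma> \<Xi>"
    unfolding seminorm_delta_def d_def using \<sigma> P by (intro SUP_upper2[OF \<sigma>] SUP_upper) simp
  also have "\<dots> = ennreal E" using C2_finite(2)[OF \<Xi>] by (simp add: E_def)
  finally have "\<bar>\<Xi> \<sigma> - (\<Sum>\<tau>\<in>P. \<Xi> \<tau>)\<bar> / d \<le> E" by (simp add: E_def)
  then show "\<bar>\<Xi> \<sigma> - (\<Sum>\<tau>\<in>P. \<Xi> \<tau>)\<bar> \<le> E * real (card P) * diam N \<sigma> powr \<gamma>"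
    using d by (simp add: pos_divide_le_eq d_def mult.assoc)
qed simp

lemma C2_eta_bound:
  assumes \<Xi>: "\<Xi> \<in> C2 N k K \<eta> \<gamma>" and k: "0 < k" and \<sigma>: "\<sigma> \<in> simplices k K"
  shows "\<bar>\<Xi> \<sigma>\<bar> \<le> enn2real (seminorm_eta N k K \<eta> \<Xi>) * diam N \<sigma> powr \<eta>"
proof -
  define H where "H = enn2real (seminorm_eta N k K \<eta> \<Xi>)"
  have "ennreal (\<bar>\<Xi> \<sigma>\<bar> / diam N \<sigma> powr \<eta>) \<le> seminorm_eta N k K \<eta> \<Xi>"
    unfolding seminorm_eta_def using \<sigma> by (intro SUP_upper)
  also have "\<dots> = ennreal H" using C2_finite(1)[OF \<Xi>] by (simp add: H_def)
  finally have "\<bar>\<Xi> \<sigma>\<bar> / diam N \<sigma> powr \<eta> \<le> H" by (simp add: H_def)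
  then show ?thesis using simplices_diam_pos[OF \<sigma> k] by (simp add: pos_divide_le_eq H_def)
qed

lemma ennreal_ratio_add_le:
  assumes "0 \<le> d" "\<bar>c\<bar> \<le> \<bar>a\<bar> + \<bar>b\<bar>"
  shows "ennreal (\<bar>c\<bar> / d) \<le> ennreal (\<bar>a\<bar> / d) + ennreal (\<bar>b\<bar> / d)"
proof -
  have "\<bar>c\<bar> / d \<le> \<bar>a\<bar> / d + \<bar>b\<bar> / d"
    unfolding add_divide_distrib[symmetric] using assms by (intro divide_right_mono) auto
  then show ?thesis using assms(1) by (simp flip: ennreal_plus)
qed

lemma C2_add:
  assumes "f \<in> C2 N k K \<eta> \<gamma>" "g \<in> C2 N k K \<eta> \<gamma>"
  shows "(\<lambda>\<sigma>. f \<sigma> + g \<sigma>) \<in> C2 N k K \<eta> \<gamma>"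
proof -
  have "seminorm_eta N k K \<eta> (\<lambda>\<sigma>. f \<sigma> + g \<sigma>) \<le> seminorm_eta N k K \<eta> f + seminorm_eta N k K \<eta> g"
    unfolding seminorm_eta_def[of N k K \<eta> "\<lambda>\<sigma>. f \<sigma> + g \<sigma>"]
  proof (intro SUP_least)
    fix \<sigma> assume \<sigma>: "\<sigma> \<in> simplices k K"
    have up: "ennreal (\<bar>h \<sigma>\<bar> / diam N \<sigma> powr \<eta>) \<le> seminorm_eta N k K \<eta> h" for h
      unfolding seminorm_eta_def by (intro SUP_upper \<sigma>)
    show "ennreal (\<bar>f \<sigma> + g \<sigma>\<bar> / diam N \<sigma> powr \<eta>)
        \<le> seminorm_eta N k K \<eta> f + seminorm_eta N k K \<eta> g"
      by (rule order_trans[OF ennreal_ratio_add_le add_mono[OF up[of f] up[of g]]]) auto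
  qed
  also have "\<dots> < \<infinity>" using C2_finite(1)[OF assms(1)] C2_finite(1)[OF assms(2)] by simp
  finally have eta: "seminorm_eta N k K \<eta> (\<lambda>\<sigma>. f \<sigma> + g \<sigma>) < \<infinity>" .
  have "seminorm_delta N k K \<gamma> (\<lambda>\<sigma>. f \<sigma> + g \<sigma>) \<le> seminorm_delta N k K \<gamma> f + seminorm_delta N k K \<gamma> g"
    unfolding seminorm_delta_def[of N k K \<gamma> "\<lambda>\<sigma>. f \<sigma> + g \<sigma>"]
  proof (intro SUP_least)
    fix \<sigma> P assume \<sigma>: "\<sigma> \<in> simplices k K" and P: "P \<in> {P. subdivision N k \<sigma> P}"
    have up: "ennreal (\<bar>h \<sigma> - (\<Sum>\<sigma>'\<in>P. h \<sigma>')\<bar> / (real (card P) * diam N \<sigma> powr \<gamma>)) \<le> seminorm_delta N k K \<gamma> h" for h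
      unfolding seminorm_delta_def by (intro SUP_upper2[OF \<sigma>] SUP_upper P)
    show "ennreal (\<bar>f \<sigma> + g \<sigma> - (\<Sum>\<sigma>'\<in>P. f \<sigma>' + g \<sigma>')\<bar> / (real (card P) * diam N \<sigma> powr \<gamma>))
        \<le> seminorm_delta N k K \<gamma> f + seminorm_delta N k K \<gamma> g"
      by (rule order_trans[OF ennreal_ratio_add_le add_mono[OF up[of f] up[of g]]])
        (auto simp: sum.distrib)
  qed
  also have "\<dots> < \<infinity>" using C2_finite(2)[OF assms(1)] C2_finite(2)[OF assms(2)] by simp
  finally have "seminorm_delta N k K \<gamma> (\<lambda>\<sigma>. f \<sigma> + g \<sigma>) < \<infinity>" .
  with eta assms show ?thesis
    by (auto simp: C2_def seminorm_eta_gamma_def alternating_def)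
qed

lemma C2_scale:
  assumes "f \<in> C2 N k K \<eta> \<gamma>"
  shows "(\<lambda>\<sigma>. c * f \<sigma>) \<in> C2 N k K \<eta> \<gamma>"
proof -
  have scale: "ennreal (\<bar>c * x\<bar> / d) = ennreal \<bar>c\<bar> * ennreal (\<bar>x\<bar> / d)" if "0 \<le> d" for x d :: real
    using that by (simp add: abs_mult flip: ennreal_mult)
  have "seminorm_eta N k K \<eta> (\<lambda>\<sigma>. c * f \<sigma>) \<le> ennreal \<bar>c\<bar> * seminorm_eta N k K \<eta> f"
    unfolding seminorm_eta_def by (intro SUP_least, subst scale) (auto intro!: mult_left_mono SUP_upper)
  also have "\<dots> < \<infinity>" using C2_finite(1)[OF assms] by (simp add: ennreal_mult_less_top)
  finally have eta: "seminorm_eta N k K \<eta> (\<lambda>\<sigma>. c * f \<sigma>) < \<infinity>" .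
  have "seminorm_delta N k K \<gamma> (\<lambda>\<sigma>. c * f \<sigma>) \<le> ennreal \<bar>c\<bar> * seminorm_delta N k K \<gamma> f"
    unfolding seminorm_delta_def[of N k K \<gamma> "\<lambda>\<sigma>. c * f \<sigma>"]
  proof (intro SUP_least)
    fix \<sigma> P assume \<sigma>: "\<sigma> \<in> simplices k K" and P: "P \<in> {P. subdivision N k \<sigma> P}"
    define d where "d = real (card P) * diam N \<sigma> powr \<gamma>"
    have up: "ennreal (\<bar>f \<sigma> - (\<Sum>\<sigma>'\<in>P. f \<sigma>')\<bar> / d) \<le> seminorm_delta N k K \<gamma> f"
      unfolding seminorm_delta_def d_def by (intro SUP_upper2[OF \<sigma>] SUP_upper P)
    have "c * f \<sigma> - (\<Sum>\<sigma>'\<in>P. c * f \<sigma>') = c * (f \<sigma> - (\<Sum>\<sigma>'\<in>P. f \<sigma>'))"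
      by (simp add: right_diff_distrib sum_distrib_left)
    then show "ennreal (\<bar>c * f \<sigma> - (\<Sum>\<sigma>'\<in>P. c * f \<sigma>')\<bar> / (real (card P) * diam N \<sigma> powr \<gamma>))
        \<le> ennreal \<bar>c\<bar> * seminorm_delta N k K \<gamma> f"
      using scale[of d "f \<sigma> - (\<Sum>\<sigma>'\<in>P. f \<sigma>')"] mult_left_mono[OF up, of "ennreal \<bar>c\<bar>"]
      by (simp add: d_def)
  qed
  also have "\<dots> < \<infinity>" using C2_finite(2)[OF assms] by (simp add: ennreal_mult_less_top)
  finally have "seminorm_delta N k K \<gamma> (\<lambda>\<sigma>. c * f \<sigma>) < \<infinity>" .
  with eta assms show ?thesis
    by (auto simp: C2_def seminorm_eta_gamma_def alternating_def)
qed

lemma sewing_add: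
  assumes f: "almost_additive k K \<gamma> E f" and g: "almost_additive k K \<gamma> E' g"
    and fg: "almost_additive k K \<gamma> E'' (\<lambda>\<sigma>. f \<sigma> + g \<sigma>)" and k: "0 < k" and \<gamma>: "real k < \<gamma>"
  shows "sewing k K (\<lambda>\<sigma>. f \<sigma> + g \<sigma>) = (\<lambda>\<sigma>. sewing k K f \<sigma> + sewing k K g \<sigma>)"
proof
  fix \<sigma>
  show "sewing k K (\<lambda>\<sigma>. f \<sigma> + g \<sigma>) \<sigma> = sewing k K f \<sigma> + sewing k K g \<sigma>"
  proof (cases "\<sigma> \<in> simplices k K")
    case True
    then obtain vs where vs: "\<sigma> = osimplex vs" "simplex_vertices k vs" "convex hull (set vs) \<subseteq> K"
      by (blast elim: simplicesE)
    have "cell_sum (\<lambda>\<sigma>. f \<sigma> + g \<sigma>) n vs = cell_sum f n vs + cell_sum g n vs" for n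
      by (simp add: cell_sum_def sum.distrib)
    then have "(\<lambda>n. cell_sum f n vs + cell_sum g n vs) \<longlonglongrightarrow> sewn (\<lambda>\<sigma>. f \<sigma> + g \<sigma>) vs"
      using cell_sum_limit(1)[OF fg k \<gamma> vs(2,3)] by simp
    moreover have "(\<lambda>n. cell_sum f n vs + cell_sum g n vs) \<longlonglongrightarrow> sewn f vs + sewn g vs"
      by (intro tendsto_add cell_sum_limit(1)[OF f k \<gamma> vs(2,3)] cell_sum_limit(1)[OF g k \<gamma> vs(2,3)])
    ultimately have "sewn (\<lambda>\<sigma>. f \<sigma> + g \<sigma>) vs = sewn f vs + sewn g vs" by (rule LIMSEQ_unique)
    then show ?thesis
      unfolding vs(1) sewing_osimplex[OF f k \<gamma> vs(2,3)] sewing_osimplex[OF g k \<gamma> vs(2,3)]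
        sewing_osimplex[OF fg k \<gamma> vs(2,3)] .
  qed (simp add: sewing_def)
qed

lemma sewing_scale:
  assumes f: "almost_additive k K \<gamma> E f"
    and cf: "almost_additive k K \<gamma> E' (\<lambda>\<sigma>. c * f \<sigma>)" and k: "0 < k" and \<gamma>: "real k < \<gamma>"
  shows "sewing k K (\<lambda>\<sigma>. c * f \<sigma>) = (\<lambda>\<sigma>. c * sewing k K f \<sigma>)"
proof
  fix \<sigma>
  show "sewing k K (\<lambda>\<sigma>. c * f \<sigma>) \<sigma> = c * sewing k K f \<sigma>"
  proof (cases "\<sigma> \<in> simplices k K")
    case True
    then obtain vs where vs: "\<sigma> = osimplex vs" "simplex_vertices k vs" "convex hull (set vs) \<subseteq> K"
      by (blast elim: simplicesE)
    have "cell_sum (\<lambda>\<sigma>. c * f \<sigma>) n vs = c * cell_sum f n vs" for n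
      by (simp add: cell_sum_def sum_distrib_left)
    then have "(\<lambda>n. c * cell_sum f n vs) \<longlonglongrightarrow> sewn (\<lambda>\<sigma>. c * f \<sigma>) vs"
      using cell_sum_limit(1)[OF cf k \<gamma> vs(2,3)] by simp
    moreover have "(\<lambda>n. c * cell_sum f n vs) \<longlonglongrightarrow> c * sewn f vs"
      by (intro tendsto_mult_left cell_sum_limit(1)[OF f k \<gamma> vs(2,3)])
    ultimately have "sewn (\<lambda>\<sigma>. c * f \<sigma>) vs = c * sewn f vs" by (rule LIMSEQ_unique)
    then show ?thesis
      unfolding vs(1) sewing_osimplex[OF f k \<gamma> vs(2,3)] sewing_osimplex[OF cf k \<gamma> vs(2,3)] .
  qed (simp add: sewing_def)
qed

text \<open>Diameters at most 1 and \<eta> < \<gamma> let the \<gamma>-th power be replaced by the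
  \<eta>-th. The second bound is then the first one plus the bound on \<open>\<Xi>\<close> itself,
  whence the constant \<open>1 + c\<close>.\<close>

lemma sewing_sewing_bounds:
  assumes k: "0 < k" and \<eta>: "\<eta> \<le> real k" and \<gamma>: "real k < \<gamma>"
    and V: "V \<subseteq> C2 N k K \<eta> \<gamma>"
  shows "sewing_bounds N k K \<eta> \<gamma> V (restrict (sewing k K) V)"
proof -
  define c where "c = sewing_const k \<gamma>"
  have c: "0 \<le> c" unfolding c_def by (rule sewing_const_nonneg[OF \<gamma>])
  have close: "\<bar>restrict (sewing k K) V \<Xi> \<sigma> - \<Xi> \<sigma>\<bar>
      \<le> c * enn2real (seminorm_delta N k K \<gamma> \<Xi>) * diam N \<sigma> powr \<gamma>"
    if "\<Xi> \<in> V" "\<sigma> \<in> simplices_le1 N k K" for \<Xi> \<sigma>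
    using sewing_close[OF C2_almost_additive[OF subsetD[OF V that(1)] k] k \<gamma>] that
    by (simp add: c_def simplices_le1_def)
  have small: "\<bar>restrict (sewing k K) V \<Xi> \<sigma>\<bar>
      \<le> (1 + c) * enn2real (seminorm_eta_gamma N k K \<eta> \<gamma> \<Xi>) * diam N \<sigma> powr \<eta>"
    if \<Xi>: "\<Xi> \<in> V" and \<sigma>: "\<sigma> \<in> simplices_le1 N k K" for \<Xi> \<sigma>
  proof -
    define E where "E = enn2real (seminorm_delta N k K \<gamma> \<Xi>)"
    define H where "H = enn2real (seminorm_eta N k K \<eta> \<Xi>)"
    have EH: "0 \<le> E" "0 \<le> H" by (simp_all add: E_def H_def)
    have sum: "enn2real (seminorm_eta_gamma N k K \<eta> \<gamma> \<Xi>) = H + E"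
      unfolding seminorm_eta_gamma_def H_def E_def
      using C2_finite[OF subsetD[OF V \<Xi>]] by (simp add: enn2real_plus)
    have \<sigma>': "\<sigma> \<in> simplices k K" "diam N \<sigma> \<le> 1" using \<sigma> by (simp_all add: simplices_le1_def)
    define d where "d = diam N \<sigma> powr \<eta>"
    have "diam N \<sigma> powr \<gamma> \<le> d"
      unfolding d_def using \<eta> \<gamma> \<sigma>'(2) by (intro powr_mono') auto
    then have "c * E * diam N \<sigma> powr \<gamma> \<le> c * E * d"
      using c EH by (intro mult_left_mono) auto
    moreover have "\<bar>\<Xi> \<sigma>\<bar> \<le> H * d"
      unfolding H_def d_def by (rule C2_eta_bound[OF subsetD[OF V \<Xi>] k \<sigma>'(1)])
    ultimately have "\<bar>restrict (sewing k K) V \<Xi> \<sigma>\<bar> \<le> H * d + c * E * d"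
      using close[OF \<Xi> \<sigma>] unfolding E_def[symmetric] by linarith
    also have "\<dots> \<le> (1 + c) * (H + E) * d"
    proof -
      have "0 \<le> d" by (simp add: d_def)
      then have "0 \<le> c * (H * d)" "0 \<le> E * d" using c EH by simp_all
      then show ?thesis by (simp add: algebra_simps)
    qed
    finally show ?thesis unfolding sum d_def .
  qed
  show ?thesis
    unfolding sewing_bounds_def using close small by blast
qed

text \<open>One argument for germs with and without measurability: apart from stability of
  \<open>V\<close> under the vector operations, it uses only that \<open>W\<close> consists of
  additive cochains and contains the sewn germs.\<close>

lemma sewing_theorem:
  assumes k: "0 < k" and \<eta>: "\<eta> \<le> real k" and \<gamma>: "real k < \<gamma>"
    and V: "V \<subseteq> C2 N k K \<eta> \<gamma>"
    and V_add: "\<And>f g. f \<in> V \<Longrightarrow> g \<in> V \<Longrightarrow> (\<lambda>\<sigma>. f \<sigma> + g \<sigma>) \<in> V"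
    and V_scale: "\<And>c f. f \<in> V \<Longrightarrow> (\<lambda>\<sigma>. c * f \<sigma>) \<in> V"
    and W: "W \<subseteq> additive_cochains N k K"
    and VW: "\<And>\<Xi>. \<Xi> \<in> V \<Longrightarrow> sewing k K \<Xi> \<in> W"
  shows "(\<exists>!I. linear_between V W I \<and> sewing_bounds N k K \<eta> \<gamma> V I) \<and>
     (\<forall>I. linear_between V W I \<and> sewing_bounds N k K \<eta> \<gamma> V I \<longrightarrow>
        (\<forall>\<Xi>\<in>V. \<forall>\<sigma>\<in>simplices k K. \<forall>P. regular_subdivisions N k \<sigma> P \<longrightarrow>
           (\<lambda>n. \<Sum>\<sigma>'\<in>P n. \<Xi> \<sigma>') \<longlonglongrightarrow> I \<Xi> \<sigma>))"
proof -
  have aa: "almost_additive k K \<gamma> (enn2real (seminorm_delta N k K \<gamma> \<Xi>)) \<Xi>" if "\<Xi> \<in> V" for \<Xi>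
    by (rule C2_almost_additive[OF subsetD[OF V that] k])
  have lim: "(\<lambda>n. \<Sum>\<sigma>'\<in>P n. \<Xi> \<sigma>') \<longlonglongrightarrow> I \<Xi> \<sigma>"
    if I: "linear_between V W I" "sewing_bounds N k K \<eta> \<gamma> V I" and \<Xi>: "\<Xi> \<in> V"
      and \<sigma>: "\<sigma> \<in> simplices k K" and P: "regular_subdivisions N k \<sigma> P" for I \<Xi> \<sigma> P
  proof -
    have "I \<Xi> \<in> additive_cochains N k K" using I(1) \<Xi> W by (auto simp: linear_between_def)
    then have "I \<Xi> \<sigma> = (\<Sum>\<tau>\<in>Q. I \<Xi> \<tau>)" if "subdivision N k \<sigma> Q" for Q
      using \<sigma> that by (simp add: additive_cochains_def)
    moreover obtain c where "\<And>\<tau>. \<tau> \<in> simplices_le1 N k K \<Longrightarrow>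
        \<bar>I \<Xi> \<tau> - \<Xi> \<tau>\<bar> \<le> c * enn2real (seminorm_delta N k K \<gamma> \<Xi>) * diam N \<tau> powr \<gamma>"
      using I(2) \<Xi> unfolding sewing_bounds_def by blast
    ultimately show ?thesis by (rule regular_limit[OF \<gamma> \<sigma> P])
  qed
  have unique: "I = J"
    if I: "linear_between V W I" "sewing_bounds N k K \<eta> \<gamma> V I"
      and J: "linear_between V W J" "sewing_bounds N k K \<eta> \<gamma> V J" for I J
  proof (rule PiE_ext[of I V "\<lambda>_. W" J])
    \<comment> \<open>Maps in \<open>V \<rightarrow>\<^sub>E W\<close> are determined by their
      values on \<open>V\<close>, and cochains vanish off \<open>simplices k K\<close>, so only
      germs in \<open>V\<close> on simplices in \<open>K\<close> remain to be compared.\<close>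
    show IJ: "I \<in> V \<rightarrow>\<^sub>E W" "J \<in> V \<rightarrow>\<^sub>E W" using I(1) J(1) by (auto simp: linear_between_def)
    fix \<Xi> assume \<Xi>: "\<Xi> \<in> V"
    have alt: "alternating k K (I \<Xi>)" "alternating k K (J \<Xi>)"
      using PiE_mem[OF IJ(1) \<Xi>] PiE_mem[OF IJ(2) \<Xi>] W by (auto simp: additive_cochains_def)
    show "I \<Xi> = J \<Xi>"
    proof
      fix \<sigma>
      show "I \<Xi> \<sigma> = J \<Xi> \<sigma>"
      proof (cases "\<sigma> \<in> simplices k K")
        case True
        obtain vs where vs: "\<sigma> = osimplex vs" "simplex_vertices k vs"
          using True by (blast elim: simplicesE)
        \<comment> \<open>Both maps have to be the limit of the same sums along this one regular
          sequence.\<close>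
        have reg: "regular_subdivisions N k \<sigma> (\<lambda>n. cell_set n vs)"
          unfolding vs(1) by (rule regular_cell_sets[OF vs(2) k])
        show ?thesis by (rule LIMSEQ_unique[OF lim[OF I \<Xi> True reg] lim[OF J \<Xi> True reg]])
      next
        case False
        then show ?thesis using alt by (simp add: alternating_def)
      qed
    qed
  qed
  have "linear_between V W (restrict (sewing k K) V)"
    unfolding linear_between_def
  proof (intro conjI ballI allI)
    show "restrict (sewing k K) V \<in> V \<rightarrow>\<^sub>E W" using VW by auto
    show "restrict (sewing k K) V (\<lambda>x. f x + g x)
        = (\<lambda>x. restrict (sewing k K) V f x + restrict (sewing k K) V g x)" if "f \<in> V" "g \<in> V" for f g
      using sewing_add[OF aa aa aa[OF V_add] k \<gamma>] that V_add by simp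
    show "restrict (sewing k K) V (\<lambda>x. c * f x) = (\<lambda>x. c * restrict (sewing k K) V f x)"
      if "f \<in> V" for c f
      using sewing_scale[OF aa aa[OF V_scale] k \<gamma>] that V_scale by simp
  qed
  then have ex: "linear_between V W (restrict (sewing k K) V) \<and>
      sewing_bounds N k K \<eta> \<gamma> V (restrict (sewing k K) V)"
    using sewing_sewing_bounds[OF k \<eta> \<gamma> V] by blast
  have "\<exists>!I. linear_between V W I \<and> sewing_bounds N k K \<eta> \<gamma> V I"
  proof (rule ex1I)
    show "J = restrict (sewing k K) V" if "linear_between V W J \<and> sewing_bounds N k K \<eta> \<gamma> V J" for J
      using unique[of J "restrict (sewing k K) V"] that ex by blast
  qed (rule ex)
  moreover have "\<forall>I. linear_between V W I \<and> sewing_bounds N k K \<eta> \<gamma> V I \<longrightarrow>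
        (\<forall>\<Xi>\<in>V. \<forall>\<sigma>\<in>simplices k K. \<forall>P. regular_subdivisions N k \<sigma> P \<longrightarrow>
           (\<lambda>n. \<Sum>\<sigma>'\<in>P n. \<Xi> \<sigma>') \<longlonglongrightarrow> I \<Xi> \<sigma>)"
    by (intro allI ballI impI, elim conjE) (rule lim)
  ultimately show ?thesis by (rule conjI)
qed

lemma C2_sewing_in_additive_cochains:
  assumes "0 < k" "real k < \<gamma>" "\<Xi> \<in> C2 N k K \<eta> \<gamma>"
  shows "sewing k K \<Xi> \<in> additive_cochains N k K"
  using assms by (intro sewing_in_additive_cochains[OF C2_almost_additive]) (auto simp: C2_def)

end

theorem proposition2p19:
  fixes N :: "real ^ 'd \<Rightarrow> real" and K :: "(real ^ 'd) set"
    and k :: nat and \<eta> \<gamma> :: real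
  assumes "is_norm N"
    and "0 < \<eta>" and "\<eta> \<le> real k" and "real k < \<gamma>"
  shows "\<forall>(V, W) \<in> {(C2_measurable N k K \<eta> \<gamma>, Omega N k K),
                     (C2 N k K \<eta> \<gamma>, additive_cochains N k K)}.
     (\<exists>!I. linear_between V W I \<and> sewing_bounds N k K \<eta> \<gamma> V I) \<and>
     (\<forall>I. linear_between V W I \<and> sewing_bounds N k K \<eta> \<gamma> V I \<longrightarrow>
        (\<forall>\<Xi>\<in>V. \<forall>\<sigma>\<in>simplices k K. \<forall>P. regular_subdivisions N k \<sigma> P \<longrightarrow>
           (\<lambda>n. \<Sum>\<sigma>'\<in>P n. \<Xi> \<sigma>') \<longlonglongrightarrow> I \<Xi> \<sigma>))"
proof -
  interpret arbitrary_norm N by unfold_locales (rule assms(1))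
  \<comment> \<open>The condition 0 < \<eta> \<le> k rules out 0-simplices, which have diameter 0
    and no odd reordering.\<close>
  have k: "0 < k" using assms(2,3) by (cases k) auto
  let ?P = "\<lambda>V W. (\<exists>!I. linear_between V W I \<and> sewing_bounds N k K \<eta> \<gamma> V I) \<and>
     (\<forall>I. linear_between V W I \<and> sewing_bounds N k K \<eta> \<gamma> V I \<longrightarrow>
        (\<forall>\<Xi>\<in>V. \<forall>\<sigma>\<in>simplices k K. \<forall>P. regular_subdivisions N k \<sigma> P \<longrightarrow>
           (\<lambda>n. \<Sum>\<sigma>'\<in>P n. \<Xi> \<sigma>') \<longlonglongrightarrow> I \<Xi> \<sigma>))"
  note in_cochains = C2_sewing_in_additive_cochains[OF k assms(4), where \<eta> = \<eta> and K = K]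
  have general: "?P (C2 N k K \<eta> \<gamma>) (additive_cochains N k K)"
    by (rule sewing_theorem[OF k assms(3,4) order_refl C2_add C2_scale order_refl in_cochains])
  have measurable: "?P (C2_measurable N k K \<eta> \<gamma>) (Omega N k K)"
  proof (rule sewing_theorem[OF k assms(3,4)])
    show "C2_measurable N k K \<eta> \<gamma> \<subseteq> C2 N k K \<eta> \<gamma>" by (auto simp: C2_measurable_def)
    show "Omega N k K \<subseteq> additive_cochains N k K" by (auto simp: Omega_def)
    show "sewing k K \<Xi> \<in> Omega N k K" if "\<Xi> \<in> C2_measurable N k K \<eta> \<gamma>" for \<Xi>
    proof -
      have "\<Xi> \<in> C2 N k K \<eta> \<gamma>" "measurable_cochain k K \<Xi>"
        using that by (simp_all add: C2_measurable_def)
      then show ?thesis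
        using in_cochains measurable_cochain_sewing[OF C2_almost_additive[OF _ k] k assms(4)]
        by (simp add: Omega_def)
    qed
    show "(\<lambda>\<sigma>. f \<sigma> + g \<sigma>) \<in> C2_measurable N k K \<eta> \<gamma>"
      if "f \<in> C2_measurable N k K \<eta> \<gamma>" "g \<in> C2_measurable N k K \<eta> \<gamma>" for f g
    proof -
      have "measurable_cochain k K f" "measurable_cochain k K g" "f \<in> C2 N k K \<eta> \<gamma>" "g \<in> C2 N k K \<eta> \<gamma>"
        using that by (simp_all add: C2_measurable_def)
      then show ?thesis
        unfolding C2_measurable_def measurable_cochain_def
        by (intro CollectI conjI C2_add borel_measurable_add)
    qed
    show "(\<lambda>\<sigma>. c * f \<sigma>) \<in> C2_measurable N k K \<eta> \<gamma>"
      if "f \<in> C2_measurable N k K \<eta> \<gamma>" for c f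
    proof -
      have "measurable_cochain k K f" "f \<in> C2 N k K \<eta> \<gamma>"
        using that by (simp_all add: C2_measurable_def)
      then show ?thesis
        unfolding C2_measurable_def measurable_cochain_def
        by (intro CollectI conjI C2_scale borel_measurable_times borel_measurable_const)
    qed
  qed
  show ?thesis
  proof (rule ballI)
    fix VW
    assume "VW \<in> {(C2_measurable N k K \<eta> \<gamma>, Omega N k K), (C2 N k K \<eta> \<gamma>, additive_cochains N k K)}"
    then consider "VW = (C2_measurable N k K \<eta> \<gamma>, Omega N k K)"
      | "VW = (C2 N k K \<eta> \<gamma>, additive_cochains N k K)" by blast
    then show "case VW of (V, W) \<Rightarrow> ?P V W"
    proof cases
      case 1
      show ?thesis unfolding 1 prod.case by (rule measurable)
    next
      case 2
      show ?thesis unfolding 2 prod.case by (rule general)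
    qed
  qed
qed

end
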